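(* Let $X\subset\mathbb{P}^9$ be the graph hypersurface for $\Gamma=ZZ_5$, defined by the graph polynomial $\Psi_\Gamma$, and let $\eta=\Omega_9/\Psi_\Gamma^2$. Then the de Rham class of $\eta$ spans the top-degree de Rham cohomology of the complement: $$K[\eta]=H^9_{DR}(\mathbb{P}^9\setminus X).$$
   Context: Work over an algebraically closed field $K$ of characteristic $0$; $K[\eta]$ denotes the $K$-span of the class $[\eta]$. The graph $ZZ_5$ has vertices $1,\dots,6$ and ten edges: $\{i,i+1\}$ for $1\le i\le5$, $\{i,i+2\}$ for $1\le i\le4$, and $\{1,6\}$. For a finite connected graph $\Gamma$ with $N$ edges, the graph polynomial is $\Psi_\Gamma=\sum_T\prod_{e\notin T}A_e$ (sum over spanning trees $T$), and the graph hypersurface is $\{\Psi_\Gamma=0\}\subset\mathbb{P}^{N-1}$. On $\mathbb{P}^{N-1}$ with homogeneous coordinates $A_1,\dots,A_N$, $\Omega_{N-1}=\sum_{i=1}^{N}(-1)^iA_i\,dA_1\wedge\dots\wedge\widehat{dA_i}\wedge\dots\wedge dA_N$. *)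

theory Defs
  imports
    "HOL-Library.Poly_Mapping"
    "HOL-Computational_Algebra.Computational_Algebra"
begin

section \<open>Polynomials and rational functions in the variables \<open>A\<^sub>i\<close>\<close>

text \<open>
  A monomial is a finitely supported exponent function; the variables are indexed by all of
  \<^typ>\<open>nat\<close>, and the restriction to \<open>A\<^sub>1, \<dots>, A\<^sub>N\<close> is part of the predicate \<open>homogeneous\<close> below.
\<close>

type_synonym 'a mpoly = "(nat \<Rightarrow>\<^sub>0 nat) \<Rightarrow>\<^sub>0 'a"

type_synonym 'a ratfun = "'a mpoly fract"

definition Var :: "nat \<Rightarrow> 'a::comm_ring_1 mpoly"
  where "Var i = Poly_Mapping.single (Poly_Mapping.single i 1) 1"

definition Const :: "'a::comm_ring_1 \<Rightarrow> 'a mpoly"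
  where "Const c = Poly_Mapping.single 0 c"

definition homogeneous :: "nat \<Rightarrow> nat \<Rightarrow> 'a::comm_ring_1 mpoly \<Rightarrow> bool"
  where "homogeneous N d F \<longleftrightarrow>
    (\<forall>m \<in> Poly_Mapping.keys F.
       Poly_Mapping.keys m \<subseteq> {1..N} \<and> (\<Sum>i\<in>{1..N}. Poly_Mapping.lookup m i) = d)"

definition mpderiv :: "nat \<Rightarrow> 'a::comm_ring_1 mpoly \<Rightarrow> 'a mpoly"
  where "mpderiv i F =
    (\<Sum>m \<in> Poly_Mapping.keys F.
       Poly_Mapping.single (m - Poly_Mapping.single i 1)
         (of_nat (Poly_Mapping.lookup m i) * Poly_Mapping.lookup F m))"

lemma mpderiv_superset:
  assumes "finite M" "Poly_Mapping.keys F \<subseteq> M"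
  shows "mpderiv i F =
    (\<Sum>m\<in>M. Poly_Mapping.single (m - Poly_Mapping.single i 1)
       (of_nat (Poly_Mapping.lookup m i) * Poly_Mapping.lookup F m))"
  unfolding mpderiv_def
  by (rule sum.mono_neutral_left) (use assms in \<open>auto simp: in_keys_iff\<close>)

lemma mpderiv_add: "mpderiv i (F + G) = mpderiv i F + mpderiv i G"
proof -
  let ?M = "Poly_Mapping.keys F \<union> Poly_Mapping.keys G"
  have "Poly_Mapping.keys (F + G) \<subseteq> ?M"
    by (rule Poly_Mapping.keys_add)
  then show ?thesis
    by (subst (1 2 3) mpderiv_superset[of ?M])
       (auto simp: lookup_add distrib_left single_add sum.distrib)
qed

lemma mpderiv_zero [simp]: "mpderiv i 0 = 0"
  by (simp add: mpderiv_def)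

lemma mpderiv_single:
  "mpderiv i (Poly_Mapping.single m c) =
     Poly_Mapping.single (m - Poly_Mapping.single i 1) (of_nat (Poly_Mapping.lookup m i) * c)"
  by (cases "c = 0") (simp_all add: mpderiv_def)

lemma single_minus_shift:
  "Poly_Mapping.single (m + n - Poly_Mapping.single i 1) (of_nat (Poly_Mapping.lookup m i) * c) =
   Poly_Mapping.single ((m - Poly_Mapping.single i 1) + n)
     (of_nat (Poly_Mapping.lookup m i) * (c :: 'a::comm_ring_1))"
  for m n :: "nat \<Rightarrow>\<^sub>0 nat"
proof (cases "Poly_Mapping.lookup m i = 0")
  case False
  then have "m + n - Poly_Mapping.single i 1 = (m - Poly_Mapping.single i 1) + n"
    by (intro poly_mapping_eqI) (auto simp: lookup_add lookup_minus lookup_single when_def)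
  then show ?thesis by simp
qed simp

lemma mpderiv_mult_single:
  "mpderiv i (Poly_Mapping.single m c * Poly_Mapping.single n e) =
     Poly_Mapping.single m c * mpderiv i (Poly_Mapping.single n e)
     + mpderiv i (Poly_Mapping.single m c) * Poly_Mapping.single n (e :: 'a::comm_ring_1)"
proof -
  have "mpderiv i (Poly_Mapping.single m c * Poly_Mapping.single n e) =
      Poly_Mapping.single (m + n - Poly_Mapping.single i 1)
        (of_nat (Poly_Mapping.lookup m i) * (c * e))
      + Poly_Mapping.single (n + m - Poly_Mapping.single i 1)
        (of_nat (Poly_Mapping.lookup n i) * (c * e))"
    by (simp add: mult_single mpderiv_single lookup_add distrib_right add.commute
        flip: single_add)
  then show ?thesis
    unfolding single_minus_shift by (simp add: mult_single mpderiv_single ac_simps)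
qed

lemma mpoly_induct [case_names zero add]:
  fixes F :: "'a::comm_ring_1 mpoly"
  assumes "P 0" "\<And>F m c. P F \<Longrightarrow> P (F + Poly_Mapping.single m c)"
  shows "P F"
proof (induction F rule: update_induct)
  case const
  show ?case using assms(1) by simp
next
  case (update F m c)
  have "Poly_Mapping.update m c F = F + Poly_Mapping.single m c"
    using update.hyps
    by (intro poly_mapping_eqI)
       (auto simp: lookup_add lookup_single lookup_update in_keys_iff when_def)
  with assms(2) update show ?case by simp
qed

lemma mpderiv_mult: "mpderiv i (F * G) = F * mpderiv i G + mpderiv i F * G"
proof (induction F rule: mpoly_induct)
  case zero
  show ?case by simp
next
  case (add F m c)
  have "mpderiv i (Poly_Mapping.single m c * G) =
      Poly_Mapping.single m c * mpderiv i G + mpderiv i (Poly_Mapping.single m c) * G"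
  proof (induction G rule: mpoly_induct)
    case zero
    show ?case by simp
  next
    case (add G n e)
    then show ?case by (simp add: mpderiv_add mpderiv_mult_single distrib_left)
  qed
  with add show ?case by (simp add: mpderiv_add distrib_right)
qed

text \<open>The partial derivative \<open>\<partial>/\<partial>A\<^sub>i\<close> of rational functions, by the quotient rule.\<close>

definition rderiv :: "nat \<Rightarrow> 'a::field ratfun \<Rightarrow> 'a ratfun"
  where "rderiv i q = (THE r. \<exists>a b. b \<noteq> 0 \<and> q = Fract a b \<and>
    r = Fract (mpderiv i a * b - a * mpderiv i b) (b * b))"

lemma rderiv_Fract:
  assumes "b \<noteq> 0"
  shows "rderiv i (Fract a b) = Fract (mpderiv i a * b - a * mpderiv i b) (b * b)"
  unfolding rderiv_def
proof (rule the_equality)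
  fix r
  assume "\<exists>a' b'. b' \<noteq> 0 \<and> Fract a b = Fract a' b' \<and>
    r = Fract (mpderiv i a' * b' - a' * mpderiv i b') (b' * b')"
  then obtain c d where nz: "d \<noteq> 0" and eq: "a * d = c * b"
    and r: "r = Fract (mpderiv i c * d - c * mpderiv i d) (d * d)"
    using assms by (auto simp: eq_fract)
  have "a * mpderiv i d + mpderiv i a * d = c * mpderiv i b + mpderiv i c * b"
    using arg_cong[OF eq, of "mpderiv i"] by (simp only: mpderiv_mult)
  then have "(mpderiv i c * d - c * mpderiv i d) * (b * b) =
      (mpderiv i a * b - a * mpderiv i b) * (d * d)"
    using eq by algebra
  with nz assms r show "r = Fract (mpderiv i a * b - a * mpderiv i b) (b * b)"
    by (simp add: eq_fract)
qed (use assms in blast)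

section \<open>Algebraic de Rham cohomology of the complement of a projective hypersurface\<close>

text \<open>
  A form on (an open subset of) affine \<open>N\<close>-space is given by its coefficients: \<open>\<omega> I\<close> is the
  coefficient of \<open>dA\<^sub>i\<^sub>1 \<and> \<dots> \<and> dA\<^sub>i\<^sub>p\<close> where \<open>I = {i\<^sub>1 < \<dots> < i\<^sub>p}\<close>.
\<close>

type_synonym 'a form = "nat set \<Rightarrow> 'a ratfun"

definition smult_form :: "'a::field \<Rightarrow> 'a form \<Rightarrow> 'a form"
  where "smult_form c \<omega> = (\<lambda>I. Fract (Const c) 1 * \<omega> I)"

definition pos_sign :: "nat \<Rightarrow> nat set \<Rightarrow> 'a::field ratfun"
  where "pos_sign j I = (-1) ^ card {i \<in> I. i < j}"

definition ext_deriv :: "nat \<Rightarrow> 'a::field form \<Rightarrow> 'a form"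
  where "ext_deriv N \<omega> = (\<lambda>J.
    if J \<subseteq> {1..N} then \<Sum>j\<in>J. pos_sign j J * rderiv j (\<omega> (J - {j})) else 0)"

text \<open>Contraction with the Euler vector field \<open>\<Sum>\<^sub>j A\<^sub>j \<partial>/\<partial>A\<^sub>j\<close>.\<close>

definition euler_contraction :: "nat \<Rightarrow> 'a::field form \<Rightarrow> 'a form"
  where "euler_contraction N \<omega> = (\<lambda>I.
    if I \<subseteq> {1..N} then \<Sum>j\<in>{1..N} - I. pos_sign j I * Fract (Var j) 1 * \<omega> (insert j I) else 0)"

text \<open>
  Regular \<open>p\<close>-forms on \<open>U = \<P>\<^sup>N\<^sup>-\<^sup>1 - {f = 0}\<close>, for \<open>f\<close> homogeneous, in homogeneous coordinates.
  Pullback to the affine cone identifies them (Euler sequence) with the \<open>p\<close>-forms on \<open>{f \<noteq> 0}\<close> in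
  affine \<open>N\<close>-space that are homogeneous of degree 0, where each \<open>dA\<^sub>i\<close> has degree 1, and are killed
  by contraction with the Euler field. So the coefficient of each \<open>dA\<^sub>I\<close> is \<open>F / f^k\<close> of degree \<open>-p\<close>.
\<close>

definition regular_forms :: "nat \<Rightarrow> 'a::field mpoly \<Rightarrow> nat \<Rightarrow> 'a form set"
  where "regular_forms N f p = {\<omega>.
    (\<forall>I. \<not> (I \<subseteq> {1..N} \<and> card I = p) \<longrightarrow> \<omega> I = 0) \<and>
    (\<forall>I. I \<subseteq> {1..N} \<and> card I = p \<longrightarrow>
       (\<exists>F k d. homogeneous N d F \<and> homogeneous N (d + p) (f ^ k) \<and> \<omega> I = Fract F (f ^ k))) \<and>
    euler_contraction N \<omega> = (\<lambda>_. 0)}"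

text \<open>
  Since \<open>U\<close> is affine, its algebraic de Rham cohomology is the cohomology of the complex of
  global regular forms.
\<close>

definition closed_forms :: "nat \<Rightarrow> 'a::field mpoly \<Rightarrow> nat \<Rightarrow> 'a form set"
  where "closed_forms N f p = {\<omega> \<in> regular_forms N f p. ext_deriv N \<omega> = (\<lambda>_. 0)}"

definition exact_forms :: "nat \<Rightarrow> 'a::field mpoly \<Rightarrow> nat \<Rightarrow> 'a form set"
  where "exact_forms N f p =
    (case p of 0 \<Rightarrow> {\<lambda>_. 0} | Suc q \<Rightarrow> ext_deriv N ` regular_forms N f q)"

definition cohomologous :: "nat \<Rightarrow> 'a::field mpoly \<Rightarrow> nat \<Rightarrow> ('a form \<times> 'a form) set"
  where "cohomologous N f p = {(\<omega>, \<omega>').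
    \<omega> \<in> closed_forms N f p \<and> \<omega>' \<in> closed_forms N f p \<and>
    (\<lambda>I. \<omega> I - \<omega>' I) \<in> exact_forms N f p}"

definition de_rham_cohomology :: "nat \<Rightarrow> 'a::field mpoly \<Rightarrow> nat \<Rightarrow> 'a form set set"
  where "de_rham_cohomology N f p = closed_forms N f p // cohomologous N f p"

text \<open>The class of a form that is not closed is empty, hence not in the cohomology.\<close>

definition de_rham_class :: "nat \<Rightarrow> 'a::field mpoly \<Rightarrow> nat \<Rightarrow> 'a form \<Rightarrow> 'a form set"
  where "de_rham_class N f p \<omega> = cohomologous N f p `` {\<omega>}"

text \<open>The line \<open>K[\<omega>]\<close>; scalar multiplication on classes is \<open>c[\<omega>] = [c\<omega>]\<close>.\<close>

definition class_span :: "nat \<Rightarrow> 'a::field mpoly \<Rightarrow> nat \<Rightarrow> 'a form \<Rightarrow> 'a form set set"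
  where "class_span N f p \<omega> = range (\<lambda>c. de_rham_class N f p (smult_form c \<omega>))"

text \<open>\<open>\<Omega>\<^sub>N\<^sub>-\<^sub>1 = \<Sum>\<^sub>i (-1)\<^sup>i A\<^sub>i dA\<^sub>1 \<and> \<dots> \<and> dA\<^sub>N\<close> with \<open>dA\<^sub>i\<close> omitted.\<close>

definition Omega :: "nat \<Rightarrow> 'a::field form"
  where "Omega N = (\<lambda>I. \<Sum>i\<in>{1..N}.
    if I = {1..N} - {i} then (-1) ^ i * Fract (Var i) 1 else 0)"

section \<open>Graph polynomials\<close>

text \<open>
  A finite simple graph is a vertex set together with a list of distinct two-element sets of
  vertices, its edges; the \<open>i\<close>-th edge, counted from 1, carries the variable \<open>A\<^sub>i\<close>.
\<close>

definition connected_graph :: "'v set \<Rightarrow> 'v set set \<Rightarrow> bool"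
  where "connected_graph V T \<longleftrightarrow> (\<forall>u\<in>V. \<forall>v\<in>V. (u, v) \<in> {(x, y). {x, y} \<in> T}\<^sup>*)"

definition is_cycle :: "'v set set \<Rightarrow> 'v list \<Rightarrow> bool"
  where "is_cycle T c \<longleftrightarrow> length c \<ge> 3 \<and> distinct c \<and>
    (\<forall>i<length c. {c ! i, c ! (Suc i mod length c)} \<in> T)"

definition spanning_tree :: "'v set \<Rightarrow> 'v set list \<Rightarrow> 'v set set \<Rightarrow> bool"
  where "spanning_tree V es T \<longleftrightarrow>
    T \<subseteq> set es \<and> connected_graph V T \<and> (\<nexists>c. is_cycle T c)"

definition graph_polynomial :: "'v set \<Rightarrow> 'v set list \<Rightarrow> 'a::comm_ring_1 mpoly"
  where "graph_polynomial V es =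
    (\<Sum>T | spanning_tree V es T. \<Prod>i | i \<in> {1..length es} \<and> es ! (i - 1) \<notin> T. Var i)"

definition ZZ5_vertices :: "nat set"
  where "ZZ5_vertices = {1..6}"

definition ZZ5_edges :: "nat set list"
  where "ZZ5_edges =
    map (\<lambda>i. {i, i + 1}) [1..<6] @ map (\<lambda>i. {i, i + 2}) [1..<5] @ [{1, 6}]"

definition Psi_ZZ5 :: "'a::comm_ring_1 mpoly"
  where "Psi_ZZ5 = graph_polynomial ZZ5_vertices ZZ5_edges"

definition eta_ZZ5 :: "'a::field form"
  where "eta_ZZ5 = (\<lambda>I. Omega 10 I / Fract (Psi_ZZ5 ^ 2) 1)"

end

theory Submission imports Defs begin

text \<open>
  With linear coordinates \<open>a, t, c, v, r, b, z, y, u, D\<close> on the affine cone, \<open>\<Psi>\<close> is the determinant of a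
  symmetric \<open>5 \<times> 5\<close> matrix,
  \<open>\<Psi> = c AA - v\<^sup>2 De - 2 v r ka - r\<^sup>2 PP\<close> with \<open>sg AA = PP De - ka\<^sup>2\<close>, \<open>PP = sg a - al\<close> and
  \<open>De = sg t - ep\<close>, where \<open>sg, al, ep, ka\<close> involve only \<open>b, z, y, u, D\<close>.

  Top-degree forms modulo exact forms are functions \<open>G / \<Psi>\<^sup>k\<close> modulo divergences. If \<open>1 / \<Psi>\<^sup>2\<close> together
  with the divergences did not span, some linear functional would kill all of them without being zero.
  Integration by parts in \<open>c, v, r\<close> shows that such a functional only depends on residue-like data on
  the space of \<open>(a, t, b, z, y, u, D)\<close>; integration by parts in \<open>a, t\<close> reduces it further to a functional
  \<open>Phi\<close> on \<open>K[b, z, y, u, D, 1 / (sg u k0)]\<close> (with \<open>ka = u k0\<close>) that kills all derivatives and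
  \<open>1 / (sg u k0)\<close>. Elimination of \<open>z\<close> and \<open>u\<close>, using that \<open>k0 = b (D - y - u) + y z\<close> is linear in both, and
  a weight argument for the monomials \<open>b\<^sup>i y\<^sup>j D\<^sup>l u\<^sup>m / sg\<^sup>s\<close> show that \<open>Phi = 0\<close>. Taking homogeneous
  components and contracting with the Euler field turns the resulting decomposition of \<open>G / \<Psi>\<^sup>k\<close> into
  the cohomology statement.
\<close>

section \<open>Derivations and generated subrings\<close>

text \<open>The matrix is the cycle matrix of the graph for the triangles 123, 234, 345, 456 and the
  square 1-2-4-6. Its diagonal entries \<open>b, D, a, c, t\<close> are the edge sums of these
  cycles, and its other entries are, up to sign, the shared edges \<open>y, u, v, r, z\<close> and
  \<open>D - y - u\<close>. The cycle of \<open>c\<close> meets only those of \<open>a\<close> and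
  \<open>t\<close>, which makes the polynomial linear in \<open>c\<close> and a quadratic form in
  \<open>(v, r)\<close> otherwise.

  The geometric model is an iterated residue: Gaussian integration over \<open>v, r\<close>, a
  simple pole along \<open>AA = 0\<close>, then a Laurent coefficient in the torus coordinate
  \<open>PP\<close> of the surface \<open>PP De = ka^2\<close>. The obstacle is that
  \<open>AA, PP, De, ka, sg\<close> are not invertible on the complement, so none of these
  operations is available for forms. For a functional it is enough to know its values on monomials:
  each residue rule becomes a recursion in the exponents that divides by nonzero integers only, and
  the absence of a pole becomes the vanishing of boundary values.\<close>

locale derivation =
  fixes d :: "'f::field \<Rightarrow> 'f"
  assumes d_add [simp]: "d (x + y) = d x + d y"
    and d_mult [simp]: "d (x * y) = x * d y + d x * y"
begin

lemma d_zero [simp]: "d 0 = 0"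
proof -
  have "d 0 + 0 = d 0 + d 0" using d_add[of 0 0] by simp
  then show ?thesis by (simp only: add_left_cancel)
qed

lemma d_one [simp]: "d 1 = 0"
proof -
  have "d 1 + 0 = d 1 + d 1" using d_mult[of 1 1] by simp
  then show ?thesis by (simp only: add_left_cancel)
qed

lemma d_minus [simp]: "d (- x) = - d x"
  using d_add[of x "- x"] by (simp add: eq_neg_iff_add_eq_0 add.commute)

lemma d_diff [simp]: "d (x - y) = d x - d y"
  using d_add[of x "- y"] by simp

lemma d_of_nat [simp]: "d (of_nat n) = 0"
  by (induction n) simp_all

lemma d_numeral [simp]: "d (numeral n) = 0"
  using d_of_nat[of "numeral n"] by simp

lemma d_power: "d (x ^ n) = of_nat n * x ^ (n - 1) * d x"
proof (induction n)
  case (Suc n)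
  have "d (x ^ Suc n) = x * (of_nat n * x ^ (n - 1) * d x) + d x * x ^ n"
    by (simp only: power_Suc d_mult Suc)
  also have "x * (of_nat n * x ^ (n - 1) * d x) = of_nat n * x ^ n * d x"
    by (cases n) simp_all
  finally have "d (x ^ Suc n) = of_nat n * x ^ n * d x + d x * x ^ n" .
  also have "\<dots> = of_nat (Suc n) * x ^ (Suc n - 1) * d x"
    by (simp add: algebra_simps)
  finally show ?case .
qed simp

lemma d_power2 [simp]: "d (x\<^sup>2) = 2 * x * d x"
  by (simp add: d_power)

lemma d_divide_power:
  assumes g: "g \<noteq> 0"
  shows "d (x / g ^ n) = d x / g ^ n - of_nat n * (x * d g / g ^ Suc n)"
proof (induction n)
  case 0
  then show ?case by simp
next
  case (Suc n)
  have "x / g ^ n = x / g ^ Suc n * g" using g by simp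
  then have "d (x / g ^ n) = x / g ^ Suc n * d g + d (x / g ^ Suc n) * g"
    by (simp only: d_mult)
  then have "d (x / g ^ Suc n) = (d (x / g ^ n) - x / g ^ Suc n * d g) / g"
    using g by (metis add_diff_cancel_left' nonzero_mult_div_cancel_right)
  also have "\<dots> = (d x / g ^ n - of_nat n * (x * d g / g ^ Suc n) - x / g ^ Suc n * d g) / g"
    by (simp only: Suc)
  also have "\<dots> = d x / g ^ Suc n - of_nat (Suc n) * (x * d g / g ^ Suc (Suc n))"
    using g by (simp add: diff_divide_distrib add_divide_distrib algebra_simps)
  finally show ?case .
qed

end

text \<open>Every ring of the proof lies in one ambient field, so localising just means adding an
  inverse such as \<open>1 / sg\<close> to the generators.\<close>

inductive_set ring_gen :: "'f::comm_ring_1 set \<Rightarrow> 'f set" for S where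
  gen: "x \<in> S \<Longrightarrow> x \<in> ring_gen S"
| one [simp]: "1 \<in> ring_gen S"
| minus: "x \<in> ring_gen S \<Longrightarrow> - x \<in> ring_gen S"
| add: "x \<in> ring_gen S \<Longrightarrow> y \<in> ring_gen S \<Longrightarrow> x + y \<in> ring_gen S"
| mult: "x \<in> ring_gen S \<Longrightarrow> y \<in> ring_gen S \<Longrightarrow> x * y \<in> ring_gen S"

lemma ring_gen_zero [simp]: "0 \<in> ring_gen S"
  using ring_gen.add[OF ring_gen.one ring_gen.minus[OF ring_gen.one]] by simp

lemma ring_gen_diff: "x \<in> ring_gen S \<Longrightarrow> y \<in> ring_gen S \<Longrightarrow> x - y \<in> ring_gen S"
  using ring_gen.add[of x S "- y"] ring_gen.minus[of y S] by simp

lemma ring_gen_power: "x \<in> ring_gen S \<Longrightarrow> x ^ n \<in> ring_gen S"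
  by (induction n) (auto intro: ring_gen.mult)

lemma ring_gen_of_nat [simp]: "of_nat n \<in> ring_gen S"
  by (induction n) (auto intro: ring_gen.add)

lemma ring_gen_numeral [simp]: "numeral n \<in> ring_gen S"
  using ring_gen_of_nat[of "numeral n" S] by simp

lemmas ring_gen_closed = ring_gen.minus ring_gen.add ring_gen.mult ring_gen_diff ring_gen_power

lemma ring_gen_subset: "S \<subseteq> ring_gen S' \<Longrightarrow> x \<in> ring_gen S \<Longrightarrow> x \<in> ring_gen S'"
proof -
  assume S: "S \<subseteq> ring_gen S'" and "x \<in> ring_gen S"
  from this(2) show ?thesis by induction (use S in \<open>auto intro: ring_gen_closed\<close>)
qed

text \<open>Elements of the enlarged ring are polynomials in \<open>x\<close> over the smaller one.
  Only existence of such an expression matters, so \<open>x\<close> may be algebraic over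
  \<open>S\<close> (as \<open>1 / u\<close> is over a ring containing \<open>u\<close>). Iterated,
  the rule reduces an additive claim to monomials.\<close>

lemma ring_gen_adjoin_induct [consumes 1, case_names monom add]:
  assumes p: "p \<in> ring_gen (insert x S)"
    and monom: "\<And>w k. w \<in> ring_gen S \<Longrightarrow> Q (w * x ^ k)"
    and add: "\<And>p q. Q p \<Longrightarrow> Q q \<Longrightarrow> Q (p + q)"
  shows "Q p"
proof -
  let ?W = "ring_gen S"
  define smz where "smz = {(\<Sum>k<n. w k * x ^ k) | w n. \<forall>k. w k \<in> ?W}"
  have add_in: "P + P' \<in> smz" if "P \<in> smz" "P' \<in> smz" for P P'
  proof -
    from that obtain w n w' n' where w: "P = (\<Sum>k<n. w k * x ^ k)" "\<forall>k. w k \<in> ?W"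
      "P' = (\<Sum>k<n'. w' k * x ^ k)" "\<forall>k. w' k \<in> ?W" by (auto simp: smz_def)
    have ext: "(\<Sum>k<n. w k * x ^ k) = (\<Sum>k<max n n'. (if k < n then w k else 0) * x ^ k)" for w n n'
      by (rule sum.mono_neutral_cong_left) auto
    have "P + P' = (\<Sum>k<max n n'. ((if k < n then w k else 0) + (if k < n' then w' k else 0)) * x ^ k)"
      unfolding w(1) w(3) ext[of w n n'] ext[of w' n' n]
      by (simp add: max.commute sum.distrib distrib_right)
    moreover have "\<forall>k. (if k < n then w k else 0) + (if k < n' then w' k else 0) \<in> ?W"
      using w by (auto intro: ring_gen_closed)
    ultimately show ?thesis unfolding smz_def
      by (intro CollectI exI[of _ "\<lambda>k. (if k < n then w k else 0) + (if k < n' then w' k else 0)"]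
          exI[of _ "max n n'"]) simp
  qed
  have monom_in: "w * x ^ k \<in> smz" if "w \<in> ?W" for w k
  proof -
    have "w * x ^ k = (\<Sum>i<Suc k. (if i = k then w else 0) * x ^ i)" by simp
    then show ?thesis unfolding smz_def using that
      by (intro CollectI exI[of _ "\<lambda>i. if i = k then w else 0"] exI[of _ "Suc k"]) auto
  qed
  have ind: "P \<in> smz \<Longrightarrow> R 0 \<Longrightarrow> (\<And>w k P. w \<in> ?W \<Longrightarrow> P \<in> smz \<Longrightarrow> R P \<Longrightarrow> R (w * x ^ k + P)) \<Longrightarrow> R P" for P R
  proof -
    assume "P \<in> smz" and R: "R 0" "\<And>w k P. w \<in> ?W \<Longrightarrow> P \<in> smz \<Longrightarrow> R P \<Longrightarrow> R (w * x ^ k + P)"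
    then obtain w n where w: "P = (\<Sum>k<n. w k * x ^ k)" "\<forall>k. w k \<in> ?W" by (auto simp: smz_def)
    have "(\<Sum>k<n. w k * x ^ k) \<in> smz" for n using w(2) unfolding smz_def by blast
    have "R (\<Sum>k<n. w k * x ^ k)" for n
    proof (induction n)
      case 0
      show ?case using R(1) by simp
    next
      case (Suc n)
      have "R (w n * x ^ n + (\<Sum>k<n. w k * x ^ k))"
        by (rule R(2)) (use w(2) Suc \<open>\<And>n. (\<Sum>k<n. w k * x ^ k) \<in> smz\<close> in blast)+
      then show ?case by (simp add: add.commute)
    qed
    then show "R P" using w by simp
  qed
  have z: "0 \<in> smz" using monom_in[of 0 0] by simp
  have mult_in: "P * P' \<in> smz" if "P \<in> smz" "P' \<in> smz" for P P'
  proof -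
    have m: "w * x ^ k * P' \<in> smz" if w: "w \<in> ?W" for w k
      using \<open>P' \<in> smz\<close>
    proof (rule ind)
      show "w * x ^ k * 0 \<in> smz" using z by simp
    next
      fix w' k' P assume "w' \<in> ?W" "w * x ^ k * P \<in> smz"
      then have "(w * w') * x ^ (k + k') + w * x ^ k * P \<in> smz"
        using w by (intro add_in monom_in ring_gen.mult)
      then show "w * x ^ k * (w' * x ^ k' + P) \<in> smz" by (simp add: algebra_simps power_add)
    qed
    from \<open>P \<in> smz\<close> show ?thesis
    proof (rule ind)
      show "0 * P' \<in> smz" using z by simp
    next
      fix w k P assume "w \<in> ?W" "P * P' \<in> smz"
      then show "(w * x ^ k + P) * P' \<in> smz" using add_in m by (simp add: distrib_right)
    qed
  qed
  from p have "p \<in> smz"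
  proof (induction rule: ring_gen.induct)
    case (gen q)
    then show ?case
      using monom_in[of 1 1] monom_in[of q 0] ring_gen.gen[of q S] by auto
  next
    case one
    then show ?case using monom_in[of 1 0] by simp
  next
    case (minus q)
    then show ?case using mult_in[of "- 1" q] monom_in[of "- 1" 0]
      by (simp add: ring_gen.minus)
  next
    case (add p q)
    then show ?case by (intro add_in)
  next
    case (mult p q)
    then show ?case by (intro mult_in)
  qed
  then show ?thesis
  proof (rule ind)
    show "Q 0" using monom[of 0 0] by simp
  next
    fix w k P assume "w \<in> ?W" "Q P"
    then show "Q (w * x ^ k + P)" by (intro add monom)
  qed
qed

lemma derivation_vanishes_on_ring_gen:
  assumes "derivation d" "\<And>x. x \<in> S \<Longrightarrow> d x = 0" "p \<in> ring_gen S"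
  shows "d p = 0"
proof -
  interpret derivation d by fact
  show ?thesis using assms(3) by induction (simp_all add: assms(2))
qed

lemma derivation_maps_ring_gen:
  assumes "derivation d" "\<And>x. x \<in> S \<Longrightarrow> d x \<in> ring_gen S" "p \<in> ring_gen S"
  shows "d p \<in> ring_gen S"
proof -
  interpret derivation d by fact
  show ?thesis using assms(3) by induction (auto simp: assms(2) intro: ring_gen_closed)
qed

section \<open>The polynomial in adapted coordinates\<close>

text \<open>Indices start at 2: the numeral 1 would be rewritten to \<open>Suc 0\<close> by the simplifier.\<close>

locale zz5_coordinates =
  fixes pd :: "nat \<Rightarrow> 'f::field \<Rightarrow> 'f" and X :: "nat \<Rightarrow> 'f" and C :: "'f set"
  assumes derivation_pd: "i \<in> {2..11} \<Longrightarrow> derivation (pd i)"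
    and pd_X: "i \<in> {2..11} \<Longrightarrow> j \<in> {2..11} \<Longrightarrow> pd i (X j) = (if i = j then 1 else 0)"
    and pd_C: "i \<in> {2..11} \<Longrightarrow> k \<in> C \<Longrightarrow> pd i k = 0"
begin

abbreviation "a \<equiv> X 2"
abbreviation "t \<equiv> X 3"
abbreviation "c \<equiv> X 4"
abbreviation "v \<equiv> X 5"
abbreviation "r \<equiv> X 6"
abbreviation "b \<equiv> X 7"
abbreviation "z \<equiv> X 8"
abbreviation "y \<equiv> X 9"
abbreviation "u \<equiv> X 10"
abbreviation "D \<equiv> X 11"

text \<open>With rows named after the diagonal entries, \<open>sg\<close>, \<open>PP\<close>,
  \<open>De\<close> and \<open>AA\<close> are the principal minors on \<open>b D\<close>,
  \<open>b D a\<close>, \<open>b D t\<close> and \<open>b D a t\<close>. The polynomial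
  \<open>ka\<close> is, up to sign, the mixed minor with rows \<open>b D a\<close> and columns
  \<open>b D t\<close>, and \<open>f\<close> is the expansion of the determinant along the row of
  \<open>c\<close>.\<close>

definition "sg = b * D - y\<^sup>2"
definition "al = b * u\<^sup>2"
definition "ep = z\<^sup>2 * D + 2 * z * y * (D - y - u) + b * (D - y - u)\<^sup>2"
definition "ze = u\<^sup>2 * z\<^sup>2"
definition "k0 = b * (D - y - u) + y * z"
definition "ka = u * k0"
definition "PP = sg * a - al"
definition "De = sg * t - ep"
definition "AA = sg * a * t - ep * a - al * t + ze"
definition "f = c * AA - v\<^sup>2 * De - 2 * v * r * ka - r\<^sup>2 * PP"

lemmas base_defs = sg_def al_def ep_def ze_def k0_def ka_def
lemmas poly_defs = PP_def De_def AA_def f_def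

lemma ka_square: "ka\<^sup>2 = al * ep - sg * ze"
  unfolding base_defs by algebra

text \<open>Dodgson condensation for the minor \<open>AA\<close>. Equivalently, the quadratic form
  in \<open>(v, r)\<close> with coefficients \<open>De\<close>, \<open>2 ka\<close>,
  \<open>PP\<close> has determinant \<open>sg AA\<close>, so it becomes degenerate along
  \<open>AA = 0\<close>.\<close>

lemma sg_AA: "sg * AA = PP * De - ka\<^sup>2"
  unfolding ka_square poly_defs by algebra

definition "S5 = C \<union> X ` {7, 8, 9, 10, 11}"
abbreviation "R5 \<equiv> ring_gen S5"
definition "S7 = insert a (insert t S5)"
abbreviation "R7 \<equiv> ring_gen S7"
definition "S10 = insert c (insert v (insert r S7))"
abbreviation "R10 \<equiv> ring_gen S10"

lemma R5_R7: "w \<in> R5 \<Longrightarrow> w \<in> R7"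
  by (rule ring_gen_subset) (auto simp: S7_def intro: ring_gen.gen)

lemma R7_R10: "w \<in> R7 \<Longrightarrow> w \<in> R10"
  by (rule ring_gen_subset) (auto simp: S10_def intro: ring_gen.gen)

lemma coords_R5 [simp]: "b \<in> R5" "z \<in> R5" "y \<in> R5" "u \<in> R5" "D \<in> R5"
  by (auto simp: S5_def intro!: ring_gen.gen)

lemma coords_R7 [simp]: "a \<in> R7" "t \<in> R7"
  by (auto simp: S7_def intro!: ring_gen.gen)

lemma coords_R10 [simp]: "c \<in> R10" "v \<in> R10" "r \<in> R10"
  by (auto simp: S10_def intro!: ring_gen.gen)

lemma base_R5 [simp]: "sg \<in> R5" "al \<in> R5" "ep \<in> R5" "ze \<in> R5" "k0 \<in> R5" "ka \<in> R5"
  unfolding base_defs by (intro ring_gen_closed; simp)+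

lemma poly_R7 [simp]: "PP \<in> R7" "De \<in> R7" "AA \<in> R7"
  unfolding PP_def De_def AA_def by (intro ring_gen_closed; simp add: R5_R7)+

lemma pd_R5: "i \<in> {2..6} \<Longrightarrow> w \<in> R5 \<Longrightarrow> pd i w = 0"
  by (rule derivation_vanishes_on_ring_gen[of "pd i" S5])
     (auto simp: derivation_pd S5_def pd_C pd_X)

lemma pd_R7: "i \<in> {4, 5, 6} \<Longrightarrow> w \<in> R7 \<Longrightarrow> pd i w = 0"
  by (rule derivation_vanishes_on_ring_gen[of "pd i" S7])
     (auto simp: derivation_pd S5_def S7_def pd_C pd_X)

lemma pd_in_R5: "i \<in> {2..11} \<Longrightarrow> w \<in> R5 \<Longrightarrow> pd i w \<in> R5"
  by (rule derivation_maps_ring_gen[of "pd i" S5])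
     (auto simp: derivation_pd S5_def pd_C pd_X)

lemma pd_in_R7: "i \<in> {2..11} \<Longrightarrow> w \<in> R7 \<Longrightarrow> pd i w \<in> R7"
  by (rule derivation_maps_ring_gen[of "pd i" S7])
     (auto simp: derivation_pd S5_def S7_def pd_C pd_X)

lemma pd_add [simp]: "i \<in> {2..11} \<Longrightarrow> pd i (p + q) = pd i p + pd i q"
  and pd_diff [simp]: "i \<in> {2..11} \<Longrightarrow> pd i (p - q) = pd i p - pd i q"
  and pd_minus [simp]: "i \<in> {2..11} \<Longrightarrow> pd i (- p) = - pd i p"
  and pd_mult [simp]: "i \<in> {2..11} \<Longrightarrow> pd i (p * q) = p * pd i q + pd i p * q"
  and pd_power: "i \<in> {2..11} \<Longrightarrow> pd i (p ^ n) = of_nat n * p ^ (n - 1) * pd i p"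
  and pd_power2 [simp]: "i \<in> {2..11} \<Longrightarrow> pd i (p\<^sup>2) = 2 * p * pd i p"
  and pd_one [simp]: "i \<in> {2..11} \<Longrightarrow> pd i 1 = 0"
  and pd_zero [simp]: "i \<in> {2..11} \<Longrightarrow> pd i 0 = 0"
  and pd_of_nat [simp]: "i \<in> {2..11} \<Longrightarrow> pd i (of_nat m) = 0"
  and pd_numeral [simp]: "i \<in> {2..11} \<Longrightarrow> pd i (numeral k) = 0"
  and pd_divide_power: "i \<in> {2..11} \<Longrightarrow> g \<noteq> 0 \<Longrightarrow>
        pd i (p / g ^ n) = pd i p / g ^ n - of_nat n * (p * pd i g / g ^ Suc n)"
  using derivation_pd
  by (simp_all add: derivation.d_add derivation.d_mult derivation.d_diff derivation.d_minus
      derivation.d_power derivation.d_power2 derivation.d_one derivation.d_zero derivation.d_of_nat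
      derivation.d_numeral derivation.d_divide_power)

lemma pd_f:
  "pd 2 f = c * De - sg * r\<^sup>2" "pd 3 f = c * PP - sg * v\<^sup>2" "pd 4 f = AA"
  "pd 5 f = - 2 * (De * v + ka * r)" "pd 6 f = - 2 * (PP * r + ka * v)"
proof -
  have z: "i \<in> {2..6} \<Longrightarrow> pd i sg = 0" "i \<in> {2..6} \<Longrightarrow> pd i al = 0" "i \<in> {2..6} \<Longrightarrow> pd i ep = 0"
     "i \<in> {2..6} \<Longrightarrow> pd i ze = 0" "i \<in> {2..6} \<Longrightarrow> pd i ka = 0" for i
    by (simp_all add: pd_R5)
  show "pd 2 f = c * De - sg * r\<^sup>2" "pd 3 f = c * PP - sg * v\<^sup>2" "pd 4 f = AA"
    "pd 5 f = - 2 * (De * v + ka * r)" "pd 6 f = - 2 * (PP * r + ka * v)"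
    unfolding poly_defs by (simp_all add: z pd_X algebra_simps)
qed

lemma pd_base_f: "i \<in> {7..11} \<Longrightarrow>
    pd i f = c * pd i AA - v\<^sup>2 * pd i De - 2 * v * r * pd i ka - r\<^sup>2 * pd i PP"
  unfolding f_def by (simp add: pd_X)

lemma pd_base_poly:
  assumes "i \<in> {7..11}"
  shows "pd i PP = pd i sg * a - pd i al" "pd i De = pd i sg * t - pd i ep"
    "pd i AA = pd i sg * a * t - pd i ep * a - pd i al * t + pd i ze"
  unfolding PP_def De_def AA_def using assms by (simp_all add: pd_X)

lemma X_nonzero: "i \<in> {2..11} \<Longrightarrow> X i \<noteq> 0"
  using pd_X[of i i] pd_zero[of i] by auto

lemma sg_nonzero: "sg \<noteq> 0"
proof
  assume "sg = 0"
  then have "pd 7 sg = 0" by simp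
  then show False using X_nonzero[of 11] by (simp add: sg_def pd_X)
qed

lemma k0_nonzero: "k0 \<noteq> 0"
proof
  assume "k0 = 0"
  then have "pd 8 k0 = 0" by simp
  then show False using X_nonzero[of 9] by (simp add: k0_def pd_X)
qed

lemma ka_nonzero: "ka \<noteq> 0"
  using k0_nonzero X_nonzero[of 10] by (simp add: ka_def)

lemma f_nonzero: "f \<noteq> 0"
proof
  assume "f = 0"
  then have "pd 3 (pd 2 (pd 4 f)) = 0" by simp
  moreover have "pd 2 AA = De" "pd 3 De = sg"
    unfolding AA_def De_def by (simp_all add: pd_X pd_R5)
  ultimately show False using sg_nonzero by (simp add: pd_f)
qed

end

section \<open>Moments of a functional in the variables c, v, r\<close>

text \<open>\<open>lam\<close> is a functional on functions modulo divergences that also kills the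
  class of eta; the aim is \<open>lam = 0\<close> on all \<open>g / f ^ n\<close>. As
  \<open>lam\<close> is only additive here, constant multiples of \<open>1 / f^2\<close> have to be
  listed in \<open>lam_eta\<close>.\<close>

locale zz5_functional = zz5_coordinates pd X C
  for pd :: "nat \<Rightarrow> 'f::field \<Rightarrow> 'f" and X :: "nat \<Rightarrow> 'f" and C :: "'f set" +
  fixes lam :: "'f \<Rightarrow> 'k::field_char_0"
  assumes lam_add: "lam (p + q) = lam p + lam q"
    and lam_pd: "i \<in> {2..11} \<Longrightarrow> g \<in> R10 \<Longrightarrow> lam (pd i (g / f ^ n)) = 0"
    and lam_eta: "k \<in> ring_gen C \<Longrightarrow> lam (k / f\<^sup>2) = 0"
begin

lemma lam_zero [simp]: "lam 0 = 0"
  using lam_add[of 0 0] by simp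

lemma lam_minus: "lam (- p) = - lam p"
  using lam_add[of p "- p"] by (simp add: eq_neg_iff_add_eq_0 add.commute)

lemma lam_diff: "lam (p - q) = lam p - lam q"
  using lam_add[of p "- q"] by (simp add: lam_minus)

lemma lam_of_nat: "lam (of_nat n * p) = of_nat n * lam p"
  by (induction n) (simp_all add: lam_add distrib_right)

lemma lam_numeral: "lam (numeral n * p) = numeral n * lam p"
  using lam_of_nat[of "numeral n" p] by simp

lemma lam_ibp:
  assumes "i \<in> {2..11}" "p \<in> R10"
  shows "lam (pd i p / f ^ n) = of_nat n * lam (p * pd i f / f ^ Suc n)"
  using lam_pd[OF assms, of n]
  by (simp only: pd_divide_power[OF assms(1) f_nonzero] lam_diff lam_of_nat right_minus_eq)

abbreviation Mo :: "'f \<Rightarrow> nat \<Rightarrow> nat \<Rightarrow> nat \<Rightarrow> nat \<Rightarrow> 'k" where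
  "Mo q n m k K \<equiv> lam (q * v ^ n * r ^ m * c ^ k / f ^ K)"

lemma monomial_R10: "q \<in> R7 \<Longrightarrow> q * v ^ n * r ^ m * c ^ k \<in> R10"
  by (auto intro!: ring_gen_closed intro: R7_R10)

lemma Mo_add: "Mo (p + q) n m k K = Mo p n m k K + Mo q n m k K"
  by (simp add: distrib_right add_divide_distrib lam_add)

lemma Mo_diff: "Mo (p - q) n m k K = Mo p n m k K - Mo q n m k K"
  by (simp add: left_diff_distrib diff_divide_distrib lam_diff)

lemma Mo_of_nat: "Mo (of_nat l * q) n m k K = of_nat l * Mo q n m k K"
proof -
  have "of_nat l * q * v ^ n * r ^ m * c ^ k / f ^ K = of_nat l * (q * v ^ n * r ^ m * c ^ k / f ^ K)"
    by simp
  then show ?thesis by (simp only: lam_of_nat)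
qed

lemma Mo_f: "Mo q n m k K = Mo (AA * q) n m (Suc k) (Suc K) - Mo (De * q) (n + 2) m k (Suc K)
    - 2 * Mo (ka * q) (Suc n) (Suc m) k (Suc K) - Mo (PP * q) n (m + 2) k (Suc K)"
proof -
  have "q * v ^ n * r ^ m * c ^ k / f ^ K = f * (q * v ^ n * r ^ m * c ^ k) / f ^ Suc K"
    using f_nonzero by simp
  also have "f * (q * v ^ n * r ^ m * c ^ k) = AA * q * v ^ n * r ^ m * c ^ Suc k -
      De * q * v ^ (n + 2) * r ^ m * c ^ k - 2 * (ka * q * v ^ Suc n * r ^ Suc m * c ^ k) -
      PP * q * v ^ n * r ^ (m + 2) * c ^ k"
    by (simp add: f_def algebra_simps power2_eq_square)
  finally show ?thesis
    by (simp only: diff_divide_distrib lam_diff times_divide_eq_right[symmetric] lam_numeral)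
qed

lemma Mo_c:
  assumes "q \<in> R7"
  shows "of_nat k * Mo q n m (k - 1) K = of_nat K * Mo (AA * q) n m k (Suc K)"
proof -
  have "pd 4 (q * v ^ n * r ^ m * c ^ k) = of_nat k * q * v ^ n * r ^ m * c ^ (k - 1)"
    using assms by (simp add: pd_power pd_X pd_R7)
  moreover have "q * v ^ n * r ^ m * c ^ k * AA = AA * q * v ^ n * r ^ m * c ^ k"
    by (simp add: mult_ac)
  ultimately show ?thesis
    using lam_ibp[OF _ monomial_R10[OF assms], of 4 n m k K]
    by (simp only: pd_f Mo_of_nat) simp
qed

lemma Mo_v:
  assumes "q \<in> R7"
  shows "of_nat n * Mo q (n - 1) m k K =
    - 2 * of_nat K * (Mo (De * q) (Suc n) m k (Suc K) + Mo (ka * q) n (Suc m) k (Suc K))"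
proof -
  have "pd 5 (q * v ^ n * r ^ m * c ^ k) = of_nat n * q * v ^ (n - 1) * r ^ m * c ^ k"
    using assms by (simp add: pd_power pd_X pd_R7)
  moreover have "q * v ^ n * r ^ m * c ^ k * (- 2 * (De * v + ka * r)) / f ^ Suc K =
      - (2 * (De * q * v ^ Suc n * r ^ m * c ^ k / f ^ Suc K))
      - 2 * (ka * q * v ^ n * r ^ Suc m * c ^ k / f ^ Suc K)"
    by (simp add: field_simps f_nonzero)
  ultimately show ?thesis
    using lam_ibp[OF _ monomial_R10[OF assms], of 5 n m k K]
    by (simp only: pd_f Mo_of_nat lam_diff lam_minus lam_numeral) (simp add: algebra_simps)
qed

lemma Mo_r:
  assumes "q \<in> R7"
  shows "of_nat m * Mo q n (m - 1) k K =
    - 2 * of_nat K * (Mo (PP * q) n (Suc m) k (Suc K) + Mo (ka * q) (Suc n) m k (Suc K))"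
proof -
  have "pd 6 (q * v ^ n * r ^ m * c ^ k) = of_nat m * q * v ^ n * r ^ (m - 1) * c ^ k"
    using assms by (simp add: pd_power pd_X pd_R7)
  moreover have "q * v ^ n * r ^ m * c ^ k * (- 2 * (PP * r + ka * v)) / f ^ Suc K =
      - (2 * (PP * q * v ^ n * r ^ Suc m * c ^ k / f ^ Suc K))
      - 2 * (ka * q * v ^ Suc n * r ^ m * c ^ k / f ^ Suc K)"
    by (simp add: field_simps f_nonzero)
  ultimately show ?thesis
    using lam_ibp[OF _ monomial_R10[OF assms], of 6 n m k K]
    by (simp only: pd_f Mo_of_nat lam_diff lam_minus lam_numeral) (simp add: algebra_simps)
qed

lemma Mo_a:
  assumes "q \<in> R7"
  shows "Mo (pd 2 q) n m k K =
    of_nat K * (Mo (De * q) n m (Suc k) (Suc K) - Mo (sg * q) n (m + 2) k (Suc K))"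
proof -
  have "pd 2 (q * v ^ n * r ^ m * c ^ k) = pd 2 q * v ^ n * r ^ m * c ^ k"
    by (simp add: pd_power pd_X)
  moreover have "q * v ^ n * r ^ m * c ^ k * (c * De - sg * r\<^sup>2) / f ^ Suc K =
      De * q * v ^ n * r ^ m * c ^ Suc k / f ^ Suc K - sg * q * v ^ n * r ^ (m + 2) * c ^ k / f ^ Suc K"
    by (simp add: field_simps f_nonzero power2_eq_square)
  ultimately show ?thesis
    using lam_ibp[OF _ monomial_R10[OF assms], of 2 n m k K]
    by (simp only: pd_f lam_diff) simp
qed

lemma Mo_t:
  assumes "q \<in> R7"
  shows "Mo (pd 3 q) n m k K =
    of_nat K * (Mo (PP * q) n m (Suc k) (Suc K) - Mo (sg * q) (n + 2) m k (Suc K))"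
proof -
  have "pd 3 (q * v ^ n * r ^ m * c ^ k) = pd 3 q * v ^ n * r ^ m * c ^ k"
    by (simp add: pd_power pd_X)
  moreover have "q * v ^ n * r ^ m * c ^ k * (c * PP - sg * v\<^sup>2) / f ^ Suc K =
      PP * q * v ^ n * r ^ m * c ^ Suc k / f ^ Suc K - sg * q * v ^ (n + 2) * r ^ m * c ^ k / f ^ Suc K"
    by (simp add: field_simps f_nonzero power2_eq_square)
  ultimately show ?thesis
    using lam_ibp[OF _ monomial_R10[OF assms], of 3 n m k K]
    by (simp only: pd_f lam_diff) simp
qed

lemma Mo_base:
  assumes "q \<in> R7" "i \<in> {7..11}"
  shows "Mo (pd i q) n m k K =
    of_nat K * (Mo (pd i AA * q) n m (Suc k) (Suc K) - Mo (pd i De * q) (n + 2) m k (Suc K)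
      - 2 * Mo (pd i ka * q) (Suc n) (Suc m) k (Suc K) - Mo (pd i PP * q) n (m + 2) k (Suc K))"
proof -
  have "pd i (q * v ^ n * r ^ m * c ^ k) = pd i q * v ^ n * r ^ m * c ^ k"
    using assms(2) by (auto simp: pd_power pd_X)
  moreover have "q * v ^ n * r ^ m * c ^ k *
      (c * pd i AA - v\<^sup>2 * pd i De - 2 * v * r * pd i ka - r\<^sup>2 * pd i PP) / f ^ Suc K =
      pd i AA * q * v ^ n * r ^ m * c ^ Suc k / f ^ Suc K
      - pd i De * q * v ^ (n + 2) * r ^ m * c ^ k / f ^ Suc K
      - 2 * (pd i ka * q * v ^ Suc n * r ^ Suc m * c ^ k / f ^ Suc K)
      - pd i PP * q * v ^ n * r ^ (m + 2) * c ^ k / f ^ Suc K"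
    by (simp add: field_simps f_nonzero power2_eq_square)
  ultimately show ?thesis
    using lam_ibp[OF _ monomial_R10[OF assms(1)], of i n m k K] assms(2)
    by (simp only: pd_base_f[OF assms(2)] lam_diff lam_numeral) simp
qed

text \<open>The Euler field with weights 2, 1, 1 for \<open>c, v, r\<close> scales \<open>f\<close>
  with weight 2 over \<open>R7\<close>, and the summand 4 is the weight of the volume element in
  \<open>c, v, r\<close>. Only weight zero survives, so the exponents of the numerator determine
  \<open>K\<close>.\<close>

lemma Mo_weight:
  assumes "q \<in> R7" "2 * k + n + m + 4 \<noteq> 2 * K"
  shows "Mo q n m k K = 0"
proof -
  have "of_nat (Suc k) * Mo q n m k K = of_nat K * Mo (AA * q) n m (Suc k) (Suc K)"
    "of_nat (Suc n) * Mo q n m k K =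
      - 2 * of_nat K * (Mo (De * q) (n + 2) m k (Suc K) + Mo (ka * q) (Suc n) (Suc m) k (Suc K))"
    "of_nat (Suc m) * Mo q n m k K =
      - 2 * of_nat K * (Mo (PP * q) n (m + 2) k (Suc K) + Mo (ka * q) (Suc n) (Suc m) k (Suc K))"
    using Mo_c[OF assms(1), of "Suc k"] Mo_v[OF assms(1), of "Suc n"] Mo_r[OF assms(1), of "Suc m"]
    by simp_all
  moreover have "2 * of_nat K * Mo q n m k K = 2 * of_nat K * (Mo (AA * q) n m (Suc k) (Suc K)
      - Mo (De * q) (n + 2) m k (Suc K)
      - 2 * Mo (ka * q) (Suc n) (Suc m) k (Suc K) - Mo (PP * q) n (m + 2) k (Suc K))"
    by (subst Mo_f) simp
  ultimately have "(2 * of_nat (Suc k) + of_nat (Suc n) + of_nat (Suc m) - 2 * of_nat K) * Mo q n m k K = 0"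
    by (simp only: distrib_right left_diff_distrib mult.assoc) (simp add: algebra_simps)
  moreover have "2 * of_nat (Suc k) + of_nat (Suc n) + of_nat (Suc m) - 2 * of_nat K \<noteq> (0::'k)"
  proof
    assume "2 * of_nat (Suc k) + of_nat (Suc n) + of_nat (Suc m) - 2 * of_nat K = (0::'k)"
    then have "of_nat (2 * k + n + m + 4) = (of_nat (2 * K) :: 'k)"
      by (simp add: algebra_simps)
    then show False using assms(2) by (simp only: of_nat_eq_iff)
  qed
  ultimately show ?thesis by simp
qed

definition M :: "'f \<Rightarrow> nat \<Rightarrow> nat \<Rightarrow> nat \<Rightarrow> nat \<Rightarrow> 'k" where
  "M q n m k K = Mo q n m k K"

lemmas M_add = Mo_add[folded M_def]
  and M_diff = Mo_diff[folded M_def]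
  and M_c = Mo_c[folded M_def]
  and M_v = Mo_v[folded M_def]
  and M_r = Mo_r[folded M_def]
  and M_a = Mo_a[folded M_def]
  and M_t = Mo_t[folded M_def]
  and M_base = Mo_base[folded M_def]
  and M_weight = Mo_weight[folded M_def]

end

lemma field_cancel_left: "x * a = x * b \<Longrightarrow> x \<noteq> 0 \<Longrightarrow> a = (b :: 'a::field)"
  by simp

section \<open>Gaussian relations and the reduction to simple poles along AA = 0\<close>

context zz5_functional
begin

text \<open>
  The factor makes the integration-by-parts relations for \<open>c\<close>, \<open>v\<close>, \<open>r\<close> independent of the exponent
  of \<open>f\<close>, which is determined by the other exponents.
\<close>

definition E :: "'f \<Rightarrow> nat \<Rightarrow> nat \<Rightarrow> nat \<Rightarrow> 'k" where
  "E q n m i = (- 2) ^ ((n + m) div 2) * (of_nat i * fact (i + (n + m) div 2) / fact i) *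
     M q n m (i - 1) (i + (n + m) div 2 + 1)"

lemma E_eq: "n + m = 2 * J \<Longrightarrow>
    E q n m i = (- 2) ^ J * (of_nat i * fact (i + J) / fact i) * M q n m (i - 1) (i + J + 1)"
  by (simp add: E_def)

lemma E_Suc: "n + m = 2 * J \<Longrightarrow>
    E q n m (Suc i) = (- 2) ^ J * (fact (i + J + 1) / fact i) * M q n m i (i + J + 2)"
  by (simp add: E_def del: of_nat_Suc)

lemma E_add: "E (p + q) n m i = E p n m i + E q n m i"
  by (simp add: E_def M_add distrib_left)

lemma E_diff: "E (p - q) n m i = E p n m i - E q n m i"
  by (simp add: E_def M_diff right_diff_distrib)

lemma E_i0 [simp]: "E q n m 0 = 0"
  by (simp add: E_def)

text \<open>The index \<open>i\<close> acts as the pole order along \<open>AA = 0\<close>; pole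
  order 0 carries no residue, which is \<open>E_i0\<close>.\<close>

lemma E_AA:
  assumes "q \<in> R7" "even (n + m)"
  shows "E (AA * q) n m (Suc i) = E q n m i"
proof -
  obtain J where J: "n + m = 2 * J" using assms(2) by (elim evenE)
  have "of_nat i * M q n m (i - 1) (i + J + 1) = of_nat (i + J + 1) * M (AA * q) n m i (i + J + 2)"
    using M_c[OF assms(1), of i n m "i + J + 1"] by simp
  then have key: "fact (i + J + 1) * M (AA * q) n m i (i + J + 2) =
      fact (i + J) * (of_nat i * M q n m (i - 1) (i + J + 1))"
    by (simp add: mult_ac)
  have "E (AA * q) n m (Suc i) = (- 2) ^ J / fact i * (fact (i + J + 1) * M (AA * q) n m i (i + J + 2))"
    by (simp add: E_Suc[OF J])
  also have "\<dots> = (- 2) ^ J / fact i * (fact (i + J) * (of_nat i * M q n m (i - 1) (i + J + 1)))"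
    by (simp only: key)
  also have "\<dots> = E q n m i" by (simp add: E_eq[OF J])
  finally show ?thesis .
qed

text \<open>Together with \<open>E_r\<close> these are the Wick relations for the moments of
  \<open>v^n r^m\<close> under the Gaussian weight with exponent
  \<open>- (De v^2 + 2 ka v r + PP r^2) / 2\<close>. In this model \<open>E q n m i\<close> is the
  moment multiplied by \<open>q / AA^i\<close>.\<close>

lemma E_v:
  assumes "q \<in> R7" "odd (n + m)"
  shows "of_nat n * E q (n - 1) m i = E (De * q) (Suc n) m i + E (ka * q) n (Suc m) i"
proof (cases i)
  case (Suc k)
  obtain J where J: "n + m = 2 * J + 1" using assms(2) by (elim oddE)
  have J': "Suc n + m = 2 * Suc J" "n + Suc m = 2 * Suc J" using J by simp_all
  have "of_nat n * E q (n - 1) m i = (- 2) ^ J * (fact (k + J + 1) / fact k) * (of_nat n * M q (n - 1) m k (k + J + 2))"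
  proof (cases n)
    case (Suc n')
    then have "n - 1 + m = 2 * J" using J by simp
    then show ?thesis unfolding \<open>i = Suc k\<close> by (simp only: E_Suc) (simp add: mult_ac)
  qed simp
  also have "of_nat n * M q (n - 1) m k (k + J + 2) = - 2 * of_nat (k + J + 2) *
      (M (De * q) (Suc n) m k (k + J + 3) + M (ka * q) n (Suc m) k (k + J + 3))"
    using M_v[OF assms(1), of n m k "k + J + 2"] by (simp add: eval_nat_numeral)
  also have "(- 2) ^ J * (fact (k + J + 1) / fact k) * \<dots> = (- 2) ^ Suc J * (fact (k + Suc J + 1) / fact k) *
      (M (De * q) (Suc n) m k (k + Suc J + 2) + M (ka * q) n (Suc m) k (k + Suc J + 2))"
    by (simp add: eval_nat_numeral field_simps)
  finally show ?thesis unfolding Suc E_Suc[OF J'(1)] E_Suc[OF J'(2)] by (simp add: distrib_left)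
qed simp

lemma E_r:
  assumes "q \<in> R7" "odd (n + m)"
  shows "of_nat m * E q n (m - 1) i = E (PP * q) n (Suc m) i + E (ka * q) (Suc n) m i"
proof (cases i)
  case (Suc k)
  obtain J where J: "n + m = 2 * J + 1" using assms(2) by (elim oddE)
  have J': "Suc n + m = 2 * Suc J" "n + Suc m = 2 * Suc J" using J by simp_all
  have "of_nat m * E q n (m - 1) i = (- 2) ^ J * (fact (k + J + 1) / fact k) * (of_nat m * M q n (m - 1) k (k + J + 2))"
  proof (cases m)
    case (Suc n')
    then have "n + (m - 1) = 2 * J" using J by simp
    then show ?thesis unfolding \<open>i = Suc k\<close> by (simp only: E_Suc) (simp add: mult_ac)
  qed simp
  also have "of_nat m * M q n (m - 1) k (k + J + 2) = - 2 * of_nat (k + J + 2) *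
      (M (PP * q) n (Suc m) k (k + J + 3) + M (ka * q) (Suc n) m k (k + J + 3))"
    using M_r[OF assms(1), of m n k "k + J + 2"] by (simp add: eval_nat_numeral)
  also have "(- 2) ^ J * (fact (k + J + 1) / fact k) * \<dots> = (- 2) ^ Suc J * (fact (k + Suc J + 1) / fact k) *
      (M (PP * q) n (Suc m) k (k + Suc J + 2) + M (ka * q) (Suc n) m k (k + Suc J + 2))"
    by (simp add: eval_nat_numeral field_simps)
  finally show ?thesis unfolding Suc E_Suc[OF J'(1)] E_Suc[OF J'(2)] by (simp add: distrib_left)
qed simp

text \<open>The normalising factor of \<open>E\<close> at pole order \<open>k + 1\<close>. Its two
  recursions absorb the shift of the exponent of \<open>f\<close> when a coordinate other than
  \<open>c, v, r\<close> is integrated by parts.\<close>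

definition CC :: "nat \<Rightarrow> nat \<Rightarrow> 'k" where "CC J k = (- 2) ^ J * (fact (k + J + 1) / fact k)"

lemma CC_Suc: "of_nat (k + J + 2) * CC J k = of_nat (Suc k) * CC J (Suc k)"
proof -
  have "(of_nat (Suc k) :: 'k) \<noteq> 0" by (simp del: of_nat_Suc)
  then have "of_nat (Suc k) * CC J (Suc k) = (- 2) ^ J * (fact (Suc (k + J + 1)) / fact k)"
    by (simp add: CC_def del: of_nat_Suc fact_Suc) (simp add: fact_Suc del: of_nat_Suc)
  also have "\<dots> = of_nat (k + J + 2) * CC J k" by (simp add: CC_def)
  finally show ?thesis ..
qed

lemma CC_Suc': "CC (Suc J) k = - 2 * (of_nat (k + J + 2) * CC J k)"
  by (simp add: CC_def)

lemma E_CC: "n + m = 2 * J \<Longrightarrow> E q n m (Suc k) = CC J k * M q n m k (k + J + 2)"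
  by (simp only: E_Suc CC_def)

text \<open>Differentiation under the Gaussian integral: \<open>a\<close> occurs in
  \<open>AA\<close>, with derivative \<open>De\<close>, and in \<open>PP r^2 / 2\<close>, with
  derivative \<open>sg r^2 / 2\<close>.\<close>

lemma E_a:
  assumes "q \<in> R7" "even (n + m)"
  shows "E (pd 2 q) n m i = of_nat i * E (De * q) n m (Suc i) + E (sg * q) n (m + 2) i / 2"
proof (cases i)
  case (Suc k)
  obtain J where J: "n + m = 2 * J" using assms(2) by (elim evenE)
  have J': "n + (m + 2) = 2 * Suc J" using J by simp
  have "E (pd 2 q) n m i = of_nat (k + J + 2) * CC J k *
      (M (De * q) n m (Suc k) (Suc (k + J + 2)) - M (sg * q) n (m + 2) k (Suc (k + J + 2)))"
    unfolding Suc E_CC[OF J] M_a[OF assms(1)] by (simp only: mult_ac)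
  also have "\<dots> = of_nat (Suc k) * CC J (Suc k) * M (De * q) n m (Suc k) (Suc (k + J + 2))
      + CC (Suc J) k * M (sg * q) n (m + 2) k (Suc (k + J + 2)) / 2"
    unfolding CC_Suc' CC_Suc[symmetric] by (simp add: field_simps)
  finally show ?thesis unfolding Suc E_CC[OF J] E_CC[OF J'] by simp
qed simp

lemma E_t:
  assumes "q \<in> R7" "even (n + m)"
  shows "E (pd 3 q) n m i = of_nat i * E (PP * q) n m (Suc i) + E (sg * q) (n + 2) m i / 2"
proof (cases i)
  case (Suc k)
  obtain J where J: "n + m = 2 * J" using assms(2) by (elim evenE)
  have J': "(n + 2) + m = 2 * Suc J" using J by simp
  have "E (pd 3 q) n m i = of_nat (k + J + 2) * CC J k *
      (M (PP * q) n m (Suc k) (Suc (k + J + 2)) - M (sg * q) (n + 2) m k (Suc (k + J + 2)))"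
    unfolding Suc E_CC[OF J] M_t[OF assms(1)] by (simp only: mult_ac)
  also have "\<dots> = of_nat (Suc k) * CC J (Suc k) * M (PP * q) n m (Suc k) (Suc (k + J + 2))
      + CC (Suc J) k * M (sg * q) (n + 2) m k (Suc (k + J + 2)) / 2"
    unfolding CC_Suc' CC_Suc[symmetric] by (simp add: field_simps)
  finally show ?thesis unfolding Suc E_CC[OF J] E_CC[OF J'] by simp
qed simp

lemma E_base:
  assumes "q \<in> R7" "even (n + m)" "j \<in> {7..11}"
  shows "E (pd j q) n m i = of_nat i * E (pd j AA * q) n m (Suc i) + E (pd j De * q) (n + 2) m i / 2
    + E (pd j ka * q) (Suc n) (Suc m) i + E (pd j PP * q) n (m + 2) i / 2"
proof (cases i)
  case (Suc k)
  obtain J where J: "n + m = 2 * J" using assms(2) by (elim evenE)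
  have J': "(n + 2) + m = 2 * Suc J" "Suc n + Suc m = 2 * Suc J" "n + (m + 2) = 2 * Suc J" using J by simp_all
  let ?K = "Suc (k + J + 2)"
  have "E (pd j q) n m i = of_nat (k + J + 2) * CC J k *
      (M (pd j AA * q) n m (Suc k) ?K - M (pd j De * q) (n + 2) m k ?K
      - 2 * M (pd j ka * q) (Suc n) (Suc m) k ?K - M (pd j PP * q) n (m + 2) k ?K)"
    unfolding Suc E_CC[OF J] M_base[OF assms(1,3)] by (simp only: mult_ac)
  also have "\<dots> = of_nat (Suc k) * CC J (Suc k) * M (pd j AA * q) n m (Suc k) ?K
      + CC (Suc J) k * M (pd j De * q) (n + 2) m k ?K / 2
      + CC (Suc J) k * M (pd j ka * q) (Suc n) (Suc m) k ?K
      + CC (Suc J) k * M (pd j PP * q) n (m + 2) k ?K / 2"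
    unfolding CC_Suc' CC_Suc[symmetric] by (simp add: field_simps)
  finally show ?thesis unfolding Suc E_CC[OF J] E_CC[OF J'(1)] E_CC[OF J'(2)] E_CC[OF J'(3)] by simp
qed simp

lemma R7_mult: "q \<in> R7 \<Longrightarrow> PP * q \<in> R7" "q \<in> R7 \<Longrightarrow> De * q \<in> R7" "q \<in> R7 \<Longrightarrow> AA * q \<in> R7"
  "q \<in> R7 \<Longrightarrow> ka * q \<in> R7" "q \<in> R7 \<Longrightarrow> sg * q \<in> R7" "q \<in> R7 \<Longrightarrow> al * q \<in> R7" "q \<in> R7 \<Longrightarrow> ep * q \<in> R7"
  by (auto intro!: ring_gen_closed intro: R5_R7)

text \<open>The covariance of \<open>r\<close> with itself is \<open>De / (sg AA)\<close>, so this
  is a Wick contraction with the denominator cleared; the contribution of the mixed covariance, a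
  multiple of \<open>ka\<close>, is rewritten by \<open>E_v\<close>.\<close>

lemma E_sg_r:
  assumes q: "q \<in> R7" and ev: "even (n + m)"
  shows "E (sg * q) n (m + 2) i = of_nat (n + m + 1) * E (De * q) n m (Suc i)
    - of_nat (n * (n - 1)) * E q (n - 2) m (Suc i)"
proof -
  have "E (sg * q) n (m + 2) i = E (AA * (sg * q)) n (m + 2) (Suc i)"
    using E_AA[of "sg * q" n "m + 2" i] q ev by (simp add: R7_mult)
  also have "AA * (sg * q) = PP * (De * q) - ka * (ka * q)"
    using sg_AA by algebra
  finally have 1: "E (sg * q) n (m + 2) i = E (PP * (De * q)) n (m + 2) (Suc i) - E (ka * (ka * q)) n (m + 2) (Suc i)"
    by (simp only: E_diff)
  have 2: "of_nat (Suc m) * E (De * q) n m (Suc i) = E (PP * (De * q)) n (m + 2) (Suc i) + E (ka * (De * q)) (Suc n) (Suc m) (Suc i)"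
    using E_r[of "De * q" n "Suc m" "Suc i"] q ev by (simp add: R7_mult)
  have 3: "of_nat n * E (ka * q) (n - 1) (Suc m) (Suc i) = E (De * (ka * q)) (Suc n) (Suc m) (Suc i) + E (ka * (ka * q)) n (m + 2) (Suc i)"
    using E_v[of "ka * q" n "Suc m" "Suc i"] q ev by (simp add: R7_mult)
  have 4: "of_nat n * E (ka * q) (n - 1) (Suc m) (Suc i) = of_nat (n * (n - 1)) * E q (n - 2) m (Suc i) - of_nat n * E (De * q) n m (Suc i)"
  proof (cases n)
    case (Suc n')
    then have "of_nat n' * E q (n' - 1) m (Suc i) = E (De * q) n m (Suc i) + E (ka * q) n' (Suc m) (Suc i)"
      using E_v[of q n' m "Suc i"] q ev by simp
    then have e: "E (ka * q) n' (Suc m) (Suc i) = of_nat n' * E q (n' - 1) m (Suc i) - E (De * q) n m (Suc i)"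
      by simp
    have "n - 1 = n'" "n - 2 = n' - 1" using Suc by simp_all
    then show ?thesis by (simp only: e of_nat_mult right_diff_distrib mult.assoc)
  qed simp
  have "De * (ka * q) = ka * (De * q)" by (simp add: mult_ac)
  then have "E (sg * q) n (m + 2) i = of_nat (Suc m) * E (De * q) n m (Suc i)
      - of_nat n * E (ka * q) (n - 1) (Suc m) (Suc i)"
    unfolding 1 2 3 by (simp add: mult_ac)
  then show ?thesis unfolding 4 by (simp add: algebra_simps)
qed

lemma E_sg_v:
  assumes q: "q \<in> R7" and ev: "even (n + m)"
  shows "E (sg * q) (n + 2) m i = of_nat (n + m + 1) * E (PP * q) n m (Suc i)
    - of_nat (m * (m - 1)) * E q n (m - 2) (Suc i)"
proof -
  have "E (sg * q) (n + 2) m i = E (AA * (sg * q)) (n + 2) m (Suc i)"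
    using E_AA[of "sg * q" "n + 2" m i] q ev by (simp add: R7_mult)
  also have "AA * (sg * q) = De * (PP * q) - ka * (ka * q)"
    using sg_AA by algebra
  finally have 1: "E (sg * q) (n + 2) m i = E (De * (PP * q)) (n + 2) m (Suc i) - E (ka * (ka * q)) (n + 2) m (Suc i)"
    by (simp only: E_diff)
  have 2: "of_nat (Suc n) * E (PP * q) n m (Suc i) = E (De * (PP * q)) (n + 2) m (Suc i) + E (ka * (PP * q)) (Suc n) (Suc m) (Suc i)"
    using E_v[of "PP * q" "Suc n" m "Suc i"] q ev by (simp add: R7_mult)
  have 3: "of_nat m * E (ka * q) (Suc n) (m - 1) (Suc i) = E (PP * (ka * q)) (Suc n) (Suc m) (Suc i) + E (ka * (ka * q)) (n + 2) m (Suc i)"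
    using E_r[of "ka * q" "Suc n" m "Suc i"] q ev by (simp add: R7_mult)
  have 4: "of_nat m * E (ka * q) (Suc n) (m - 1) (Suc i) = of_nat (m * (m - 1)) * E q n (m - 2) (Suc i) - of_nat m * E (PP * q) n m (Suc i)"
  proof (cases m)
    case (Suc m')
    then have "of_nat m' * E q n (m' - 1) (Suc i) = E (PP * q) n m (Suc i) + E (ka * q) (Suc n) m' (Suc i)"
      using E_r[of q n m' "Suc i"] q ev by simp
    then have e: "E (ka * q) (Suc n) m' (Suc i) = of_nat m' * E q n (m' - 1) (Suc i) - E (PP * q) n m (Suc i)"
      by simp
    have "m - 1 = m'" "m - 2 = m' - 1" using Suc by simp_all
    then show ?thesis by (simp only: e of_nat_mult right_diff_distrib mult.assoc)
  qed simp
  have "PP * (ka * q) = ka * (PP * q)" by (simp add: mult_ac)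
  then have "E (sg * q) (n + 2) m i = of_nat (Suc n) * E (PP * q) n m (Suc i)
      - of_nat m * E (ka * q) (Suc n) (m - 1) (Suc i)"
    unfolding 1 2 3 by (simp add: mult_ac)
  then show ?thesis unfolding 4 by (simp add: algebra_simps)
qed

text \<open>Elimination of \<open>E (De * q)\<close> between \<open>E_sg_r\<close> and
  \<open>E_a\<close>. The factor \<open>i\<close> on the left is nonzero from pole order two on, so
  everything is determined by simple poles along \<open>AA = 0\<close>.\<close>

lemma E_lower_i:
  assumes q: "q \<in> R7" and ev: "even (n + m)"
  shows "of_nat i * of_nat ((n + 2) * (n + 1)) * E q n m (Suc i) =
    of_nat (n + m + 3) * E (pd 2 q) (n + 2) m i
    - (of_nat i + of_nat (n + m + 3) / 2) * E (sg * q) (n + 2) (m + 2) i"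
proof -
  have "E (sg * q) (n + 2) (m + 2) i = of_nat (n + m + 3) * E (De * q) (n + 2) m (Suc i)
    - of_nat ((n + 2) * (n + 1)) * E q n m (Suc i)"
    using E_sg_r[OF q, of "n + 2" m i] ev by (simp add: algebra_simps)
  moreover have "E (pd 2 q) (n + 2) m i = of_nat i * E (De * q) (n + 2) m (Suc i) + E (sg * q) (n + 2) (m + 2) i / 2"
    using E_a[OF q, of "n + 2" m i] ev by simp
  ultimately show ?thesis by (simp only:) (simp add: field_simps)
qed

text \<open>At \<open>i = 0\<close> the left side of \<open>E_sg_v\<close> has no pole and vanishes;
  what is left is a relation between simple poles.\<close>

lemma E_PP:
  assumes "q \<in> R7" "even (n + m)"
  shows "of_nat (n + m + 1) * E (PP * q) n m 1 = of_nat (m * (m - 1)) * E q n (m - 2) 1"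
  using E_sg_v[OF assms, of 0] by simp

lemma E_De:
  assumes "q \<in> R7" "even (n + m)"
  shows "of_nat (n + m + 1) * E (De * q) n m 1 = of_nat (n * (n - 1)) * E q (n - 2) m 1"
  using E_sg_r[OF assms, of 0] by simp

text \<open>The field \<open>PP d/da - De d/dt\<close> annihilates \<open>AA\<close>, because the
  derivatives of \<open>AA\<close> in \<open>a\<close> and \<open>t\<close> are \<open>De\<close>
  and \<open>PP\<close>. It multiplies \<open>PP\<close> by \<open>sg\<close> and \<open>De\<close>
  by \<open>- sg\<close>, hence is the infinitesimal torus action on the surface
  \<open>AA = 0\<close>, and \<open>(m - n) / 2\<close> is the weight attached to
  \<open>v^n r^m\<close>.\<close>

lemma E_weight_torus:
  assumes q: "q \<in> R7" and ev: "even (n + m)"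
  shows "E (PP * pd 2 q) n m 1 - E (De * pd 3 q) n m 1 = (of_nat m - of_nat n) / 2 * E (sg * q) n m 1"
proof -
  define N :: 'k where "N = of_nat n"
  define L :: 'k where "L = of_nat m"
  have NZ: "of_nat (n + m + 1) \<noteq> (0::'k)" "2 \<le> n + m \<Longrightarrow> of_nat (n + m - 1) \<noteq> (0::'k)"
    by (simp_all only: of_nat_eq_0_iff)
  have NL: "of_nat (n + m + 1) = N + L + 1" "of_nat (n * (n - 1)) = N * (N - 1)" "of_nat (m * (m - 1)) = L * (L - 1)"
    subgoal by (simp add: N_def L_def)
    subgoal by (cases n) (simp_all add: N_def algebra_simps)
    subgoal by (cases m) (simp_all add: L_def algebra_simps)
    done
  have in7: "pd 2 q \<in> R7" "pd 3 q \<in> R7" using q by (simp_all add: pd_in_R7)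
  have P: "(N + L + 1) * E (PP * pd 2 q) n m 1 = L * (L - 1) * E (pd 2 q) n (m - 2) 1"
    using E_PP[OF in7(1) ev] by (simp only: NL)
  have De: "(N + L + 1) * E (De * pd 3 q) n m 1 = N * (N - 1) * E (pd 3 q) (n - 2) m 1"
    using E_De[OF in7(2) ev] by (simp only: NL)
  have A: "(N + L - 1) * E (pd 2 q) n (m - 2) 1 = (N + L + 1) / 2 * E (sg * q) n m 1
      + N * (N - 1) * E q (n - 2) (m - 2) 2" if "2 \<le> m"
  proof -
    define m' where "m' = m - 2"
    have m: "m = m' + 2" using that by (simp add: m'_def)
    have ev': "even (n + m')" using ev m by simp
    have L: "L = of_nat m' + 2" by (simp add: L_def m)
    have "E (sg * q) n m 1 = (N + L - 1) * E (De * q) n m' 2 - N * (N - 1) * E q (n - 2) m' 2"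
    proof -
      have "of_nat (n + m' + 1) = N + L - 1" by (simp add: N_def L)
      then show ?thesis using E_sg_r[OF q ev', of 1] by (simp only: NL(2) m Suc_1)
    qed
    moreover have "E (pd 2 q) n m' 1 = E (De * q) n m' 2 + E (sg * q) n m 1 / 2"
      using E_a[OF q ev', of 1] by (simp only: m Suc_1 of_nat_1 mult_1_left)
    moreover have "m - 2 = m'" by (simp add: m)
    moreover have gen: "h * (x + (h * x - y) / 2) = (h + 2) / 2 * (h * x - y) + y" for h x y :: 'k
      by (simp add: field_simps)
    have "N + L - 1 + 2 = N + L + 1" by simp
    ultimately show ?thesis using gen[of "N + L - 1" "E (De * q) n m' 2" "N * (N - 1) * E q (n - 2) m' 2"]
      by (simp only:)
  qed
  have T: "(N + L - 1) * E (pd 3 q) (n - 2) m 1 = (N + L + 1) / 2 * E (sg * q) n m 1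
      + L * (L - 1) * E q (n - 2) (m - 2) 2" if "2 \<le> n"
  proof -
    define n' where "n' = n - 2"
    have n: "n = n' + 2" using that by (simp add: n'_def)
    have ev': "even (n' + m)" using ev n by simp
    have N: "N = of_nat n' + 2" by (simp add: N_def n)
    have "E (sg * q) n m 1 = (N + L - 1) * E (PP * q) n' m 2 - L * (L - 1) * E q n' (m - 2) 2"
    proof -
      have "of_nat (n' + m + 1) = N + L - 1" by (simp add: L_def N)
      then show ?thesis using E_sg_v[OF q ev', of 1] by (simp only: NL(3) n Suc_1)
    qed
    moreover have "E (pd 3 q) n' m 1 = E (PP * q) n' m 2 + E (sg * q) n m 1 / 2"
      using E_t[OF q ev', of 1] by (simp only: n Suc_1 of_nat_1 mult_1_left)
    moreover have "n - 2 = n'" by (simp add: n)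
    moreover have gen: "h * (x + (h * x - y) / 2) = (h + 2) / 2 * (h * x - y) + y" for h x y :: 'k
      by (simp add: field_simps)
    have "N + L - 1 + 2 = N + L + 1" by simp
    ultimately show ?thesis using gen[of "N + L - 1" "E (PP * q) n' m 2" "L * (L - 1) * E q n' (m - 2) 2"]
      by (simp only:)
  qed
  have nz: "N + L + 1 \<noteq> 0" using NZ(1) by (simp only: NL(1) not_False_eq_True)
  show ?thesis
  \<comment> \<open>The argument divides by \<open>N + L - 1\<close>. Parity excludes
    \<open>n + m = 1\<close>, the only zero of this factor, and leaves \<open>n = m = 0\<close> to
    be done by hand.\<close>
  proof (cases "2 \<le> n + m")
    case True
    then have nz': "N + L - 1 \<noteq> 0" using NZ(2) by (simp add: of_nat_diff N_def L_def)
    have "(N + L - 1) * (N + L + 1) * (E (PP * pd 2 q) n m 1 - E (De * pd 3 q) n m 1) =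
        L * (L - 1) * ((N + L - 1) * E (pd 2 q) n (m - 2) 1) - N * (N - 1) * ((N + L - 1) * E (pd 3 q) (n - 2) m 1)"
    proof -
      have "(N + L - 1) * (N + L + 1) * (E (PP * pd 2 q) n m 1 - E (De * pd 3 q) n m 1) =
          (N + L - 1) * ((N + L + 1) * E (PP * pd 2 q) n m 1) - (N + L - 1) * ((N + L + 1) * E (De * pd 3 q) n m 1)"
        by (simp only: right_diff_distrib mult.assoc)
      then show ?thesis unfolding P De by (simp only: mult_ac)
    qed
    also have "\<dots> = (N + L + 1) / 2 * (L * (L - 1) - N * (N - 1)) * E (sg * q) n m 1"
    proof -
      consider "2 \<le> n" "2 \<le> m" | "n < 2" "2 \<le> m" | "2 \<le> n" "m < 2" | "n < 2" "m < 2" by linarith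
      then show ?thesis
      proof cases
        case 1
        have gen: "x * (h * e + w * k) - w * (h * e + x * k) = h * (x - w) * e" for x h e w k :: 'k
          by (simp add: algebra_simps)
        show ?thesis unfolding A[OF 1(2)] T[OF 1(1)] by (rule gen)
      next
        case 2
        then have w: "N * (N - 1) = 0" by (auto simp: N_def less_Suc_eq numeral_2_eq_2)
        have gen: "w = 0 \<Longrightarrow> x * (h * e + w * k) - w * g = h * (x - w) * e" for x h e w k g :: 'k
          by simp
        show ?thesis unfolding A[OF 2(2)] by (rule gen) (rule w)
      next
        case 3
        then have w: "L * (L - 1) = 0" by (auto simp: L_def less_Suc_eq numeral_2_eq_2)
        have gen: "x = 0 \<Longrightarrow> x * g - w * (h * e + x * k) = h * (x - w) * e" for x h e w k g :: 'k
          by simp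
        show ?thesis unfolding T[OF 3(1)] by (rule gen) (rule w)
      next
        case 4
        then have w: "L * (L - 1) = 0" "N * (N - 1) = 0" by (auto simp: L_def N_def less_Suc_eq numeral_2_eq_2)
        show ?thesis by (simp only: w mult_zero_left diff_self mult_zero_right)
      qed
    qed
    also have "L * (L - 1) - N * (N - 1) = (N + L - 1) * (L - N)" by (simp add: algebra_simps)
    finally have "(N + L - 1) * (N + L + 1) * (E (PP * pd 2 q) n m 1 - E (De * pd 3 q) n m 1) =
        (N + L - 1) * (N + L + 1) * ((L - N) / 2 * E (sg * q) n m 1)"
      by (simp add: mult_ac)
    moreover have "(N + L - 1) * (N + L + 1) \<noteq> 0" using nz nz' by simp
    ultimately have "E (PP * pd 2 q) n m 1 - E (De * pd 3 q) n m 1 = (L - N) / 2 * E (sg * q) n m 1"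
      by (rule field_cancel_left)
    then show ?thesis by (simp only: N_def L_def)
  next
    case False
    then have "n + m = 0 \<or> n + m = 1" by linarith
    then have "n + m = 0" using ev by (elim disjE) (simp_all only: odd_one)
    then have "n = 0" "m = 0" by simp_all
    then show ?thesis using P De nz by (simp add: N_def L_def)
  qed
qed

text \<open>With this weight, multiplication by \<open>PP\<close>, \<open>De\<close> or \<open>ka\<close> becomes a pure index shift.\<close>

definition odd_fact :: "nat \<Rightarrow> 'k" where "odd_fact J = (\<Prod>j\<le>J. of_nat (2 * j + 1))"

definition wt :: "nat \<Rightarrow> nat \<Rightarrow> 'k" where "wt n m = odd_fact ((n + m) div 2) / (fact n * fact m)"

definition XN :: "'f \<Rightarrow> nat \<Rightarrow> nat \<Rightarrow> 'k" where "XN q n m = E q n m 1 * wt n m"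

lemma odd_fact_Suc: "odd_fact (Suc J) = odd_fact J * of_nat (2 * J + 3)"
  by (simp add: odd_fact_def eval_nat_numeral)

lemma odd_fact_nonzero: "odd_fact J \<noteq> 0"
  by (auto simp: odd_fact_def simp del: of_nat_Suc of_nat_add)

lemma wt_nonzero: "wt n m \<noteq> 0"
  by (simp add: wt_def odd_fact_nonzero)

lemma wt_rec:
  assumes "even (n + m)"
  shows "wt n (m + 2) * (of_nat (m + 2) * of_nat (m + 1)) = wt n m * of_nat (n + m + 3)"
    "wt (n + 2) m * (of_nat (n + 2) * of_nat (n + 1)) = wt n m * of_nat (n + m + 3)"
    "wt (n + 1) (m + 1) * (of_nat (n + 1) * of_nat (m + 1)) = wt n m * of_nat (n + m + 3)"
proof -
  obtain J where J: "n + m = 2 * J" using assms by (elim evenE)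
  have h: "(n + (m + 2)) div 2 = Suc J" "(n + 2 + m) div 2 = Suc J" "(n + 1 + (m + 1)) div 2 = Suc J"
     "(n + m) div 2 = J" "n + m + 3 = 2 * J + 3" using J by auto
  have f2: "fact (k + 2) = of_nat (k + 2) * of_nat (k + 1) * (fact k :: 'k)" for k
    by (simp add: eval_nat_numeral)
  have f1: "fact (k + 1) = of_nat (k + 1) * (fact k :: 'k)" for k by simp
  have nz: "(of_nat (k + 1) :: 'k) \<noteq> 0" "(of_nat (k + 2) :: 'k) \<noteq> 0" for k
    by (simp_all only: of_nat_eq_0_iff)
  show "wt n (m + 2) * (of_nat (m + 2) * of_nat (m + 1)) = wt n m * of_nat (n + m + 3)"
    "wt (n + 2) m * (of_nat (n + 2) * of_nat (n + 1)) = wt n m * of_nat (n + m + 3)"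
    "wt (n + 1) (m + 1) * (of_nat (n + 1) * of_nat (m + 1)) = wt n m * of_nat (n + m + 3)"
    unfolding wt_def h odd_fact_Suc f2 f1 using nz
    by (simp_all only: times_divide_eq_left divide_eq_eq eq_divide_eq) (simp_all add: field_simps del: of_nat_add of_nat_Suc)
qed


section \<open>Index shifts on the hypersurface AA = 0\<close>

lemma XN_add: "XN (p + q) n m = XN p n m + XN q n m"
  and XN_diff: "XN (p - q) n m = XN p n m - XN q n m"
  by (simp_all add: XN_def E_add E_diff algebra_simps)

text \<open>The model behind the shifts: on \<open>AA = 0\<close> write \<open>PP = S^2\<close>,
  \<open>De = T^2\<close>, \<open>ka = S T\<close>; then \<open>XN q n m\<close> behaves like a
  functional at \<open>q / (T^(n+1) S^(m+1))\<close>. It vanishes when a factor cancels the whole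
  pole in \<open>S\<close> or \<open>T\<close>, which explains the bounds in \<open>XN_PP_0\<close>,
  \<open>XN_De_0\<close> and \<open>XN_ka_0\<close>.\<close>

lemma XN_PP:
  assumes "q \<in> R7" "even (n + m)"
  shows "XN (PP * q) n (m + 2) = XN q n m"
proof -
  have "of_nat (n + m + 3) * E (PP * q) n (m + 2) 1 = of_nat (m + 2) * of_nat (m + 1) * E q n m 1"
    using E_PP[OF assms(1), of n "m + 2"] assms(2) by (simp add: algebra_simps)
  then have "of_nat (n + m + 3) * E (PP * q) n (m + 2) 1 * wt n (m + 2) =
      (wt n (m + 2) * (of_nat (m + 2) * of_nat (m + 1))) * E q n m 1"
    by (simp only: mult_ac)
  then have "of_nat (n + m + 3) * XN (PP * q) n (m + 2) = of_nat (n + m + 3) * XN q n m"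
    unfolding wt_rec(1)[OF assms(2)] XN_def by (simp only: mult_ac)
  moreover have "of_nat (n + m + 3) \<noteq> (0::'k)" by (simp only: of_nat_eq_0_iff)
  ultimately show ?thesis by (rule field_cancel_left)
qed

lemma XN_De:
  assumes "q \<in> R7" "even (n + m)"
  shows "XN (De * q) (n + 2) m = XN q n m"
proof -
  have "of_nat (n + m + 3) * E (De * q) (n + 2) m 1 = of_nat (n + 2) * of_nat (n + 1) * E q n m 1"
    using E_De[OF assms(1), of "n + 2" m] assms(2) by (simp add: algebra_simps)
  then have "of_nat (n + m + 3) * E (De * q) (n + 2) m 1 * wt (n + 2) m =
      (wt (n + 2) m * (of_nat (n + 2) * of_nat (n + 1))) * E q n m 1"
    by (simp only: mult_ac)
  then have "of_nat (n + m + 3) * XN (De * q) (n + 2) m = of_nat (n + m + 3) * XN q n m"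
    unfolding wt_rec(2)[OF assms(2)] XN_def by (simp only: mult_ac)
  moreover have "of_nat (n + m + 3) \<noteq> (0::'k)" by (simp only: of_nat_eq_0_iff)
  ultimately show ?thesis by (rule field_cancel_left)
qed

lemma XN_PP_0: "q \<in> R7 \<Longrightarrow> even (n + m) \<Longrightarrow> m < 2 \<Longrightarrow> XN (PP * q) n m = 0"
proof -
  assume a: "q \<in> R7" "even (n + m)" "m < 2"
  have "m * (m - 1) = 0" using a(3) by (auto simp: less_Suc_eq numeral_2_eq_2)
  then have "of_nat (n + m + 1) * E (PP * q) n m 1 = 0"
    using E_PP[OF a(1,2)] by (simp only: of_nat_0 mult_zero_left)
  moreover have "of_nat (n + m + 1) \<noteq> (0::'k)" by (simp only: of_nat_eq_0_iff)
  ultimately have "E (PP * q) n m 1 = 0" by (metis mult_eq_0_iff)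
  then show ?thesis by (simp add: XN_def)
qed

lemma XN_De_0: "q \<in> R7 \<Longrightarrow> even (n + m) \<Longrightarrow> n < 2 \<Longrightarrow> XN (De * q) n m = 0"
proof -
  assume a: "q \<in> R7" "even (n + m)" "n < 2"
  have "n * (n - 1) = 0" using a(3) by (auto simp: less_Suc_eq numeral_2_eq_2)
  then have "of_nat (n + m + 1) * E (De * q) n m 1 = 0"
    using E_De[OF a(1,2)] by (simp only: of_nat_0 mult_zero_left)
  moreover have "of_nat (n + m + 1) \<noteq> (0::'k)" by (simp only: of_nat_eq_0_iff)
  ultimately have "E (De * q) n m 1 = 0" by (metis mult_eq_0_iff)
  then show ?thesis by (simp add: XN_def)
qed

lemma XN_ka:
  assumes q: "q \<in> R7" and ev: "even (n + m)"
  shows "XN (ka * q) (n + 1) (m + 1) = XN q n m"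
proof -
  let ?s = "of_nat (n + m + 3) :: 'k"
  have 1: "of_nat (n + 1) * E q n m 1 = E (De * q) (n + 2) m 1 + E (ka * q) (n + 1) (m + 1) 1"
    using E_v[OF q, of "n + 1" m 1] ev by simp
  have 2: "?s * E (De * q) (n + 2) m 1 = of_nat (n + 2) * of_nat (n + 1) * E q n m 1"
    using E_De[OF q, of "n + 2" m] ev by (simp add: algebra_simps)
  have "?s * E (ka * q) (n + 1) (m + 1) 1 = ?s * (of_nat (n + 1) * E q n m 1) - of_nat (n + 2) * of_nat (n + 1) * E q n m 1"
    unfolding 1 2[symmetric] by (simp add: algebra_simps)
  also have "\<dots> = of_nat (n + 1) * of_nat (m + 1) * E q n m 1"
    by (simp add: algebra_simps)
  finally have "?s * E (ka * q) (n + 1) (m + 1) 1 * wt (n + 1) (m + 1) =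
      (wt (n + 1) (m + 1) * (of_nat (n + 1) * of_nat (m + 1))) * E q n m 1"
    by (simp only: mult_ac)
  then have "?s * XN (ka * q) (n + 1) (m + 1) = ?s * XN q n m"
    unfolding wt_rec(3)[OF ev] XN_def by (simp only: mult_ac)
  moreover have "?s \<noteq> (0::'k)" by (simp only: of_nat_eq_0_iff)
  ultimately show ?thesis by (rule field_cancel_left)
qed

lemma XN_AA: "q \<in> R7 \<Longrightarrow> even (n + m) \<Longrightarrow> XN (AA * q) n m = 0"
  using E_AA[of q n m 0] by (simp add: XN_def)

text \<open>A second factor \<open>ka\<close> is introduced by an index shift, and
  \<open>ka^2\<close> equals \<open>PP De\<close> modulo \<open>AA\<close>. The raised index that
  started at 0 is now 1, too small for \<open>PP\<close> or \<open>De\<close> to be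
  absorbed.\<close>

lemma XN_ka_0:
  assumes q: "q \<in> R7" and ev: "even (n + m)" and "n = 0 \<or> m = 0"
  shows "XN (ka * q) n m = 0"
proof -
  have "XN (ka * q) n m = XN (ka * (ka * q)) (n + 1) (m + 1)"
    using XN_ka[of "ka * q" n m] q ev by (simp add: R7_mult)
  also have "ka * (ka * q) = PP * (De * q) - AA * (sg * q)" using sg_AA by algebra
  also have "XN \<dots> (n + 1) (m + 1) = XN (PP * (De * q)) (n + 1) (m + 1)"
    using q ev by (simp add: XN_diff XN_AA R7_mult)
  also have "\<dots> = 0"
  proof (cases "m = 0")
    case True
    then show ?thesis using XN_PP_0[of "De * q" "n + 1" "m + 1"] q ev by (simp add: R7_mult)
  next
    case False
    then have "n = 0" using assms(3) by simp
    then have "XN (De * (PP * q)) (n + 1) (m + 1) = 0"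
      using XN_De_0[of "PP * q" "n + 1" "m + 1"] q ev by (simp add: R7_mult)
    then show ?thesis by (simp only: mult.left_commute[of PP])
  qed
  finally show ?thesis .
qed

text \<open>A derivative in a base coordinate produces a double pole along \<open>AA\<close>, which
  \<open>E_lower_i\<close> trades for a derivative in \<open>a\<close>. The remainder involves
  \<open>sg * pd j AA\<close>; rewriting it makes the term with \<open>pd j PP\<close>
  cancel.\<close>

lemma XN_base:
  assumes q: "q \<in> R7" and ev: "even (n + m)" and j: "j \<in> {7..11}"
  shows "XN (pd j q) n m = XN (pd 2 (pd j AA * q)) (n + 2) m
    - (of_nat m - of_nat n) / 2 * XN (pd j De * q) (n + 2) m
    + of_nat (m + 1) * XN (pd j ka * q) (n + 1) (m + 1)"
proof -
  have j': "j \<in> {2..11}" using j by auto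
  let ?A = "pd j AA" and ?D = "pd j De" and ?k = "pd j ka" and ?P = "pd j PP"
  have in7: "?A \<in> R7" "?D \<in> R7" "?k \<in> R7" "?P \<in> R7"
    using pd_in_R7[OF j'] R5_R7[of ka] by simp_all
  have ev2: "even (n + 2 + m)" "even (n + (m + 2))" "even (n + 2 + (m + 2))" "even (n + 1 + (m + 1))"
    using ev by simp_all
  let ?s = "of_nat (n + m + 3) :: 'k" and ?n = "of_nat n :: 'k" and ?m = "of_nat m :: 'k" and ?w = "wt n m"
  have w1: "wt n (m + 2) * ((?m + 2) * (?m + 1)) = ?w * ?s"
    and w2: "wt (n + 2) m * ((?n + 2) * (?n + 1)) = ?w * ?s"
    and w3: "wt (n + 1) (m + 1) * ((?n + 1) * (?m + 1)) = ?w * ?s"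
    using wt_rec[OF ev] by (simp_all add: algebra_simps)
  have w4: "wt (n + 2) (m + 2) * ((?m + 2) * (?m + 1)) = wt (n + 2) m * (?s + 2)"
    using wt_rec(1)[OF ev2(1)] by (simp add: algebra_simps)
  have nz: "?s \<noteq> 0" "?s + 2 \<noteq> 0" "?n + 1 \<noteq> 0" "?n + 2 \<noteq> 0" "?m + 1 \<noteq> 0" "?m + 2 \<noteq> 0"
  proof -
    have "of_nat (n + m + 3) \<noteq> (0::'k)" "of_nat (n + m + 5) \<noteq> (0::'k)" "of_nat (n + 1) \<noteq> (0::'k)"
      "of_nat (n + 2) \<noteq> (0::'k)" "of_nat (m + 1) \<noteq> (0::'k)" "of_nat (m + 2) \<noteq> (0::'k)"
      by (simp_all only: of_nat_eq_0_iff)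
    then show "?s \<noteq> 0" "?s + 2 \<noteq> 0" "?n + 1 \<noteq> 0" "?n + 2 \<noteq> 0" "?m + 1 \<noteq> 0" "?m + 2 \<noteq> 0"
      by (simp_all add: algebra_simps)
  qed
  have s_eq: "?s = ?n + ?m + 3" by simp
  have low: "(?n + 2) * (?n + 1) * E (?A * q) n m 2 =
      ?s * E (pd 2 (?A * q)) (n + 2) m 1 - (1 + ?s / 2) * E (sg * (?A * q)) (n + 2) (m + 2) 1"
    using E_lower_i[of "?A * q" n m 1] in7 q ev
    by (simp add: ring_gen.mult eval_nat_numeral algebra_simps)
  have base: "E (pd j q) n m 1 = E (?A * q) n m 2 + E (?D * q) (n + 2) m 1 / 2
    + E (?k * q) (n + 1) (m + 1) 1 + E (?P * q) n (m + 2) 1 / 2"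
    using E_base[OF q ev j, of 1] by (simp add: eval_nat_numeral)
  define a1 where "a1 = XN (pd 2 (?A * q)) (n + 2) m"
  define a2 where "a2 = XN (sg * (?A * q)) (n + 2) (m + 2)"
  define a3 where "a3 = XN (?D * q) (n + 2) m"
  define a4 where "a4 = XN (?k * q) (n + 1) (m + 1)"
  define a5 where "a5 = XN (?P * q) n (m + 2)"
  \<comment> \<open>This is the derivative of the condensation identity \<open>sg_AA\<close>, so
    that index shifts apply to each summand.\<close>
  have "sg * (?A * q) = PP * (?D * q) + De * (?P * q) - 2 * (ka * (?k * q)) - AA * (pd j sg * q)"
  proof -
    have "pd j (sg * AA) = pd j (PP * De - ka\<^sup>2)" by (simp only: sg_AA)
    then have "sg * ?A + pd j sg * AA = PP * ?D + ?P * De - 2 * ka * ?k" using j' by simp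
    then show ?thesis by algebra
  qed
  moreover have "XN (2 * (ka * (?k * q))) (n + 2) (m + 2) = 2 * XN (ka * (?k * q)) (n + 2) (m + 2)"
    using XN_add[of "ka * (?k * q)" "ka * (?k * q)" "n + 2" "m + 2"] by (simp add: mult_2[symmetric])
  moreover have "XN (ka * (?k * q)) (n + 2) (m + 2) = a4"
    using XN_ka[of "?k * q" "n + 1" "m + 1"] in7 q ev by (simp add: a4_def ring_gen.mult)
  moreover have "XN (PP * (?D * q)) (n + 2) (m + 2) = a3"
    using XN_PP[of "?D * q" "n + 2" m] in7 q ev by (simp add: a3_def ring_gen.mult)
  moreover have "XN (De * (?P * q)) (n + 2) (m + 2) = a5"
    using XN_De[of "?P * q" n "m + 2"] in7 q ev by (simp add: a5_def ring_gen.mult)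
  moreover have "XN (AA * (pd j sg * q)) (n + 2) (m + 2) = 0"
  proof -
    have "pd j sg \<in> R7" using pd_in_R5[OF j', of sg] R5_R7 by simp
    then show ?thesis using q ev by (intro XN_AA) (simp_all add: ring_gen.mult)
  qed
  ultimately have a2: "a2 = a3 + a5 - 2 * a4"
    unfolding a2_def by (simp add: XN_add XN_diff)
  have W: "E (?A * q) n m 2 * ?w = a1 - (?m + 2) * (?m + 1) / (2 * ?s) * a2"
  proof -
    have "?s * (E (?A * q) n m 2 * ?w) = wt (n + 2) m * ((?n + 2) * (?n + 1) * E (?A * q) n m 2)"
      using w2 by (simp add: mult_ac)
    also have "\<dots> = ?s * a1 - (1 + ?s / 2) * (wt (n + 2) m * E (sg * (?A * q)) (n + 2) (m + 2) 1)"
      unfolding low a1_def XN_def by (simp add: algebra_simps)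
    also have "(1 + ?s / 2) * (wt (n + 2) m * E (sg * (?A * q)) (n + 2) (m + 2) 1) =
        (wt (n + 2) m * (?s + 2)) * E (sg * (?A * q)) (n + 2) (m + 2) 1 / 2"
      by (simp add: field_simps)
    also have "\<dots> = (?m + 2) * (?m + 1) / 2 * a2"
      unfolding w4[symmetric] a2_def XN_def by (simp add: mult_ac)
    also have "?s * a1 - (?m + 2) * (?m + 1) / 2 * a2 = ?s * (a1 - (?m + 2) * (?m + 1) / (2 * ?s) * a2)"
    proof -
      have "s \<noteq> 0 \<Longrightarrow> s * x - P / 2 * z = s * (x - P / (2 * s) * z)" for s x P z :: 'k
        by (simp add: right_diff_distrib)
      then show ?thesis using nz(1) by blast
    qed
    finally have "?s * (E (?A * q) n m 2 * ?w) = ?s * (a1 - (?m + 2) * (?m + 1) / (2 * ?s) * a2)" .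
    then show ?thesis using nz(1) by (rule field_cancel_left)
  qed
  have scale: "e * w = P / s * (e * w')" if "s \<noteq> 0" "w' * P = w * s" for e w w' P s :: 'k
  proof -
    have "P / s * (e * w') = (w' * P) * e / s" by (simp add: mult_ac)
    then show ?thesis using that by simp
  qed
  have X3: "E (?D * q) (n + 2) m 1 * ?w = (?n + 2) * (?n + 1) / ?s * a3"
    unfolding a3_def XN_def by (rule scale[OF nz(1) w2])
  have X4: "E (?k * q) (n + 1) (m + 1) 1 * ?w = (?n + 1) * (?m + 1) / ?s * a4"
    unfolding a4_def XN_def by (rule scale[OF nz(1) w3])
  have X5: "E (?P * q) n (m + 2) 1 * ?w = (?m + 2) * (?m + 1) / ?s * a5"
    unfolding a5_def XN_def by (rule scale[OF nz(1) w1])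
  have "XN (pd j q) n m = E (?A * q) n m 2 * ?w + E (?D * q) (n + 2) m 1 * ?w / 2
     + E (?k * q) (n + 1) (m + 1) 1 * ?w + E (?P * q) n (m + 2) 1 * ?w / 2"
    unfolding XN_def base by (simp add: algebra_simps)
  also have "\<dots> = a1 - (?m + 2) * (?m + 1) / (2 * ?s) * (a3 + a5 - 2 * a4) + (?n + 2) * (?n + 1) / ?s * a3 / 2
     + (?n + 1) * (?m + 1) / ?s * a4 + (?m + 2) * (?m + 1) / ?s * a5 / 2"
    unfolding W X3 X4 X5 a2 ..
  also have "\<dots> = a1 - (?m - ?n) / 2 * a3 + (?m + 1) * a4"
  proof -
    have "2 * ?s * (a1 - (?m + 2) * (?m + 1) / (2 * ?s) * (a3 + a5 - 2 * a4) + (?n + 2) * (?n + 1) / ?s * a3 / 2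
     + (?n + 1) * (?m + 1) / ?s * a4 + (?m + 2) * (?m + 1) / ?s * a5 / 2) =
       2 * ?s * a1 - (?m + 2) * (?m + 1) * (a3 + a5 - 2 * a4) + (?n + 2) * (?n + 1) * a3
     + 2 * (?n + 1) * (?m + 1) * a4 + (?m + 2) * (?m + 1) * a5"
      using nz(1) by (simp add: field_simps del: of_nat_add)
    also have "\<dots> = 2 * ?s * (a1 - (?m - ?n) / 2 * a3 + (?m + 1) * a4)"
      unfolding s_eq by (simp add: field_simps)
    finally show ?thesis by (rule field_cancel_left) (use nz(1) in \<open>simp only: mult_eq_0_iff, simp\<close>)
  qed
  finally show ?thesis by (simp add: a1_def a3_def a4_def add.commute)
qed


text \<open>Extension by zero makes the shift rules below valid for all integer indices.\<close>

definition XX :: "'f \<Rightarrow> int \<Rightarrow> int \<Rightarrow> 'k" where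
  "XX q n e = (if n < 0 \<or> n + 2 * e < 0 then 0 else XN q (nat n) (nat (n + 2 * e)))"

lemma XX_add: "XX (p + q) n e = XX p n e + XX q n e"
  and XX_diff: "XX (p - q) n e = XX p n e - XX q n e"
  by (simp_all add: XX_def XN_add XN_diff)

lemma XX_zero [simp]: "XX 0 n e = 0"
  using XX_add[of 0 0 n e] by simp

lemma XX_of_nat: "XX (of_nat k * q) n e = of_nat k * XX q n e"
  by (induction k) (simp_all add: XX_add distrib_right)

lemma XX_nonneg:
  assumes "0 \<le> n" "0 \<le> n + 2 * e"
  shows "\<exists>N L. n = int N \<and> n + 2 * e = int L \<and> even (N + L) \<and> (\<forall>q. XX q n e = XN q N L) \<and>
    (of_nat L - of_nat N) / 2 = (of_int e :: 'k)"
proof (intro exI conjI allI)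
  show "n = int (nat n)" "n + 2 * e = int (nat (n + 2 * e))" using assms by simp_all
  show "even (nat n + nat (n + 2 * e))" using assms by (simp add: even_nat_iff flip: nat_add_distrib)
  show "XX q n e = XN q (nat n) (nat (n + 2 * e))" for q using assms by (simp add: XX_def)
  show "(of_nat (nat (n + 2 * e)) - of_nat (nat n)) / 2 = (of_int e :: 'k)" using assms by simp
qed

text \<open>Since \<open>n + 2 e\<close> is the exponent of \<open>r\<close>, the index
  \<open>e\<close> is the torus weight: \<open>PP\<close> lowers it at fixed \<open>n\<close>,
  \<open>De\<close> raises it while lowering \<open>n\<close> by two, and \<open>ka\<close> leaves
  it alone.\<close>

lemma XX_PP:
  assumes q: "q \<in> R7"
  shows "XX (PP * q) n e = XX q n (e - 1)"
proof (cases "n < 0 \<or> n + 2 * e < 0")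
  case True
  then show ?thesis by (auto simp: XX_def)
next
  case False
  then have nn: "0 \<le> n" "0 \<le> n + 2 * e" by auto
  obtain N L where NL: "n = int N" "n + 2 * e = int L" "even (N + L)" "\<And>q. XX q n e = XN q N L"
    "(of_nat L - of_nat N) / 2 = (of_int e :: 'k)"
    using XX_nonneg[OF nn] by blast
  show ?thesis
  proof (cases "L < 2")
    case True
    then have "n + 2 * (e - 1) < 0" using NL by simp
    then show ?thesis using XN_PP_0[OF q NL(3) True] NL(4) by (simp add: XX_def)
  next
    case False
    then obtain L' where L: "L = L' + 2" by (metis le_add_diff_inverse2 not_le)
    then have "n + 2 * (e - 1) = int L'" using NL by simp
    then have "XX q n (e - 1) = XN q N L'" using NL(1) by (simp add: XX_def)
    then show ?thesis using XN_PP[OF q, of N L'] NL(3,4) L by simp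
  qed
qed

lemma XX_De:
  assumes q: "q \<in> R7"
  shows "XX (De * q) n e = XX q (n - 2) (e + 1)"
proof (cases "n < 0 \<or> n + 2 * e < 0")
  case True
  then show ?thesis by (auto simp: XX_def)
next
  case False
  then have nn: "0 \<le> n" "0 \<le> n + 2 * e" by auto
  obtain N L where NL: "n = int N" "n + 2 * e = int L" "even (N + L)" "\<And>q. XX q n e = XN q N L"
    "(of_nat L - of_nat N) / 2 = (of_int e :: 'k)"
    using XX_nonneg[OF nn] by blast
  show ?thesis
  proof (cases "N < 2")
    case True
    then have "n - 2 < 0" using NL by simp
    then show ?thesis using XN_De_0[OF q NL(3) True] NL(4) by (simp add: XX_def)
  next
    case False
    then obtain N' where N: "N = N' + 2" by (metis le_add_diff_inverse2 not_le)
    then have "n - 2 = int N'" "n - 2 + 2 * (e + 1) = int L" using NL by simp_all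
    then have "XX q (n - 2) (e + 1) = XN q N' L" by (simp add: XX_def)
    then show ?thesis using XN_De[OF q, of N' L] NL(3,4) N by simp
  qed
qed

lemma XX_ka:
  assumes q: "q \<in> R7"
  shows "XX (ka * q) n e = XX q (n - 1) e"
proof (cases "n < 0 \<or> n + 2 * e < 0")
  case True
  then show ?thesis by (auto simp: XX_def)
next
  case False
  then have nn: "0 \<le> n" "0 \<le> n + 2 * e" by auto
  obtain N L where NL: "n = int N" "n + 2 * e = int L" "even (N + L)" "\<And>q. XX q n e = XN q N L"
    "(of_nat L - of_nat N) / 2 = (of_int e :: 'k)"
    using XX_nonneg[OF nn] by blast
  show ?thesis
  proof (cases "N = 0 \<or> L = 0")
    case True
    then have "n - 1 < 0 \<or> n - 1 + 2 * e < 0" using NL by auto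
    then have "XX q (n - 1) e = 0" by (simp add: XX_def)
    then show ?thesis using XN_ka_0[OF q NL(3) True] NL(4) by simp
  next
    case False
    then obtain N' L' where N: "N = N' + 1" "L = L' + 1" by (metis Suc_eq_plus1 not0_implies_Suc)
    then have "n - 1 = int N'" "n - 1 + 2 * e = int L'" using NL by simp_all
    then have "XX q (n - 1) e = XN q N' L'" by (simp add: XX_def)
    then show ?thesis using XN_ka[OF q, of N' L'] NL(3,4) N by simp
  qed
qed

lemma XX_torus:
  assumes q: "q \<in> R7"
  shows "XX (PP * pd 2 q - De * pd 3 q) n e = of_int e * XX (sg * q) n e"
proof (cases "n < 0 \<or> n + 2 * e < 0")
  case True
  then show ?thesis by (auto simp: XX_def)
next
  case False
  then have nn: "0 \<le> n" "0 \<le> n + 2 * e" by auto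
  obtain N L where NL: "n = int N" "n + 2 * e = int L" "even (N + L)" "\<And>q. XX q n e = XN q N L"
    "(of_nat L - of_nat N) / 2 = (of_int e :: 'k)"
    using XX_nonneg[OF nn] by blast
  show ?thesis using E_weight_torus[OF q NL(3)]
    by (simp only: NL(4) XN_def E_diff left_diff_distrib[symmetric] NL(5)) (simp add: mult_ac)
qed

text \<open>The indices on the right exceed those on the left, so extension by zero does not carry
  this relation over to negative indices; hence the two bounds.\<close>

lemma XX_base:
  assumes q: "q \<in> R7" and j: "j \<in> {7..11}" and nn: "0 \<le> n" "0 \<le> n + 2 * e"
  shows "XX (pd j q) n e = XX (pd 2 (pd j AA * q)) (n + 2) (e - 1)
    - of_int e * XX (pd j De * q) (n + 2) (e - 1) + of_int (n + 2 * e + 1) * XX (pd j ka * q) (n + 1) e"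
proof -
  obtain N L where NL: "n = int N" "n + 2 * e = int L" "even (N + L)" "\<And>q. XX q n e = XN q N L"
    "(of_nat L - of_nat N) / 2 = (of_int e :: 'k)"
    using XX_nonneg[OF nn] by blast
  have "XX q' (n + 2) (e - 1) = XN q' (N + 2) L" for q'
  proof -
    have h: "n + 2 = int (N + 2)" "int (N + 2) + 2 * (e - 1) = int L" using NL by simp_all
    show ?thesis unfolding XX_def h nat_int by (simp del: of_nat_add)
  qed
  moreover have "XX q' (n + 1) e = XN q' (N + 1) (L + 1)" for q'
  proof -
    have h: "n + 1 = int (N + 1)" "int (N + 1) + 2 * e = int (L + 1)" using NL by simp_all
    show ?thesis unfolding XX_def h nat_int by (simp del: of_nat_add of_nat_Suc)
  qed
  moreover have "of_int (n + 2 * e + 1) = (of_nat (L + 1) :: 'k)" using NL(2) by simp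
  ultimately show ?thesis using XN_base[OF q NL(3) j] by (simp only: NL(4) NL(5))
qed

section \<open>Laurent coefficients in the torus coordinate\<close>

text \<open>In the model, \<open>a = (PP + al) / sg\<close> and
  \<open>t = (ka^2 / PP + ep) / sg\<close> on \<open>AA = 0\<close>. Then \<open>F w k l n e\<close>
  stands for the coefficient of \<open>PP^e\<close> in \<open>a^k t^l\<close>, multiplied by
  \<open>w / (sg ka^(n+1))\<close>.\<close>

definition F :: "'f \<Rightarrow> nat \<Rightarrow> nat \<Rightarrow> int \<Rightarrow> int \<Rightarrow> 'k" where
  "F w k l n e = XX (w * a ^ k * t ^ l) n e"

lemma monomial_R7: "w \<in> R5 \<Longrightarrow> w * a ^ k * t ^ l \<in> R7"
  by (auto intro!: ring_gen_closed intro: R5_R7)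

lemma F_torus:
  assumes w: "w \<in> R5"
  shows "of_nat k * F w (k - 1) l n (e - 1) - of_nat l * F w k (l - 1) (n - 2) (e + 1) =
    of_int e * F (sg * w) k l n e"
proof -
  let ?q = "w * a ^ k * t ^ l"
  have "pd 2 ?q = of_nat k * (w * a ^ (k - 1) * t ^ l)" "pd 3 ?q = of_nat l * (w * a ^ k * t ^ (l - 1))"
    using w by (simp_all add: pd_power pd_X pd_R5)
  then have "PP * pd 2 ?q - De * pd 3 ?q =
      of_nat k * (PP * (w * a ^ (k - 1) * t ^ l)) - of_nat l * (De * (w * a ^ k * t ^ (l - 1)))"
    by (simp add: mult_ac)
  moreover have "sg * ?q = sg * w * a ^ k * t ^ l" by (simp add: mult_ac)
  ultimately show ?thesis using XX_torus[OF monomial_R7[OF w], of k l n e]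
    by (simp only: F_def XX_diff XX_of_nat XX_PP[OF monomial_R7[OF w]] XX_De[OF monomial_R7[OF w]])
qed

lemma F_PP:
  assumes w: "w \<in> R5"
  shows "F (sg * w) (Suc k) l n e = F (al * w) k l n e + F w k l n (e - 1)"
proof -
  have "sg * w * a ^ Suc k * t ^ l = al * w * a ^ k * t ^ l + PP * (w * a ^ k * t ^ l)"
    by (simp add: PP_def algebra_simps)
  then show ?thesis by (simp only: F_def XX_add XX_PP[OF monomial_R7[OF w]])
qed

lemma F_De:
  assumes w: "w \<in> R5"
  shows "F (sg * w) k (Suc l) n e = F (ep * w) k l n e + F w k l (n - 2) (e + 1)"
proof -
  have "sg * w * a ^ k * t ^ Suc l = ep * w * a ^ k * t ^ l + De * (w * a ^ k * t ^ l)"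
    by (simp add: De_def algebra_simps)
  then show ?thesis by (simp only: F_def XX_add XX_De[OF monomial_R7[OF w]])
qed

text \<open>The torus relation is used one step higher, at \<open>a^(k+1)\<close>, where
  \<open>F_PP\<close> removes the product \<open>sg a\<close>; thus nothing is divided by
  \<open>sg\<close>. The coefficient \<open>k - e\<close> vanishes exactly on the diagonal
  \<open>e = k\<close>, so the diagonal values are the ones that this recursion leaves open.\<close>

lemma F_B1:
  assumes w: "w \<in> R5"
  shows "(of_nat k - of_int e) * F w k l n e = of_nat l * F w (Suc k) (l - 1) (n - 2) (e + 2)
    + (of_int e + 1) * F (al * w) k l n (e + 1)"
proof -
  have "(of_nat k + 1) * F w k l n e - of_nat l * F w (Suc k) (l - 1) (n - 2) (e + 2) =
      (of_int e + 1) * (F (al * w) k l n (e + 1) + F w k l n e)"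
    using F_torus[OF w, of "Suc k" l n "e + 1"] by (simp add: F_PP[OF w] add.commute)
  then show ?thesis by (simp add: algebra_simps)
qed

lemma F_B2:
  assumes w: "w \<in> R5"
  shows "(of_nat l + of_int e) * F w k l n e = of_nat k * F w (k - 1) (Suc l) (n + 2) (e - 2)
    - (of_int e - 1) * F (ep * w) k l (n + 2) (e - 1)"
proof -
  have "of_nat k * F w (k - 1) (Suc l) (n + 2) (e - 2) - (of_nat l + 1) * F w k l n e =
      (of_int e - 1) * (F (ep * w) k l (n + 2) (e - 1) + F w k l n e)"
    using F_torus[OF w, of k "Suc l" "n + 2" "e - 1"] by (simp add: F_De[OF w] add.commute)
  then show ?thesis by (simp add: algebra_simps)
qed

lemma ep_R5: "w \<in> R5 \<Longrightarrow> ep * w \<in> R5" and al_R5: "w \<in> R5 \<Longrightarrow> al * w \<in> R5"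
  and ka_R5: "w \<in> R5 \<Longrightarrow> ka * w \<in> R5"
  by (auto intro: ring_gen.mult)


abbreviation "T w k l n \<equiv> F w k l n (int k)"

lemma T_shift_0:
  assumes w: "w \<in> R5"
  shows "T w 0 (Suc l) n = T (ep * w) 1 l n"
proof -
  have "(of_nat l + 1) * F w 0 (Suc l) n 0 = F (ep * w) 0 (Suc l) (n + 2) (- 1)"
    using F_B2[OF w, of "Suc l" 0 0 n] by (simp add: add.commute)
  also have "\<dots> = (of_nat l + 1) * F (ep * w) 1 l n 1"
    using F_B2[OF ep_R5[OF w], of l 1 1 n] by simp
  finally show ?thesis
    using of_nat_neq_0[of l, where 'a='k] by (simp add: add.commute)
qed

lemma T_shift_1:
  assumes w: "w \<in> R5"
  shows "T w 1 (Suc l) n = T (ep * w) 2 l n"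
proof -
  let ?w = "ep * w"
  define L :: 'k where "L = of_nat (Suc l)"
  have L: "of_nat l = L - 1" by (simp add: L_def)
  have nz: "L \<noteq> 0" "L + 1 \<noteq> 0"
    using of_nat_neq_0[of l, where 'a='k] of_nat_neq_0[of "Suc l", where 'a='k]
    by (simp_all add: L_def algebra_simps)
  define x1 x2 x3 x4 where "x1 = F ?w 1 (Suc l) (n + 2) 0" and "x2 = F (ep * ?w) 2 l (n + 2) 1"
    and "x3 = F (ep * ?w) 1 (Suc l) (n + 4) (- 1)" and "x4 = F ?w 0 (Suc (Suc l)) (n + 4) (- 2)"
  define x5 where "x5 = F w 0 (Suc (Suc l)) (n + 2) (- 1)"
  have 1: "(L + 1) * F ?w 2 l n 2 = 2 * x1 - x2"
    using F_B2[OF ep_R5[OF w], of l 2 2 n] by (simp add: x1_def x2_def L add.commute)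
  have 2: "L * x2 = 2 * x3"
    using F_B2[OF ep_R5[OF ep_R5[OF w]], of l 1 2 "n + 2"] by (simp add: x2_def x3_def L add.commute)
  have 3: "L * x1 = x4 + x3"
    using F_B2[OF ep_R5[OF w], of "Suc l" 0 1 "n + 2"]
    by (simp add: x1_def x3_def x4_def L_def add.commute)
  have 4: "(L + 1) * F w 1 (Suc l) n 1 = x5"
    using F_B2[OF w, of "Suc l" 1 1 n] by (simp add: x5_def L_def add.commute)
  have 5: "L * x5 = 2 * x4"
    using F_B2[OF w, of "Suc (Suc l)" "- 1" 0 "n + 2"] by (simp add: x4_def x5_def L_def add.commute)
  have "L * ((L + 1) * F ?w 2 l n 2) = L * ((L + 1) * F w 1 (Suc l) n 1)"
    unfolding 1 4 5 using 2 3 by algebra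
  then have "F ?w 2 l n 2 = F w 1 (Suc l) n 1" using nz by simp
  then show ?thesis by simp
qed

text \<open>On the diagonal only the top coefficient counts: \<open>PP^k\<close> in
  \<open>a^k t^(l+1)\<close> arises from \<open>PP^k\<close> and \<open>ep^(l+1)\<close> alone. A
  factor \<open>t\<close> therefore acts as \<open>ep / sg\<close>, and a factor \<open>a\<close> as
  \<open>1 / sg\<close>.\<close>

lemma T_shift: "w \<in> R5 \<Longrightarrow> T w k (Suc l) n = T (ep * w) (Suc k) l n"
proof (induction k arbitrary: w l n)
  case 0
  then show ?case using T_shift_0 by simp
next
  case (Suc j)
  show ?case
  \<comment> \<open>The generic elimination ends in a division by \<open>j\<close>, which is why
    exponent 1 was treated separately in \<open>T_shift_1\<close>.\<close>
  proof (cases j)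
    case 0
    then show ?thesis using T_shift_1[OF Suc.prems, of l n] by (simp add: numeral_2_eq_2)
  next
    case (Suc i)
    let ?w = "ep * w" and ?k = "Suc j"
    define K :: 'k where "K = of_nat j"
    define L :: 'k where "L = of_nat (Suc l)"
    have nz: "L \<noteq> 0" "K \<noteq> 0"
      using of_nat_neq_0[of l, where 'a='k] of_nat_neq_0[of i, where 'a='k] Suc
      by (simp_all add: L_def K_def)
    define x1 x2 where "x1 = F w j (Suc (Suc l)) (n + 2) (int j - 1)"
      and "x2 = F ?w ?k (Suc l) (n + 2) (int j)"
    define T1 T2 where "T1 = T w ?k (Suc l) n" and "T2 = T ?w (Suc ?k) l n"
    define A1 A2 where "A1 = T (al * w) j (Suc (Suc l)) (n + 2)" and "A2 = T (al * ?w) ?k (Suc l) (n + 2)"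
    have 1: "(L + K + 1) * T1 = (K + 1) * x1 - K * x2"
      using F_B2[OF Suc.prems, of "Suc l" "int ?k" ?k n]
      by (simp add: T1_def x1_def x2_def L_def K_def algebra_simps)
    have 2: "x2 = L * T2 + (K + 1) * A2"
      using F_B1[OF ep_R5[OF Suc.prems], of ?k "int j" "Suc l" "n + 2"]
      by (simp add: x2_def T2_def A2_def L_def K_def algebra_simps)
    have 3: "x1 = (L + 1) * T1 + K * A1"
      using F_B1[OF Suc.prems, of j "int j - 1" "Suc (Suc l)" "n + 2"]
      by (simp add: x1_def T1_def A1_def L_def K_def algebra_simps)
    \<comment> \<open>The terms with \<open>al\<close> produced by the two off-diagonal values agree
      by the induction hypothesis; once they are identified, the remaining relation is linear in
      \<open>T1\<close> and \<open>T2\<close>.\<close>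
    have "al * ?w = ep * (al * w)" by (simp add: mult_ac)
    then have 4: "A1 = A2"
      using Suc.IH[OF al_R5[OF Suc.prems], of "Suc l" "n + 2"] by (simp only: A1_def A2_def)
    have "L * K * T1 = L * K * T2" using 1 unfolding 2 3 4 by algebra
    then show ?thesis using nz by (simp add: T1_def T2_def)
  qed
qed

text \<open>Away from the diagonal the values are forced: for \<open>e > k\<close> by
  \<open>F_B2\<close>, whose coefficient \<open>l + e\<close> is positive there, and for
  \<open>e < k\<close> by \<open>F_B1\<close>, whose coefficient is \<open>k - e\<close>.\<close>

lemma F_vanish:
  assumes mu: "\<And>w s n. w \<in> R5 \<Longrightarrow> T w s 0 n = 0"
  shows "w \<in> R5 \<Longrightarrow> F w k l n e = 0"
proof -
  have T0: "T w k l n = 0" if "w \<in> R5" for w k l n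
    using that
  proof (induction l arbitrary: w k)
    case 0
    then show ?case by (rule mu)
  next
    case (Suc l)
    then show ?case by (simp only: T_shift[OF Suc.prems] ep_R5)
  qed
  have up: "F w k l n (int k + int d) = 0" if "w \<in> R5" for w k l n d
    using that
  proof (induction k arbitrary: w l n d)
    case 0
    then show ?case
    proof (induction d arbitrary: w n)
      case 0
      then show ?case using T0[of w 0 l n] by simp
    next
      case (Suc d)
      have "(of_nat l + of_int (int (Suc d))) * F w 0 l n (int (Suc d)) = 0"
        using F_B2[OF Suc.prems, of l "int (Suc d)" 0 n] Suc.IH[OF ep_R5[OF Suc.prems], of "n + 2"] by simp
      moreover have "(of_nat l + of_int (int (Suc d)) :: 'k) = of_nat (l + Suc d)" by simp
      ultimately show ?case by (simp only: mult_eq_0_iff of_nat_eq_0_iff) simp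
    qed
  next
    case (Suc k)
    show ?case using Suc.prems
    proof (induction d arbitrary: w n)
      case 0
      then show ?case using T0[of w "Suc k" l n] by simp
    next
      case (Suc d)
      let ?e = "int (Suc k) + int (Suc d)"
      have "F w k (Suc l) (n + 2) (?e - 2) = 0"
        using Suc.IH Suc.prems \<open>\<And>w l n d. w \<in> R5 \<Longrightarrow> F w k l n (int k + int d) = 0\<close>[OF Suc.prems, of "Suc l" "n + 2" d]
        by simp
      moreover have "F (ep * w) (Suc k) l (n + 2) (?e - 1) = 0"
        using Suc.IH[OF ep_R5[OF Suc.prems], of "n + 2"] by (simp add: add.assoc)
      ultimately have "(of_nat l + of_int ?e) * F w (Suc k) l n ?e = 0"
        using F_B2[OF Suc.prems, of l ?e "Suc k" n] by simp
      moreover have "(of_nat l + of_int ?e :: 'k) = of_nat (l + Suc k + Suc d)" by simp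
      ultimately show ?case by (simp only: mult_eq_0_iff of_nat_eq_0_iff) simp
    qed
  qed
  have down: "F w k l n (int k - int d) = 0" if "w \<in> R5" for w k l n d
    using that
  proof (induction l arbitrary: w k n d)
    case 0
    then show ?case
    proof (induction d arbitrary: w)
      case 0
      then show ?case using T0[of w k 0 n] by simp
    next
      case (Suc d)
      have "of_nat (Suc d) * F w k 0 n (int k - int (Suc d)) = 0"
        using F_B1[OF Suc.prems, of k "int k - int (Suc d)" 0 n] Suc.IH[OF al_R5[OF Suc.prems]] by simp
      then show ?case by (simp only: mult_eq_0_iff of_nat_eq_0_iff) simp
    qed
  next
    case (Suc l)
    note IHl = Suc.IH
    show ?case using Suc.prems
    proof (induction d arbitrary: w)
      case 0
      then show ?case using T0[of w k "Suc l" n] by simp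
    next
      case (Suc d)
      let ?e = "int k - int (Suc d)"
      have "F w (Suc k) l (n - 2) (?e + 2) = 0"
      proof (cases d)
        case 0
        then show ?thesis using up[OF Suc.prems, of "Suc k" l "n - 2" 0] by simp
      next
        case (Suc d')
        have "?e + 2 = int (Suc k) - int d" by simp
        then show ?thesis using IHl[OF Suc.prems, of "Suc k" "n - 2" d] by (simp only:)
      qed
      moreover have "F (al * w) k (Suc l) n (?e + 1) = 0"
        using Suc.IH[OF al_R5[OF Suc.prems]] by simp
      ultimately have "of_nat (Suc d) * F w k (Suc l) n ?e = 0"
        using F_B1[OF Suc.prems, of k ?e "Suc l" n] by simp
      then show ?case by (simp only: mult_eq_0_iff of_nat_eq_0_iff) simp
    qed
  qed
  show "w \<in> R5 \<Longrightarrow> F w k l n e = 0"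
  proof (cases "int k \<le> e")
    case True
    then have "e = int k + int (nat (e - int k))" by simp
    then show "w \<in> R5 \<Longrightarrow> ?thesis" using up by metis
  next
    case False
    then have "e = int k - int (nat (int k - e))" by simp
    then show "w \<in> R5 \<Longrightarrow> ?thesis" using down by metis
  qed
qed

text \<open>The reductions run backwards: diagonal values give all \<open>XX\<close>, hence simple
  poles, hence all pole orders through \<open>E_lower_i\<close>. \<open>M_weight\<close> disposes of
  the other exponents of \<open>f\<close>, and \<open>R10\<close> consists of sums of
  monomials.\<close>

lemma lam_vanish:
  assumes mu: "\<And>w s n. w \<in> R5 \<Longrightarrow> T w s 0 n = 0" and g: "g \<in> R10"
  shows "lam (g / f ^ K) = 0"
proof -
  have XX0: "XX q n e = 0" if "q \<in> R7" for q n e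
    using that unfolding S7_def
  proof (induction rule: ring_gen_adjoin_induct)
    case (monom w k)
    then show ?case
    proof (induction rule: ring_gen_adjoin_induct)
      case (monom w l)
      have "w * t ^ l * a ^ k = w * a ^ k * t ^ l" by (simp add: mult_ac)
      then show ?case using F_vanish[OF mu monom, of k l n e] by (simp only: F_def)
    qed (simp add: distrib_right XX_add)
  qed (simp add: XX_add)
  have XN0: "XN q n m = 0" if "q \<in> R7" "even (n + m)" for q n m
  proof -
    have "int n + 2 * ((int m - int n) div 2) = int m" using that(2) by auto
    then have "XN q n m = XX q (int n) ((int m - int n) div 2)" by (simp only: XX_def) simp
    then show ?thesis using XX0[OF that(1)] by simp
  qed
  have E0: "E q n m (Suc i) = 0" if "q \<in> R7" "even (n + m)" for q n m i
    using that
  proof (induction i arbitrary: q n m)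
    case 0
    then have "E q n m 1 * wt n m = 0" using XN0[of q n m] by (simp add: XN_def mult.commute)
    then show ?case using wt_nonzero by simp
  next
    case (Suc i)
    have "of_nat (Suc i) * of_nat ((n + 2) * (n + 1)) * E q n m (Suc (Suc i)) = 0"
      using E_lower_i[OF Suc.prems, of "Suc i"] Suc.IH[of "pd 2 q" "n + 2" m]
        Suc.IH[of "sg * q" "n + 2" "m + 2"] Suc.prems
      by (simp add: pd_in_R7 R7_mult del: of_nat_Suc of_nat_mult)
    then show ?case by (simp only: mult_eq_0_iff of_nat_eq_0_iff) simp
  qed
  have M0: "M q n m k K = 0" if "q \<in> R7" for q n m k K
  proof (cases "2 * k + n + m + 4 = 2 * K")
    case False
    then show ?thesis using M_weight[OF that] by simp
  next
    case True
    then have "even (n + m)" by presburger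
    then obtain J where J: "n + m = 2 * J" by (elim evenE)
    then have "K = k + J + 2" using True by simp
    moreover have "CC J k \<noteq> 0" by (simp add: CC_def del: fact_Suc of_nat_add of_nat_Suc)
    ultimately show ?thesis using E0[OF that \<open>even (n + m)\<close>, of k] E_CC[OF J, of q k] by simp
  qed
  from g show ?thesis unfolding S10_def
  proof (induction rule: ring_gen_adjoin_induct)
    case (monom w k)
    then show ?case
    proof (induction rule: ring_gen_adjoin_induct)
      case (monom w n)
      then show ?case
      proof (induction rule: ring_gen_adjoin_induct)
        case (monom w m)
        have "w * r ^ m * v ^ n * c ^ k = w * v ^ n * r ^ m * c ^ k" by (simp add: mult_ac)
        then show ?case using M0[OF monom, of n m k K] by (simp only: M_def)
      qed (simp add: distrib_right add_divide_distrib lam_add)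
    qed (simp add: distrib_right add_divide_distrib lam_add)
  qed (simp add: add_divide_distrib lam_add)
qed

text \<open>\<open>mu w s n\<close> plays the role of a functional evaluated at \<open>w / (sg\<^bsup>s+1\<^esup> ka\<^bsup>n+1\<^esup>)\<close>.\<close>

definition mu :: "'f \<Rightarrow> nat \<Rightarrow> int \<Rightarrow> 'k" where "mu w s n = F w s 0 n (int s)"

section \<open>Descent to the base coordinates b, z, y, u, D\<close>

lemma F_add: "F (p + q) k l n e = F p k l n e + F q k l n e"
  and F_diff: "F (p - q) k l n e = F p k l n e - F q k l n e"
  by (simp_all add: F_def distrib_right left_diff_distrib XX_add XX_diff)

lemma mu_add: "mu (p + q) s n = mu p s n + mu q s n"
  and mu_diff: "mu (p - q) s n = mu p s n - mu q s n"
  by (simp_all add: mu_def F_add F_diff)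

text \<open>On the diagonal with no factor \<open>t\<close>, the torus relation has the same factor
  \<open>s + 1\<close> on both sides; cancelling it is the rule for expanding a fraction by
  \<open>sg\<close>.\<close>

lemma mu_sg:
  assumes "w \<in> R5"
  shows "mu (sg * w) (Suc s) n = mu w s n"
proof -
  have "(of_nat (Suc s) :: 'k) * F w s 0 n (int s) = of_nat (Suc s) * F (sg * w) (Suc s) 0 n (int (Suc s))"
    using F_torus[OF assms, of "Suc s" 0 n "int (Suc s)"] by simp
  then have "F w s 0 n (int s) = F (sg * w) (Suc s) 0 n (int (Suc s))"
    by (rule field_cancel_left) (simp del: of_nat_Suc)
  then show ?thesis by (simp only: mu_def)
qed

lemma mu_ka:
  assumes "w \<in> R5"
  shows "mu (ka * w) s n = mu w s (n - 1)"
  using XX_ka[OF monomial_R7[OF assms], of s 0 n "int s"] by (simp add: mu_def F_def mult_ac)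

lemma mu_neg: "n < 0 \<Longrightarrow> mu w s n = 0"
  by (simp add: mu_def F_def XX_def)

text \<open>This says that the functional modelled by \<open>mu\<close> kills the derivative of
  \<open>w / (sg^(s+1) ka^(n+1))\<close>. The test function is \<open>w * a ^ s\<close> at weight
  \<open>s\<close>; \<open>F_B1\<close> and \<open>T_shift\<close> return every term to the
  diagonal, and the terms in \<open>al\<close>, \<open>ep\<close>, \<open>ze\<close> combine through
  the derivative of \<open>ka^2 = al ep - sg ze\<close>.\<close>

lemma mu_ibp:
  assumes w: "w \<in> R5" and j: "j \<in> {7..11}" and n: "0 \<le> n"
  shows "mu (pd j w) s n = of_nat (Suc s) * mu (pd j sg * w) (Suc s) n
    + of_int (n + 1) * mu (pd j ka * w) s (n + 1)"
proof -
  have j': "j \<in> {2..11}" using j by auto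
  let ?d = "pd j"
  have in5: "?d x * w \<in> R5" if "x \<in> R5" for x
    using pd_in_R5[OF j' that] w by (intro ring_gen.mult)
  have in5': "?d sg * w \<in> R5" "?d al * w \<in> R5" "?d ep * w \<in> R5" "?d ze * w \<in> R5" "?d ka * w \<in> R5"
    by (rule in5; simp)+
  \<comment> \<open>\<open>pd j AA\<close> is \<open>a * pd j De\<close> plus a part free of
    \<open>a\<close>. \<open>G\<close> is \<open>w * a ^ s\<close> times the slope and
    \<open>H\<close> is \<open>w * a ^ (s - 1)\<close> times that part, so the derivative in
    \<open>a\<close> below is \<open>(s + 1) G + s H\<close>. At \<open>s = 0\<close> the truncated
    exponent in \<open>H\<close> is harmless because of the factor \<open>s\<close>.\<close>
  define G H where "G = ?d sg * w * a ^ s * t ^ 1 - ?d ep * w * a ^ s * t ^ 0"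
    and "H = ?d ze * w * a ^ (s - 1) * t ^ 0 - ?d al * w * a ^ (s - 1) * t ^ 1"
  have dDe: "?d De * (w * a ^ s) = G"
    unfolding pd_base_poly[OF j] G_def by (simp add: algebra_simps)
  have pd2: "pd 2 (?d AA * (w * a ^ s)) = G + of_nat s * G + of_nat s * H"
  proof -
    have "pd 2 (?d AA) = ?d sg * t - ?d ep"
      unfolding pd_base_poly[OF j] by (simp add: pd_X pd_R5 pd_in_R5[OF j'])
    moreover have "pd 2 (w * a ^ s) = of_nat s * (w * a ^ (s - 1))"
      using w by (simp add: pd_power pd_X pd_R5)
    ultimately have "pd 2 (?d AA * (w * a ^ s)) =
        ?d AA * (of_nat s * (w * a ^ (s - 1))) + (?d sg * t - ?d ep) * (w * a ^ s)"
      by simp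
    also have "\<dots> = G + of_nat s * G + of_nat s * H"
      unfolding pd_base_poly[OF j] G_def H_def by (cases s) (simp_all add: algebra_simps)
    finally show ?thesis .
  qed
  define N where "N = n + 2"
  have "(0::int) \<le> n + 2 * int s" using n by simp
  have "?d (w * a ^ s) = ?d w * a ^ s * t ^ 0"
    using j by (auto simp: pd_power pd_X)
  then have "mu (?d w) s n = XX (?d (w * a ^ s)) n (int s)"
    by (simp only: mu_def F_def)
  also have "\<dots> = XX (G + of_nat s * G + of_nat s * H) N (int s - 1) - of_nat s * XX G N (int s - 1)
      + of_int (n + 2 * int s + 1) * XX (?d ka * (w * a ^ s)) (n + 1) (int s)"
    using XX_base[OF _ j n \<open>0 \<le> n + 2 * int s\<close>, of "w * a ^ s"] monomial_R7[OF w, of s 0]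
    unfolding dDe pd2 N_def by simp
  also have "\<dots> = XX G N (int s - 1) + of_nat s * XX H N (int s - 1)
      + of_int (n + 2 * int s + 1) * mu (?d ka * w) s (n + 1)"
    by (simp add: XX_add XX_of_nat mu_def F_def mult.assoc)
  also have "XX G N (int s - 1) = F (?d sg * w) s 1 N (int s - 1) - F (?d ep * w) s 0 N (int s - 1)"
    by (simp only: G_def XX_diff F_def)
  also have "F (?d ep * w) s 0 N (int s - 1) = of_nat s * mu (al * (?d ep * w)) s N"
    using F_B1[OF in5'(3), of s "int s - 1" 0 N] by (simp add: mu_def)
  also have "F (?d sg * w) s 1 N (int s - 1) = mu (?d sg * w) (Suc s) n
      + of_nat s * mu (ep * (al * (?d sg * w))) (Suc s) N"
    using F_B1[OF in5'(1), of s "int s - 1" 1 N] T_shift[OF al_R5[OF in5'(1)], of s 0 N]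
    by (simp add: mu_def N_def algebra_simps)
  also have "mu (ep * (al * (?d sg * w))) (Suc s) N = mu (?d sg * w) (Suc s) n + mu (ze * (?d sg * w)) s N"
  proof -
    have "ep * (al * (?d sg * w)) = ka * (ka * (?d sg * w)) + sg * (ze * (?d sg * w))"
      using ka_square by algebra
    then show ?thesis using mu_ka[of "ka * (?d sg * w)" "Suc s" N] mu_ka[of "?d sg * w" "Suc s" "N - 1"]
        mu_sg[of "ze * (?d sg * w)" s N] in5'(1) ka_R5[OF in5'(1)] ring_gen.mult[OF base_R5(4) in5'(1)]
      by (simp add: mu_add N_def)
  qed
  also have "of_nat s * XX H N (int s - 1) =
      of_nat s * (mu (sg * (?d ze * w)) s N - mu (ep * (?d al * w)) s N)"
  proof (cases s)
    case (Suc s')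
    have "XX H N (int s - 1) = F (?d ze * w) s' 0 N (int s') - F (?d al * w) s' 1 N (int s')"
      by (simp add: H_def XX_diff F_def Suc)
    moreover have "F (?d ze * w) s' 0 N (int s') = mu (sg * (?d ze * w)) s N"
      unfolding Suc mu_sg[OF in5'(4)] by (simp add: mu_def)
    moreover have "F (?d al * w) s' 1 N (int s') = mu (ep * (?d al * w)) s N"
      using T_shift[OF in5'(2), of s' 0 N] by (simp add: Suc mu_def)
    ultimately show ?thesis by simp
  qed simp
  finally have eq: "mu (?d w) s n = (of_nat s + 1) * mu (?d sg * w) (Suc s) n
     + of_nat s * (mu (ze * (?d sg * w)) s N - mu (al * (?d ep * w)) s N
        + mu (sg * (?d ze * w)) s N - mu (ep * (?d al * w)) s N)
     + of_int (n + 2 * int s + 1) * mu (?d ka * w) s (n + 1)"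
    by (simp add: algebra_simps)
  have lin: "ze * (?d sg * w) - al * (?d ep * w) + sg * (?d ze * w) - ep * (?d al * w) =
      0 - (ka * (?d ka * w) + ka * (?d ka * w))"
  proof -
    have "?d (ka\<^sup>2) = ?d (al * ep - sg * ze)" by (simp only: ka_square)
    then have "2 * ka * ?d ka = al * ?d ep + ?d al * ep - (sg * ?d ze + ?d sg * ze)" using j' by simp
    then show ?thesis by algebra
  qed
  have "mu (ze * (?d sg * w)) s N - mu (al * (?d ep * w)) s N
        + mu (sg * (?d ze * w)) s N - mu (ep * (?d al * w)) s N = - 2 * mu (ka * (?d ka * w)) s N"
  proof -
    have "mu 0 s N = 0" using mu_add[of 0 0 s N] by simp
    then show ?thesis using arg_cong[OF lin, of "\<lambda>x. mu x s N"] by (simp only: mu_add mu_diff) simp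
  qed
  also have "mu (ka * (?d ka * w)) s N = mu (?d ka * w) s (n + 1)"
    using mu_ka[OF in5'(5), of s N] by (simp add: N_def add.commute)
  finally have br: "mu (ze * (?d sg * w)) s N - mu (al * (?d ep * w)) s N
        + mu (sg * (?d ze * w)) s N - mu (ep * (?d al * w)) s N = - 2 * mu (?d ka * w) s (n + 1)" .
  show ?thesis unfolding eq br by (simp add: algebra_simps)
qed

text \<open>At these indices all normalising factors equal 1, so \<open>mu k 0 0\<close> is
  \<open>lam (k / f^2)\<close> itself.\<close>

lemma mu_eta: "k \<in> ring_gen C \<Longrightarrow> mu k 0 0 = 0"
  using lam_eta[of k] by (simp add: mu_def F_def XX_def XN_def E_def M_def numeral_2_eq_2)

end

section \<open>Functionals on the localised base ring\<close>

definition (in zz5_coordinates) "S2 = S5 \<union> {1 / sg, 1 / u, 1 / k0}"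

text \<open>\<open>Phi\<close> will be defined through fractions, so its additivity is only claimed
  on the localised ring; this is the source of the membership conditions below.\<close>

locale zz5_base_functional = zz5_coordinates pd X C
  for pd :: "nat \<Rightarrow> 'f::field \<Rightarrow> 'f" and X :: "nat \<Rightarrow> 'f" and C :: "'f set" +
  fixes Phi :: "'f \<Rightarrow> 'k::field_char_0"
  assumes Phi_add: "p \<in> ring_gen S2 \<Longrightarrow>
      q \<in> ring_gen S2 \<Longrightarrow> Phi (p + q) = Phi p + Phi q"
    and Phi_pd: "i \<in> {7..11} \<Longrightarrow> g \<in> ring_gen S2 \<Longrightarrow> Phi (pd i g) = 0"
    and Phi_eta: "k \<in> ring_gen C \<Longrightarrow> Phi (k / (sg * u * k0)) = 0"
begin

abbreviation "L2 \<equiv> ring_gen S2"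
definition "S4 = insert (1 / sg) (insert b (insert D (insert y C)))"
abbreviation "L4 \<equiv> ring_gen S4"
definition "S3 = insert (1 / u) (insert u S4)"
abbreviation "L3 \<equiv> ring_gen S3"

lemma S2_eq: "S2 = insert z (insert (1 / k0) S3)"
  by (auto simp: S2_def S5_def S3_def S4_def)

lemma L4_L3: "w \<in> L4 \<Longrightarrow> w \<in> L3"
  by (rule ring_gen_subset) (auto simp: S3_def intro: ring_gen.gen)

lemma L3_L2: "w \<in> L3 \<Longrightarrow> w \<in> L2"
  by (rule ring_gen_subset) (auto simp: S2_eq intro: ring_gen.gen)

lemma ring_gen_C_L4: "w \<in> ring_gen C \<Longrightarrow> w \<in> L4"
  by (rule ring_gen_subset) (auto simp: S4_def intro: ring_gen.gen)

lemma gens_L4 [simp]: "1 / sg \<in> L4" "b \<in> L4" "D \<in> L4" "y \<in> L4"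
  by (auto simp: S4_def intro!: ring_gen.gen)

lemma gens_L3 [simp]: "1 / u \<in> L3" "u \<in> L3" "1 / sg \<in> L3" "b \<in> L3" "D \<in> L3" "y \<in> L3"
  by (auto simp: S3_def S4_def intro!: ring_gen.gen)

lemma gens_L2 [simp]: "z \<in> L2" "1 / k0 \<in> L2"
  by (auto simp: S2_eq intro!: ring_gen.gen)

lemma divide_sg_L4: "w \<in> L4 \<Longrightarrow> w / sg \<in> L4"
  using ring_gen.mult[of w S4 "1 / sg"] by simp

lemma divide_sg_L3: "w \<in> L3 \<Longrightarrow> w / sg \<in> L3"
  using ring_gen.mult[of w S3 "1 / sg"] by simp

lemma u_powi_L3 [simp]: "u powi m \<in> L3"
proof (cases "0 \<le> m")
  case True
  then show ?thesis by (simp add: power_int_def ring_gen_power)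
next
  case False
  then have "u powi m = (1 / u) ^ nat (- m)" by (simp add: power_int_def power_inverse divide_inverse)
  then show ?thesis by (simp add: ring_gen_power)
qed

section \<open>Integration by parts with explicit powers of z and k0\<close>

text \<open>With \<open>y\<close> invertible, the residue of \<open>z^k / k0^j\<close> along
  \<open>k0 = 0\<close> in the variable \<open>z\<close> would be \<open>1 / y^(k+1)\<close> for
  \<open>j = k + 1\<close> and 0 for \<open>j > k + 1\<close>. As \<open>y\<close> is not inverted,
  both exponents stay as indices, and the diagonal \<open>j = k + 1\<close> carries the
  information.\<close>

definition nu :: "'f \<Rightarrow> nat \<Rightarrow> nat \<Rightarrow> 'k" where "nu w j k = Phi (w * z ^ k / k0 ^ j)"

lemma nu_arg_L2: "w \<in> L2 \<Longrightarrow> w * z ^ k / k0 ^ j \<in> L2"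
  using ring_gen.mult[of "w * z ^ k" S2 "(1 / k0) ^ j"] ring_gen_power[OF gens_L2(2), of j]
  by (simp add: ring_gen.mult ring_gen_power power_one_over)

lemma nu_add: "w \<in> L3 \<Longrightarrow> w' \<in> L3 \<Longrightarrow> nu (w + w') j k = nu w j k + nu w' j k"
  unfolding nu_def distrib_right add_divide_distrib by (intro Phi_add nu_arg_L2 L3_L2)

lemma nu_zero [simp]: "nu 0 j k = 0"
  using nu_add[of 0 0 j k] by simp

lemma nu_minus: "w \<in> L3 \<Longrightarrow> nu (- w) j k = - nu w j k"
  using nu_add[of w "- w" j k] by (simp add: ring_gen.minus eq_neg_iff_add_eq_0 add.commute)

lemma nu_diff: "w \<in> L3 \<Longrightarrow> w' \<in> L3 \<Longrightarrow> nu (w - w') j k = nu w j k - nu w' j k"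
  using nu_add[of w "- w'" j k] by (simp add: ring_gen.minus nu_minus)

lemma nu_of_nat: "w \<in> L3 \<Longrightarrow> nu (of_nat m * w) j k = of_nat m * nu w j k"
  by (induction m) (simp_all add: nu_add distrib_right ring_gen.mult)

lemma nu_of_int: "w \<in> L3 \<Longrightarrow> nu (of_int m * w) j k = of_int m * nu w j k"
  by (cases m rule: int_cases2) (simp_all add: nu_of_nat nu_minus ring_gen.mult)

lemma Phi_of_nat: "g \<in> L2 \<Longrightarrow> Phi (of_nat m * g) = of_nat m * Phi g"
proof (induction m)
  case 0
  then show ?case using Phi_add[of 0 0] by simp
qed (simp add: Phi_add distrib_right ring_gen.mult)

lemma Phi_diff: "p \<in> L2 \<Longrightarrow> q \<in> L2 \<Longrightarrow> Phi (p - q) = Phi p - Phi q"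
  using Phi_add[of "p - q" q] by (simp add: ring_gen_diff)

lemma pd_recip: "i \<in> {2..11} \<Longrightarrow> g \<noteq> 0 \<Longrightarrow> pd i (1 / g) = - (pd i g * (1 / g) * (1 / g))"
  using pd_divide_power[of i g 1 1] by simp

lemma pd_L3: "i \<in> {7..11} \<Longrightarrow> w \<in> L3 \<Longrightarrow> pd i w \<in> L3"
proof -
  assume i: "i \<in> {7..11}" and w: "w \<in> L3"
  then have i': "i \<in> {2..11}" by auto
  have sg: "pd i sg \<in> L3"
    unfolding sg_def using i' by (auto intro!: ring_gen_closed simp: pd_X)
  show ?thesis
  proof (rule derivation_maps_ring_gen[OF derivation_pd[OF i'] _ w])
    fix x assume "x \<in> S3"
    then consider "x = 1 / sg" | "x = 1 / u" | "x \<in> C" | "x \<in> {X 7, X 11, X 9, X 10}"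
      by (auto simp: S3_def S4_def)
    then show "pd i x \<in> L3"
    proof cases
      case 1
      show ?thesis
        unfolding 1 pd_recip[OF i' sg_nonzero] using sg by (intro ring_gen_closed) simp_all
    next
      case 2
      show ?thesis
        unfolding 2 pd_recip[OF i' X_nonzero[of 10, simplified]] using i'
        by (intro ring_gen_closed) (auto simp: pd_X)
    next
      case 3
      then show ?thesis using pd_C[OF i'] by simp
    next
      case 4
      then show ?thesis using i' by (auto simp: pd_X)
    qed
  qed
qed

lemma pd_z_L3: "w \<in> L3 \<Longrightarrow> pd 8 w = 0"
proof (rule derivation_vanishes_on_ring_gen[OF derivation_pd])
  fix x assume "x \<in> S3"
  then consider "x = 1 / sg" | "x = 1 / u" | "x \<in> C" | "x \<in> {X 7, X 11, X 9, X 10}"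
    by (auto simp: S3_def S4_def)
  then show "pd 8 x = 0"
  proof cases
    case 1
    then show ?thesis using pd_recip[OF _ sg_nonzero, of 8] by (simp add: sg_def pd_X)
  next
    case 2
    then show ?thesis using pd_recip[of 8 u] X_nonzero[of 10] by (simp add: pd_X)
  qed (auto simp: pd_X pd_C)
qed auto

lemma pd_u_L4: "w \<in> L4 \<Longrightarrow> pd 10 w = 0"
proof (rule derivation_vanishes_on_ring_gen[OF derivation_pd])
  fix x assume "x \<in> S4"
  then consider "x = 1 / sg" | "x \<in> C" | "x \<in> {X 7, X 11, X 9}"
    by (auto simp: S4_def)
  then show "pd 10 x = 0"
  proof cases
    case 1
    then show ?thesis using pd_recip[OF _ sg_nonzero, of 10] by (simp add: sg_def pd_X)
  qed (auto simp: pd_X pd_C)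
qed auto

lemma nu_ibp:
  assumes w: "w \<in> L3" and i: "i \<in> {7, 9, 10, 11}"
  shows "nu (pd i w) j k = of_nat j * Phi (w * pd i k0 * z ^ k / k0 ^ Suc j)"
proof -
  have i': "i \<in> {2..11}" "i \<in> {7..11}" using i by auto
  have "pd i (w * z ^ k) = pd i w * z ^ k" using i i' by (auto simp: pd_power pd_X)
  then have "pd i (w * z ^ k / k0 ^ j) =
      pd i w * z ^ k / k0 ^ j - of_nat j * (w * pd i k0 * z ^ k / k0 ^ Suc j)"
    using pd_divide_power[OF i'(1) k0_nonzero, of "w * z ^ k" j] by (simp add: mult_ac)
  moreover have "pd i k0 \<in> L2"
  proof -
    have "pd i k0 \<in> R5" using pd_in_R5[OF i'(1)] by simp
    then show ?thesis by (rule ring_gen_subset[rotated]) (auto simp: S2_def intro: ring_gen.gen)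
  qed
  then have "w * pd i k0 * z ^ k / k0 ^ Suc j \<in> L2"
    using L3_L2[OF w] by (intro nu_arg_L2 ring_gen.mult)
  moreover have "pd i w * z ^ k / k0 ^ j \<in> L2"
    using pd_L3[OF i'(2) w] by (intro nu_arg_L2 L3_L2)
  moreover have "Phi (pd i (w * z ^ k / k0 ^ j)) = 0"
    using w i' by (intro Phi_pd nu_arg_L2 L3_L2)
  ultimately show ?thesis
    by (simp only: nu_def Phi_diff Phi_of_nat ring_gen.mult ring_gen_of_nat right_minus_eq)
qed

lemma nu_u:
  assumes w: "w \<in> L3"
  shows "nu (pd 10 w) j k = - (of_nat j * nu (b * w) (Suc j) k)"
proof -
  have "pd 10 k0 = - b" by (simp add: k0_def pd_X)
  then have "Phi (w * pd 10 k0 * z ^ k / k0 ^ Suc j) = nu (- (b * w)) (Suc j) k"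
    by (simp add: nu_def mult_ac)
  then show ?thesis using nu_ibp[OF w, of 10 j k] w by (simp add: nu_minus ring_gen.mult)
qed

lemma nu_D:
  assumes w: "w \<in> L3"
  shows "nu (pd 11 w) j k = of_nat j * nu (b * w) (Suc j) k"
proof -
  have "pd 11 k0 = b" by (simp add: k0_def pd_X)
  then have "Phi (w * pd 11 k0 * z ^ k / k0 ^ Suc j) = nu (b * w) (Suc j) k"
    by (simp add: nu_def mult_ac)
  then show ?thesis using nu_ibp[OF w, of 11 j k] by simp
qed

lemma nu_b:
  assumes w: "w \<in> L3"
  shows "nu (pd 7 w) j k = of_nat j * nu ((D - y - u) * w) (Suc j) k"
proof -
  have "pd 7 k0 = D - y - u" by (simp add: k0_def pd_X)
  then have "Phi (w * pd 7 k0 * z ^ k / k0 ^ Suc j) = nu ((D - y - u) * w) (Suc j) k"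
    by (simp only: nu_def mult.commute)
  then show ?thesis using nu_ibp[OF w, of 7 j k] by simp
qed

lemma nu_y:
  assumes w: "w \<in> L3"
  shows "nu (pd 9 w) j k = of_nat j * (nu w (Suc j) (Suc k) - nu (b * w) (Suc j) k)"
proof -
  have "pd 9 k0 = z - b" by (simp add: k0_def pd_X)
  then have "w * pd 9 k0 * z ^ k / k0 ^ Suc j =
      w * z ^ Suc k / k0 ^ Suc j - (b * w) * z ^ k / k0 ^ Suc j"
    by (simp only: diff_divide_distrib[symmetric]) (simp add: algebra_simps)
  moreover have "w * z ^ Suc k / k0 ^ Suc j \<in> L2" "(b * w) * z ^ k / k0 ^ Suc j \<in> L2"
    using w by (intro nu_arg_L2 L3_L2 ring_gen.mult gens_L3; simp)+
  ultimately have "Phi (w * pd 9 k0 * z ^ k / k0 ^ Suc j) = nu w (Suc j) (Suc k) - nu (b * w) (Suc j) k"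
    by (simp only: nu_def Phi_diff)
  then show ?thesis using nu_ibp[OF w, of 9 j k] by simp
qed

lemma nu_z:
  assumes w: "w \<in> L3"
  shows "of_nat k * nu w j (k - 1) = of_nat j * nu (y * w) (Suc j) k"
proof -
  have "pd 8 (w * z ^ k) = of_nat k * (w * z ^ (k - 1))"
    using pd_z_L3[OF w] by (simp add: pd_power pd_X)
  moreover have "pd 8 k0 = y" by (simp add: k0_def pd_X)
  ultimately have "pd 8 (w * z ^ k / k0 ^ j) =
      of_nat k * (w * z ^ (k - 1) / k0 ^ j) - of_nat j * (y * w * z ^ k / k0 ^ Suc j)"
    using pd_divide_power[of 8 k0 "w * z ^ k" j] k0_nonzero by (simp add: mult_ac)
  moreover have "Phi (pd 8 (w * z ^ k / k0 ^ j)) = 0"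
    using w by (intro Phi_pd nu_arg_L2 L3_L2) simp_all
  moreover have "w * z ^ (k - 1) / k0 ^ j \<in> L2" "y * w * z ^ k / k0 ^ Suc j \<in> L2"
    using w by (intro nu_arg_L2 L3_L2 ring_gen.mult gens_L3; simp)+
  ultimately show ?thesis
    by (simp only: nu_def Phi_diff Phi_of_nat ring_gen.mult ring_gen_of_nat right_minus_eq)
qed

lemma nu_z_0: "w \<in> L3 \<Longrightarrow> nu (y * w) (Suc (Suc j)) 0 = 0"
  using nu_z[of w 0 "Suc j"] of_nat_neq_0[of j, where 'a='k] by (simp del: of_nat_Suc)

text \<open>\<open>k0 = b (D - y - u) + y z\<close> trades a factor \<open>y z\<close> for one of \<open>b (D - y - u)\<close>.\<close>

lemma nu_p:
  assumes w: "w \<in> L3"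
  shows "of_nat j * nu (b * ((D - y - u) * w)) (Suc j) k = (of_nat j - of_nat k - 1) * nu w j k"
proof -
  have in3: "(D - y - u) * w \<in> L3" "b * ((D - y - u) * w) \<in> L3" "y * w \<in> L3"
    using w by (auto intro!: ring_gen_closed)
  have "w * z ^ k / k0 ^ j = k0 * w * z ^ k / k0 ^ Suc j" using k0_nonzero by simp
  also have "k0 * w * z ^ k = b * ((D - y - u) * w) * z ^ k + y * w * z ^ Suc k"
    by (simp add: k0_def algebra_simps)
  finally have "nu w j k = nu (b * ((D - y - u) * w)) (Suc j) k + nu (y * w) (Suc j) (Suc k)"
    unfolding nu_def add_divide_distrib using in3
    by (simp only:) (intro Phi_add nu_arg_L2 L3_L2)
  moreover have "of_nat (Suc k) * nu w j k = of_nat j * nu (y * w) (Suc j) (Suc k)"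
    using nu_z[OF w, of "Suc k" j] by simp
  ultimately show ?thesis by (simp add: algebra_simps)
qed

end

text \<open>\<open>c i j l s\<close> is the value at \<open>b^i y^j D^l / sg^s\<close> of a
  functional killing derivatives; \<open>rel\<close> is the definition of \<open>sg\<close>. Two
  weights force \<open>i = l\<close> and \<open>i + l + j + 3 = 2 s\<close>, so \<open>j\<close> is
  odd, and \<open>y\<close> lowers \<open>j\<close> by two until its left side is 0. Behind this is
  the vanishing of the degree 3 cohomology of the complement of the cone \<open>b D = y^2\<close> in
  affine 3-space.\<close>

lemma torus_recursion_vanish:
  fixes c :: "nat \<Rightarrow> nat \<Rightarrow> nat \<Rightarrow> nat \<Rightarrow> 'k::field_char_0"
  assumes D: "\<And>i j l s. of_nat (Suc l) * c i j l s = of_nat s * c (Suc i) j (Suc l) (Suc s)"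
    and b: "\<And>i j l s. of_nat (Suc i) * c i j l s = of_nat s * c (Suc i) j (Suc l) (Suc s)"
    and y: "\<And>i j l s. of_nat j * c i (j - 1) l s = - (2 * of_nat s * c i (Suc j) l (Suc s))"
    and rel: "\<And>i j l s. c i j l s = c (Suc i) j (Suc l) (Suc s) - c i (Suc (Suc j)) l (Suc s)"
  shows "c i j l s = 0"
proof -
  have diag: "c i j l s = 0" if "i \<noteq> l" for i j l s
  proof -
    have "(of_nat (Suc l) - of_nat (Suc i)) * c i j l s = 0"
      using D[of l i j s] b[of i j l s] by (simp only: left_diff_distrib diff_self)
    moreover have "of_nat (Suc l) - of_nat (Suc i) \<noteq> (0 :: 'k)" using that by simp
    ultimately show ?thesis by simp
  qed
  have weight: "c i j l s = 0" if "i + l + j + 3 \<noteq> 2 * s" for i j l s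
  proof -
    have "of_nat (Suc l) * c i j l s + of_nat (Suc i) * c i j l s + of_nat (Suc j) * c i j l s =
        2 * of_nat s * (c (Suc i) j (Suc l) (Suc s) - c i (Suc (Suc j)) l (Suc s))"
      using D[of l i j s] b[of i j l s] y[of "Suc j" i l s] by (simp add: algebra_simps)
    also have "\<dots> = 2 * of_nat s * c i j l s" using rel[of i j l s] by simp
    finally have "(of_nat (i + l + j + 3) - of_nat (2 * s)) * c i j l s = 0"
      by (simp add: algebra_simps)
    moreover have "of_nat (i + l + j + 3) - of_nat (2 * s) \<noteq> (0 :: 'k)"
      using that by (simp only: right_minus_eq of_nat_eq_iff) simp
    ultimately show ?thesis by simp
  qed
  show ?thesis
  proof (induction j arbitrary: i l s rule: less_induct)
    case (less j)
    show ?case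
    proof (cases "i = l \<and> i + l + j + 3 = 2 * s")
      case True
      then have "odd j" by presburger
      then obtain h where h: "j = Suc h" by (cases j) auto
      have "2 \<le> s" using True by simp
      then have s': "s = Suc (Suc (s - 2))" by simp
      define s' where "s' = s - 2"
      have s': "s = Suc (Suc s')" using s' by (simp only: s'_def)
      have "of_nat h * c i (h - 1) l (Suc s') = 0"
        using less[of "h - 1" i l "Suc s'"] h by (cases h) simp_all
      then have "2 * of_nat (Suc s') * c i j l s = 0"
        using y[of h i l "Suc s'"] by (simp only: h s') simp
      then show ?thesis by (simp only: mult_eq_0_iff of_nat_eq_0_iff) simp
    next
      case False
      then show ?thesis using diag weight by blast
    qed
  qed
qed

section \<open>Residues in u and vanishing on and off the diagonal\<close>

context zz5_base_functional
begin

lemma pd_u_powi: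
  assumes i: "i \<in> {2..11}"
  shows "pd i (u powi m) = of_int m * u powi (m - 1) * pd i u"
proof (cases "0 \<le> m")
  case True
  then obtain n where m: "m = int n" by (metis nonneg_int_cases)
  show ?thesis
  proof (cases n)
    case (Suc n')
    have "m - 1 = int n'" using m Suc by simp
    then have "u powi m = u ^ n" "u powi (m - 1) = u ^ (n - 1)" using Suc by (simp_all only: m power_int_of_nat diff_Suc_1)
    then show ?thesis using pd_power[OF i, of u n] by (simp only: m of_int_of_nat_eq)
  qed (use i m in simp)
next
  case False
  define n where "n = nat (- m - 1)"
  have m: "m = - int (Suc n)" using False by (simp add: n_def)
  have u: "u \<noteq> 0" using X_nonzero[of 10] by simp
  have "u powi m = 1 / u ^ Suc n"
    by (simp only: m power_int_minus power_int_of_nat inverse_eq_divide)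
  moreover have "u powi (m - 1) = 1 / u ^ Suc (Suc n)"
  proof -
    have "m - 1 = - int (Suc (Suc n))" by (simp add: m)
    then show ?thesis by (simp only: power_int_minus power_int_of_nat inverse_eq_divide)
  qed
  moreover have "of_int m = - (of_nat (Suc n) :: 'f)" by (simp add: m)
  ultimately show ?thesis
    using pd_divide_power[OF i u, of 1 "Suc n"] i by (simp only:) (simp del: of_nat_Suc power_Suc)
qed

definition mon :: "'f \<Rightarrow> nat \<Rightarrow> nat \<Rightarrow> nat \<Rightarrow> nat \<Rightarrow> int \<Rightarrow> 'f" where
  "mon \<kappa> i j l s m = \<kappa> * b ^ i * y ^ j * D ^ l * u powi m / sg ^ s"

lemma mon_L3 [simp]: "\<kappa> \<in> ring_gen C \<Longrightarrow> mon \<kappa> i j l s m \<in> L3"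
proof -
  assume "\<kappa> \<in> ring_gen C"
  then have "\<kappa> \<in> L3" using ring_gen_C_L4 L4_L3 by simp
  moreover have "mon \<kappa> i j l s m = \<kappa> * b ^ i * y ^ j * D ^ l * u powi m * (1 / sg) ^ s"
    by (simp add: mon_def power_one_over)
  ultimately show ?thesis by (simp only:) (intro ring_gen.mult ring_gen_power; simp)
qed

lemma pd_ring_gen_C: "i \<in> {2..11} \<Longrightarrow> \<kappa> \<in> ring_gen C \<Longrightarrow> pd i \<kappa> = 0"
  by (rule derivation_vanishes_on_ring_gen[OF derivation_pd]) (auto simp: pd_C)

lemma mon_sg: "mon \<kappa> i j l s m = mon \<kappa> (Suc i) j (Suc l) (Suc s) m - mon \<kappa> i (Suc (Suc j)) l (Suc s) m"
proof -
  have "mon \<kappa> i j l s m = sg * (\<kappa> * b ^ i * y ^ j * D ^ l * u powi m) / sg ^ Suc s"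
    using sg_nonzero by (simp add: mon_def)
  also have "sg * (\<kappa> * b ^ i * y ^ j * D ^ l * u powi m) =
      \<kappa> * b ^ Suc i * y ^ j * D ^ Suc l * u powi m - \<kappa> * b ^ i * y ^ Suc (Suc j) * D ^ l * u powi m"
    by (simp add: sg_def algebra_simps power2_eq_square)
  finally show ?thesis by (simp only: mon_def diff_divide_distrib)
qed

lemma mon_y: "y * mon \<kappa> i j l s m = mon \<kappa> i (Suc j) l s m"
  by (simp add: mon_def mult_ac)

lemma pd_mon:
  assumes \<kappa>: "\<kappa> \<in> ring_gen C"
  shows "pd 11 (mon \<kappa> i j l s m) = of_nat l * mon \<kappa> i j (l - 1) s m - of_nat s * mon \<kappa> (Suc i) j l (Suc s) m"
    "pd 7 (mon \<kappa> i j l s m) = of_nat i * mon \<kappa> (i - 1) j l s m - of_nat s * mon \<kappa> i j (Suc l) (Suc s) m"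
    "pd 9 (mon \<kappa> i j l s m) = of_nat j * mon \<kappa> i (j - 1) l s m + of_nat (2 * s) * mon \<kappa> i (Suc j) l (Suc s) m"
proof -
  let ?q = "\<kappa> * b ^ i * y ^ j * D ^ l * u powi m"
  have k: "pd 11 \<kappa> = 0" "pd 7 \<kappa> = 0" "pd 9 \<kappa> = 0" using pd_ring_gen_C[OF _ \<kappa>] by simp_all
  have up: "pd 11 (u powi m) = 0" "pd 7 (u powi m) = 0" "pd 9 (u powi m) = 0"
    by (simp_all add: pd_u_powi pd_X)
  have sgd: "pd 11 sg = b" "pd 7 sg = D" "pd 9 sg = - 2 * y" by (simp_all add: sg_def pd_X)
  have q: "pd 11 ?q = of_nat l * (\<kappa> * b ^ i * y ^ j * D ^ (l - 1) * u powi m)"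
    "pd 7 ?q = of_nat i * (\<kappa> * b ^ (i - 1) * y ^ j * D ^ l * u powi m)"
    "pd 9 ?q = of_nat j * (\<kappa> * b ^ i * y ^ (j - 1) * D ^ l * u powi m)"
    by (simp_all add: k up pd_power pd_X mult_ac)
  show "pd 11 (mon \<kappa> i j l s m) = of_nat l * mon \<kappa> i j (l - 1) s m - of_nat s * mon \<kappa> (Suc i) j l (Suc s) m"
    unfolding mon_def
    using pd_divide_power[of 11 sg ?q s] sg_nonzero
    by (simp only: q sgd) (simp add: mult_ac)
  show "pd 7 (mon \<kappa> i j l s m) = of_nat i * mon \<kappa> (i - 1) j l s m - of_nat s * mon \<kappa> i j (Suc l) (Suc s) m"
    unfolding mon_def
    using pd_divide_power[of 7 sg ?q s] sg_nonzero
    by (simp only: q sgd) (simp add: mult_ac)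
  show "pd 9 (mon \<kappa> i j l s m) = of_nat j * mon \<kappa> i (j - 1) l s m + of_nat (2 * s) * mon \<kappa> i (Suc j) l (Suc s) m"
    unfolding mon_def
    using pd_divide_power[of 9 sg ?q s] sg_nonzero
    by (simp only: q sgd) (simp add: mult_ac)
qed

lemma L3_monomial_u_induct [consumes 1, case_names monom add]:
  assumes w: "w \<in> L3"
    and mon: "\<And>w m. w \<in> L4 \<Longrightarrow> Q (u powi m * w)"
    and add: "\<And>p q. p \<in> L3 \<Longrightarrow> q \<in> L3 \<Longrightarrow> Q p \<Longrightarrow> Q q \<Longrightarrow> Q (p + q)"
  shows "Q w"
proof -
  have u: "u \<noteq> 0" using X_nonzero[of 10] by simp
  have "w \<in> L3 \<and> Q w" using w unfolding S3_def
  proof (induction rule: ring_gen_adjoin_induct)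
    case (monom w k)
    then show ?case
    proof (induction rule: ring_gen_adjoin_induct)
      case (monom w n)
      have "u powi (int n - int k) = u ^ n / u ^ k" using u by (simp add: power_int_diff)
      then have "w * u ^ n * (1 / u) ^ k = u powi (int n - int k) * w" by (simp add: power_one_over)
      then show ?case using mon[OF monom, of "int n - int k"] L4_L3[OF monom]
        by (simp only:) (simp add: ring_gen.mult S3_def[symmetric])
    qed (simp add: distrib_right add S3_def[symmetric] ring_gen.add)
  qed (simp add: add S3_def[symmetric] ring_gen.add)
  then show ?thesis by simp
qed

lemma L4_monomial_induct [consumes 1, case_names monom add]:
  assumes w: "w \<in> L4"
    and mon: "\<And>\<kappa> i j l s. \<kappa> \<in> ring_gen C \<Longrightarrow> Q (mon \<kappa> i j l s 0)"
    and add: "\<And>p q. p \<in> L4 \<Longrightarrow> q \<in> L4 \<Longrightarrow> Q p \<Longrightarrow> Q q \<Longrightarrow> Q (p + q)"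
  shows "Q w"
proof -
  have "w \<in> L4 \<and> Q w" using w unfolding S4_def
  proof (induction rule: ring_gen_adjoin_induct)
    case (monom w s)
    then show ?case
    proof (induction rule: ring_gen_adjoin_induct)
      case (monom w i)
      then show ?case
      proof (induction rule: ring_gen_adjoin_induct)
        case (monom w l)
        then show ?case
        proof (induction rule: ring_gen_adjoin_induct)
          case (monom w j)
          have eq: "w * y ^ j * D ^ l * b ^ i * (1 / sg) ^ s = mon w i j l s 0"
            by (simp add: mon_def power_one_over mult_ac)
          have "w * y ^ j * D ^ l * b ^ i * (1 / sg) ^ s \<in> L4"
            using ring_gen_C_L4[OF monom] by (intro ring_gen.mult ring_gen_power; simp)
          then show ?case using mon[OF monom, of i j l s] unfolding eq by (simp add: S4_def[symmetric])
        qed (simp add: distrib_right add S4_def[symmetric] ring_gen.add)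
      qed (simp add: distrib_right add S4_def[symmetric] ring_gen.add)
    qed (simp add: distrib_right add S4_def[symmetric] ring_gen.add)
  qed (simp add: add S4_def[symmetric] ring_gen.add)
  then show ?thesis by simp
qed

lemma L3_monomial_induct [consumes 1, case_names monom add]:
  assumes w: "w \<in> L3"
    and mon: "\<And>\<kappa> i j l s m. \<kappa> \<in> ring_gen C \<Longrightarrow> Q (mon \<kappa> i j l s m)"
    and add: "\<And>p q. p \<in> L3 \<Longrightarrow> q \<in> L3 \<Longrightarrow> Q p \<Longrightarrow> Q q \<Longrightarrow> Q (p + q)"
  shows "Q w"
  using w
proof (induction rule: L3_monomial_u_induct)
  case (monom w m)
  then show ?case
  proof (induction rule: L4_monomial_induct)
    case (monom \<kappa> i j l s)
    have "u powi m * mon \<kappa> i j l s 0 = mon \<kappa> i j l s m" by (simp add: mon_def mult_ac)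
    then show ?case using mon[OF monom] by simp
  next
    case (add p q)
    then show ?case using assms(3)[of "u powi m * p" "u powi m * q"] L4_L3
      by (simp add: distrib_left ring_gen.mult)
  qed
qed (rule add)

text \<open>The factor \<open>y\<close> cancels the derivative of \<open>k0\<close> in
  \<open>z\<close>, so this value acts as the residue of \<open>w\<close> along
  \<open>k0 = 0\<close>. It kills derivatives in \<open>b, D, y\<close>: the double poles that arise
  in \<open>D\<close> and \<open>b\<close> carry a factor \<open>y\<close> and no \<open>z\<close>,
  hence vanish by \<open>nu_z_0\<close>. The powers of \<open>u\<close> are passive, and the cone
  recursion applies.\<close>

lemma psi_vanish: "w \<in> L3 \<Longrightarrow> nu (y * w) 1 0 = 0"
proof (induction rule: L3_monomial_induct)
  case (monom \<kappa> i j l s m)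
  define psi where "psi w = nu (y * w) 1 0" for w
  have psi_diff: "psi (p - q) = psi p - psi q" and psi_add: "psi (p + q) = psi p + psi q"
    if "p \<in> L3" "q \<in> L3" for p q
    using that by (simp_all add: psi_def right_diff_distrib distrib_left nu_diff nu_add ring_gen.mult)
  have psi_of_nat: "psi (of_nat n * p) = of_nat n * psi p" if "p \<in> L3" for n p
    using nu_of_nat[of "y * p" n 1 0] that by (simp add: psi_def ring_gen.mult mult.left_commute)
  have kill: "nu (q * (y * w)) 2 0 = 0" if "q \<in> L3" "w \<in> L3" for q w
  proof -
    have eq: "q * (y * w) = y * (q * w)" by (simp add: mult_ac)
    show ?thesis unfolding eq using nu_z_0[of "q * w" 0] that by (simp add: ring_gen.mult numeral_2_eq_2)
  qed
  have p: "D - y - u \<in> L3" by (intro ring_gen_diff gens_L3)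
  have D: "psi (pd 11 w) = 0" and b: "psi (pd 7 w) = 0" and y: "psi (pd 9 w) = 0" if w: "w \<in> L3" for w
  proof -
    have yw: "y * w \<in> L3" using w by (simp add: ring_gen.mult)
    have "pd 11 (y * w) = y * pd 11 w" "pd 7 (y * w) = y * pd 7 w" "pd 9 (y * w) = y * pd 9 w + w"
      by (simp_all add: pd_X)
    note e = this
    show "psi (pd 11 w) = 0" using nu_D[OF yw, of 1 0] kill[OF gens_L3(4) w]
      by (simp only: e psi_def) (simp add: numeral_2_eq_2)
    show "psi (pd 7 w) = 0" using nu_b[OF yw, of 1 0] kill[OF p w]
      by (simp only: e psi_def) (simp add: numeral_2_eq_2)
    have "y * pd 9 w \<in> L3" using pd_L3[OF _ w, of 9] by (simp add: ring_gen.mult)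
    \<comment> \<open>The product rule for \<open>y * w\<close> leaves an extra \<open>w\<close>;
      this identity cancels it against the term in which \<open>z\<close> appears through the
      derivative of \<open>k0\<close> in \<open>y\<close>.\<close>
    moreover have "nu w 1 0 = nu (y * w) 2 1" using nu_z[OF w, of 1 1] by (simp add: numeral_2_eq_2)
    ultimately show "psi (pd 9 w) = 0" using nu_y[OF yw, of 1 0] kill[OF gens_L3(4) w] w
      by (simp only: e psi_def nu_add) (simp add: numeral_2_eq_2)
  qed
  note \<kappa> = monom
  have "psi (mon \<kappa> i j l s m) = 0"
  proof (rule torus_recursion_vanish)
    fix i j l s
    show "of_nat (Suc l) * psi (mon \<kappa> i j l s m) = of_nat s * psi (mon \<kappa> (Suc i) j (Suc l) (Suc s) m)"
      using D[OF mon_L3[OF \<kappa>], of i j "Suc l" s m] \<kappa>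
      by (simp only: pd_mon(1)[OF \<kappa>] psi_diff psi_of_nat mon_L3 ring_gen.mult ring_gen_of_nat) simp
    show "of_nat (Suc i) * psi (mon \<kappa> i j l s m) = of_nat s * psi (mon \<kappa> (Suc i) j (Suc l) (Suc s) m)"
      using b[OF mon_L3[OF \<kappa>], of "Suc i" j l s m] \<kappa>
      by (simp only: pd_mon(2)[OF \<kappa>] psi_diff psi_of_nat mon_L3 ring_gen.mult ring_gen_of_nat) simp
    show "of_nat j * psi (mon \<kappa> i (j - 1) l s m) = - (2 * of_nat s * psi (mon \<kappa> i (Suc j) l (Suc s) m))"
      using y[OF mon_L3[OF \<kappa>], of i j l s m] \<kappa>
      by (simp only: pd_mon(3)[OF \<kappa>] psi_add psi_of_nat mon_L3 ring_gen.mult ring_gen_of_nat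
          eq_neg_iff_add_eq_0) simp
    show "psi (mon \<kappa> i j l s m) = psi (mon \<kappa> (Suc i) j (Suc l) (Suc s) m) - psi (mon \<kappa> i (Suc (Suc j)) l (Suc s) m)"
      using \<kappa> by (subst mon_sg) (simp add: psi_diff)
  qed
  then show ?case by (simp add: psi_def)
next
  case (add p q)
  then show ?case by (simp add: distrib_left nu_add ring_gen.mult)
qed


text \<open>
  The lemmas called \<open>rho\<close> concern the diagonal values \<open>nu w (Suc k) k\<close>. They depend on \<open>w\<close> and \<open>k\<close> only
  through \<open>w / y\<^sup>k\<close>, which is where negative powers of \<open>y\<close> come from.
\<close>

lemma rho_y: "w \<in> L3 \<Longrightarrow> nu (y * w) (Suc (Suc k)) (Suc k) = nu w (Suc k) k"
  using nu_z[of w "Suc k" "Suc k"] of_nat_neq_0[of k, where 'a='k] by (simp del: of_nat_Suc)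

lemma u_powi_mult_L3: "w \<in> L4 \<Longrightarrow> u powi m * w \<in> L3"
  by (intro ring_gen.mult u_powi_L3 L4_L3)

text \<open>On the diagonal the coefficient in \<open>nu_p\<close> is 0, so
  \<open>b (D - y) w\<close> and \<open>b u w\<close> have equal values one pole order higher.
  Integration by parts in \<open>u\<close> brings both back to the diagonal.\<close>

lemma rho_u_step:
  assumes w: "w \<in> L4"
  shows "of_int m * nu (u powi (m - 1) * ((D - y) * w)) (Suc k) k =
    of_int (m + 1) * nu (u powi m * w) (Suc k) k"
proof -
  have w': "(D - y) * w \<in> L4" using w by (intro ring_gen.mult ring_gen_diff gens_L4)
  have u: "u \<noteq> 0" using X_nonzero[of 10] by simp
  have ibp: "of_int m * nu (u powi (m - 1) * w) (Suc k) k =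
      - (of_nat (Suc k) * nu (b * (u powi m * w)) (Suc (Suc k)) k)" if "w \<in> L4" for w m
  proof -
    have "pd 10 (u powi m * w) = of_int m * (u powi (m - 1) * w)"
      using pd_u_L4[OF that] by (simp add: pd_u_powi pd_X)
    then show ?thesis
      using nu_u[OF u_powi_mult_L3[OF that, of m], of "Suc k" k]
        nu_of_int[OF u_powi_mult_L3[OF that, of "m - 1"], of m "Suc k" k] by simp
  qed
  have in3: "b * (u powi m * ((D - y) * w)) \<in> L3" "b * (u powi (m + 1) * w) \<in> L3"
    using w w' by (simp_all add: ring_gen.mult u_powi_mult_L3)
  have "of_nat (Suc k) * nu (b * ((D - y - u) * (u powi m * w))) (Suc (Suc k)) k = 0"
    using nu_p[OF u_powi_mult_L3[OF w, of m], of "Suc k" k] by simp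
  moreover have "b * ((D - y - u) * (u powi m * w)) =
      b * (u powi m * ((D - y) * w)) - b * (u powi (m + 1) * w)"
  proof -
    have "u powi (m + 1) = u powi m * u" using u by (simp add: power_int_add)
    then show ?thesis by (simp only:) (simp add: algebra_simps)
  qed
  ultimately have "of_nat (Suc k) * nu (b * (u powi m * ((D - y) * w))) (Suc (Suc k)) k =
      of_nat (Suc k) * nu (b * (u powi (m + 1) * w)) (Suc (Suc k)) k"
    using in3 by (simp only: nu_diff right_diff_distrib right_minus_eq)
  then show ?thesis using ibp[OF w', of m] ibp[OF w, of "m + 1"] by simp
qed

text \<open>Only \<open>u\<close> to the power -1 can have a residue at \<open>u = 0\<close>. At
  \<open>m = 0\<close> the step kills \<open>u^0\<close>, and positive powers follow. At
  \<open>m = - 1\<close> it kills multiples of \<open>D - y\<close> at power -2; multiples of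
  \<open>y\<close> are handled by induction on \<open>k\<close>, starting from
  \<open>psi_vanish\<close>, and the unit \<open>sg\<close> lies in the ideal of
  \<open>D - y\<close> and \<open>y\<close>.\<close>

lemma rho_u_vanish: "w \<in> L4 \<Longrightarrow> m \<noteq> - 1 \<Longrightarrow> nu (u powi m * w) (Suc k) k = 0"
proof -
  have pos: "nu (u powi int n * w) (Suc k) k = 0" if "w \<in> L4" for n k w
    using that
  proof (induction n arbitrary: w)
    case 0
    then show ?case using rho_u_step[OF 0, of 0 k] by simp
  next
    case (Suc n)
    have "(D - y) * w \<in> L4" using Suc.prems by (intro ring_gen.mult ring_gen_diff gens_L4)
    then have "of_int (int (Suc n) + 1) * nu (u powi int (Suc n) * w) (Suc k) k = 0"
      using rho_u_step[OF Suc.prems, of "int (Suc n)" k] Suc.IH[of "(D - y) * w"] by simp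
    moreover have "of_int (int (Suc n) + 1) \<noteq> (0::'k)"
      by (simp only: of_int_eq_0_iff)
    ultimately show ?case by (metis mult_eq_0_iff)
  qed
  have split: "nu (u powi m * w) (Suc k) k = 0"
    if D: "\<And>w. w \<in> L4 \<Longrightarrow> nu (u powi m * ((D - y) * w)) (Suc k) k = 0"
      and Y: "\<And>w. w \<in> L4 \<Longrightarrow> nu (u powi m * (y * w)) (Suc k) k = 0" and w: "w \<in> L4" for m k w
  proof -
    have in4: "b * (w / sg) \<in> L4" "(b - y) * (w / sg) \<in> L4"
      by (intro ring_gen.mult ring_gen_diff gens_L4 divide_sg_L4[OF w])+
    have in4': "(D - y) * (b * (w / sg)) \<in> L4" "y * ((b - y) * (w / sg)) \<in> L4"
      by (intro ring_gen.mult ring_gen_diff gens_L4 divide_sg_L4[OF w])+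
    \<comment> \<open>This exhibits the unit \<open>sg\<close> as a combination of
      \<open>D - y\<close> and \<open>y\<close>, so every \<open>w\<close> is a sum of a multiple of
      each.\<close>
    have "(D - y) * b + y * (b - y) = sg" by (simp add: sg_def algebra_simps power2_eq_square)
    then have "w = ((D - y) * b + y * (b - y)) * (w / sg)" using sg_nonzero by simp
    then have "u powi m * w = u powi m * (((D - y) * b + y * (b - y)) * (w / sg))" by (rule arg_cong)
    then have "u powi m * w = u powi m * ((D - y) * (b * (w / sg))) + u powi m * (y * ((b - y) * (w / sg)))"
      by (simp only: distrib_left distrib_right mult.assoc)
    then show ?thesis using D[OF in4(1)] Y[OF in4(2)]
      by (simp only: nu_add u_powi_mult_L3[OF in4'(1)] u_powi_mult_L3[OF in4'(2)] add_0)
  qed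
  have neg_if: "nu (u powi (- int n - 2) * w) (Suc k) k = 0"
    if Y: "\<And>m w. w \<in> L4 \<Longrightarrow> m \<le> - 2 \<Longrightarrow> nu (u powi m * (y * w)) (Suc k) k = 0" and "w \<in> L4" for n k w
    using that(2)
  proof (induction n arbitrary: w)
    case 0
    show ?case
    proof (rule split[OF _ _ 0])
      show "nu (u powi (- int 0 - 2) * ((D - y) * w)) (Suc k) k = 0" if "w \<in> L4" for w
        using rho_u_step[OF that, of "- 1" k] by simp
    qed (rule Y, simp_all)
  next
    case (Suc n)
    show ?case
    proof (rule split[OF _ _ Suc.prems])
      show "nu (u powi (- int (Suc n) - 2) * ((D - y) * w)) (Suc k) k = 0" if "w \<in> L4" for w
      proof -
        let ?m = "- int n - 2"
        have "of_int ?m * nu (u powi (?m - 1) * ((D - y) * w)) (Suc k) k = 0"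
          using rho_u_step[OF that, of ?m k] Suc.IH[OF that] by simp
        moreover have "of_int ?m \<noteq> (0::'k)" by (simp only: of_int_eq_0_iff)
        moreover have "?m - 1 = - int (Suc n) - 2" by simp
        ultimately show ?thesis by (metis mult_eq_0_iff)
      qed
    qed (rule Y, simp_all)
  qed
  have neg: "nu (u powi (- int n - 2) * w) (Suc k) k = 0" if "w \<in> L4" for n k w
    using that
  proof (induction k arbitrary: n w)
    case 0
    show ?case
    proof (rule neg_if[OF _ 0])
      show "nu (u powi m * (y * w)) (Suc 0) 0 = 0" if "w \<in> L4" for m w
        using psi_vanish[OF u_powi_mult_L3[OF that, of m]] by (simp add: mult.left_commute)
    qed
  next
    case (Suc k)
    show ?case
    proof (rule neg_if[OF _ Suc.prems])
      show "nu (u powi m * (y * w)) (Suc (Suc k)) (Suc k) = 0" if "w \<in> L4" "m \<le> - 2" for m w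
        using rho_y[OF u_powi_mult_L3[OF that(1), of m], of k] Suc.IH[OF that(1), of "nat (- m - 2)"] that(2)
        by (simp add: mult.left_commute)
    qed
  qed
  show "w \<in> L4 \<Longrightarrow> m \<noteq> - 1 \<Longrightarrow> nu (u powi m * w) (Suc k) k = 0"
  proof (cases "0 \<le> m")
    case True
    then show "w \<in> L4 \<Longrightarrow> ?thesis" using pos[of w "nat m" k] by simp
  next
    case False
    then show "w \<in> L4 \<Longrightarrow> m \<noteq> - 1 \<Longrightarrow> ?thesis" using neg[of w "nat (- m - 2)" k] by simp
  qed
qed

text \<open>A derivative in \<open>u\<close> never contains the power -1 of \<open>u\<close>, so
  \<open>rho_u_vanish\<close> kills it, and \<open>nu_u\<close> turns it into the stated
  value.\<close>

lemma nu_b_diag_vanish: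
  assumes "w \<in> L3"
  shows "nu (b * w) (Suc (Suc k)) k = 0"
proof -
  have "nu (pd 10 w) (Suc k) k = 0" using assms
  proof (induction rule: L3_monomial_u_induct)
    case (monom w m)
    have "pd 10 (u powi m * w) = of_int m * (u powi (m - 1) * w)"
      using pd_u_L4[OF monom] by (simp add: pd_u_powi pd_X)
    then show ?case
      using nu_of_int[OF u_powi_mult_L3[OF monom, of "m - 1"], of m "Suc k" k]
        rho_u_vanish[OF monom, of "m - 1" k] by (cases "m = 0") simp_all
  next
    case (add p q)
    then show ?case by (simp add: nu_add pd_L3)
  qed
  then have "of_nat (Suc k) * nu (b * w) (Suc (Suc k)) k = 0"
    using nu_u[OF assms, of "Suc k" k] by (simp only: neg_equal_0_iff_equal)
  then show ?thesis by (simp only: mult_eq_0_iff of_nat_eq_0_iff) simp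
qed

lemma sg_split:
  assumes w: "w \<in> L3"
  shows "\<exists>x\<in>L3. \<forall>j k. nu w j k = nu (b * (D * x)) j k - nu (y * (y * x)) j k"
proof (intro bexI allI)
  show x: "w / sg \<in> L3" by (rule divide_sg_L3[OF w])
  have "w = sg * (w / sg)" using sg_nonzero by simp
  also have "sg * (w / sg) = b * (D * (w / sg)) - y * (y * (w / sg))"
    by (simp only: sg_def power2_eq_square left_diff_distrib mult.assoc)
  finally have "nu w j k = nu (b * (D * (w / sg)) - y * (y * (w / sg))) j k" for j k by (rule arg_cong)
  moreover have "b * (D * (w / sg)) \<in> L3" "y * (y * (w / sg)) \<in> L3"
    by (intro ring_gen.mult gens_L3 x)+
  ultimately show "nu w j k = nu (b * (D * (w / sg))) j k - nu (y * (y * (w / sg))) j k" for j k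
    by (simp only: nu_diff)
qed

text \<open>The residue argument would need \<open>1 / y\<close>. Instead the unit
  \<open>sg = b D - y^2\<close> splits \<open>w\<close> into a multiple of \<open>b\<close>, which
  is a derivative in \<open>D\<close> or covered by \<open>nu_b_diag_vanish\<close>, and a multiple
  of \<open>y\<close>, for which \<open>nu_z\<close> lowers both exponents.\<close>

lemma nu_vanish_above: "w \<in> L3 \<Longrightarrow> nu w (k + 2 + d) k = 0"
proof (induction k arbitrary: d w)
  case 0
  then show ?case
  proof (induction d arbitrary: w)
    case 0
    obtain x where x: "x \<in> L3" "\<And>j k. nu w j k = nu (b * (D * x)) j k - nu (y * (y * x)) j k"
      using sg_split[OF 0] by blast
    have "D * x \<in> L3" "y * x \<in> L3" using x by (simp_all add: ring_gen.mult)
    then show ?case using x(2)[of 2 0] nu_b_diag_vanish[of "D * x" 0] nu_z_0[of "y * x" 0]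
      by (simp add: numeral_2_eq_2)
  next
    case (Suc d)
    obtain x where x: "x \<in> L3" "\<And>j k. nu w j k = nu (b * (D * x)) j k - nu (y * (y * x)) j k"
      using sg_split[OF Suc.prems] by blast
    have in3: "D * x \<in> L3" "y * x \<in> L3" using x by (simp_all add: ring_gen.mult)
    have "nu (pd 11 (D * x)) (Suc (Suc d)) 0 = 0"
      using Suc.IH[OF pd_L3[OF _ in3(1)], of 11] by simp
    then have "of_nat (Suc (Suc d)) * nu (b * (D * x)) (Suc (Suc (Suc d))) 0 = 0"
      using nu_D[OF in3(1), of "Suc (Suc d)" 0] by (simp only:)
    then have "nu (b * (D * x)) (Suc (Suc (Suc d))) 0 = 0"
      by (simp only: mult_eq_0_iff of_nat_eq_0_iff) simp
    then show ?case using x(2)[of "Suc (Suc (Suc d))" 0] nu_z_0[OF in3(2), of "Suc d"]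
      by simp
  qed
next
  case (Suc k)
  note IHk = Suc.IH
  have Y: "nu (y * w) (Suc k + 2 + d) (Suc k) = 0" if "w \<in> L3" for w d
  proof -
    have "of_nat (k + 2 + d) * nu (y * w) (Suc (k + 2 + d)) (Suc k) = 0"
      using nu_z[OF that, of "Suc k" "k + 2 + d"] IHk[OF that, of d] by simp
    then show ?thesis by (simp only: mult_eq_0_iff of_nat_eq_0_iff) simp
  qed
  show ?case using Suc.prems
  proof (induction d arbitrary: w)
    case 0
    obtain x where x: "x \<in> L3" "\<And>j k. nu w j k = nu (b * (D * x)) j k - nu (y * (y * x)) j k"
      using sg_split[OF 0] by blast
    have in3: "D * x \<in> L3" "y * x \<in> L3" using x by (simp_all add: ring_gen.mult)
    then show ?case using x(2)[of "Suc k + 2" "Suc k"] nu_b_diag_vanish[OF in3(1), of "Suc k"]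
       Y[OF in3(2), of 0] by simp
  next
    case (Suc d)
    obtain x where x: "x \<in> L3" "\<And>j k. nu w j k = nu (b * (D * x)) j k - nu (y * (y * x)) j k"
      using sg_split[OF Suc.prems] by blast
    have in3: "D * x \<in> L3" "y * x \<in> L3" using x by (simp_all add: ring_gen.mult)
    have "nu (pd 11 (D * x)) (Suc k + 2 + d) (Suc k) = 0"
      using Suc.IH[OF pd_L3[OF _ in3(1)], of 11] by simp
    then have "of_nat (Suc k + 2 + d) * nu (b * (D * x)) (Suc (Suc k + 2 + d)) (Suc k) = 0"
      using nu_D[OF in3(1), of "Suc k + 2 + d" "Suc k"] by (simp only:)
    then have "nu (b * (D * x)) (Suc (Suc k + 2 + d)) (Suc k) = 0"
      by (simp only: mult_eq_0_iff of_nat_eq_0_iff) simp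
    then show ?case using x(2)[of "Suc (Suc k + 2 + d)" "Suc k"] Y[OF in3(2), of "Suc d"]
      by simp
  qed
qed

text \<open>By the previous results only the power -1 of \<open>u\<close> matters, and a factor
  \<open>y\<close> is traded for a smaller \<open>k\<close>. For \<open>k = 0\<close> the weights
  leave \<open>b^i D^i / (u sg^(i+1))\<close>, and all of these have the value at
  \<open>1 / (sg u k0)\<close>, the class of eta. Larger \<open>k\<close> reduce to smaller ones by
  integration by parts in \<open>y\<close>.\<close>

lemma rho_vanish: "w \<in> L3 \<Longrightarrow> nu w (Suc k) k = 0"
proof (induction rule: L3_monomial_induct)
  case (monom \<kappa> i j l s m)
  note \<kappa> = monom
  define c where "c k i l s = nu (mon \<kappa> i 0 l s (- 1)) (Suc k) k" for k i l s
  have above: "nu w (Suc (Suc k)) k = 0" if "w \<in> L3" for w k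
    using nu_vanish_above[OF that, of k 0] by simp
  have p: "D - y - u \<in> L3" by (intro ring_gen_diff gens_L3)
  have D: "nu (pd 11 w) (Suc k) k = 0" and b: "nu (pd 7 w) (Suc k) k = 0"
    and y: "nu (pd 9 w) (Suc k) k = of_nat (Suc k) * nu w (Suc (Suc k)) (Suc k)" if "w \<in> L3" for w k
    using nu_D[OF that, of "Suc k" k] nu_b[OF that, of "Suc k" k] nu_y[OF that, of "Suc k" k]
      above[of "b * w" k] above[of "(D - y - u) * w" k] that p
    by (simp_all add: ring_gen.mult)
  have cD: "of_nat (Suc l) * c k i l s = of_nat s * c k (Suc i) (Suc l) (Suc s)" for k i l s
    using D[OF mon_L3[OF \<kappa>], of i 0 "Suc l" s "- 1" k] \<kappa>
    by (simp only: pd_mon(1)[OF \<kappa>] nu_diff nu_of_nat mon_L3 ring_gen.mult ring_gen_of_nat c_def) simp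
  have cb: "of_nat (Suc i) * c k i l s = of_nat s * c k (Suc i) (Suc l) (Suc s)" for k i l s
    using b[OF mon_L3[OF \<kappa>], of "Suc i" 0 l s "- 1" k] \<kappa>
    by (simp only: pd_mon(2)[OF \<kappa>] nu_diff nu_of_nat mon_L3 ring_gen.mult ring_gen_of_nat c_def) simp
  \<comment> \<open>The monomial contains no \<open>y\<close>, so its derivative in \<open>y\<close>
    only comes from the power of \<open>sg\<close>; this is where \<open>2 * s\<close> and the new
    factor \<open>y\<close> originate.\<close>
  have cy: "of_nat (Suc k) * c (Suc k) i l s = of_nat (2 * s) * nu (y * mon \<kappa> i 0 l (Suc s) (- 1)) (Suc k) k" for k i l s
    using y[OF mon_L3[OF \<kappa>], of i 0 l s "- 1" k] \<kappa>
    by (simp add: pd_mon(3)[OF \<kappa>] nu_of_nat c_def mon_y del: of_nat_Suc of_nat_mult)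
  have diag: "c k i l s = 0" if "i \<noteq> l" for k i l s
  proof -
    have "(of_nat (Suc l) - of_nat (Suc i)) * c k i l s = 0"
      using cD[of l k i s] cb[of i k l s] by (simp only: left_diff_distrib diff_self)
    moreover have "of_nat (Suc l) - of_nat (Suc i) \<noteq> (0 :: 'k)" using that by simp
    ultimately show ?thesis by simp
  qed
  have Y0: "nu (y * mon \<kappa> i 0 l s (- 1)) (Suc 0) 0 = 0" for i l s
    using psi_vanish[OF mon_L3[OF \<kappa>]] by simp
  have rel: "c 0 i l s = c 0 (Suc i) (Suc l) (Suc s)" for i l s
  proof -
    have "nu (mon \<kappa> i (Suc (Suc 0)) l (Suc s) (- 1)) (Suc 0) 0 = 0"
      using psi_vanish[OF mon_L3[OF \<kappa>, of i "Suc 0" l "Suc s" "- 1"]] by (simp add: mon_y)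
    then show ?thesis unfolding c_def using \<kappa> by (subst mon_sg) (simp add: nu_diff)
  qed
  \<comment> \<open>The one surviving class is disposed of by the hypothesis that the functional
    kills eta.\<close>
  have base: "c 0 0 0 1 = 0"
  proof -
    have "mon \<kappa> 0 0 0 1 (- 1) * z ^ 0 / k0 ^ Suc 0 = \<kappa> / (sg * u * k0)"
      by (simp add: mon_def power_int_minus field_simps)
    then show ?thesis using Phi_eta[OF \<kappa>] by (simp only: c_def nu_def)
  qed
  have c_diag: "c 0 i i (Suc i) = 0" for i
    by (induction i) (use base rel in \<open>simp_all\<close>)
  have c0: "c 0 i l s = 0" for i l s
  proof (cases "i = l \<and> s = Suc i")
    case True
    then show ?thesis using c_diag by simp
  next
    case False
    show ?thesis
    proof (cases "i = l")
      case True
      then have "(of_nat (Suc i) - of_nat s) * c 0 i l s = 0"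
        using cD[of l 0 i s] rel[of i l s] by (simp add: left_diff_distrib)
      moreover have "of_nat (Suc i) - of_nat s \<noteq> (0 :: 'k)"
        using True False by (simp only: right_minus_eq of_nat_eq_iff) simp
      ultimately show ?thesis by simp
    qed (rule diag)
  qed
  have c_all: "c k i l s = 0" for k i l s
  proof (induction k arbitrary: i l s rule: less_induct)
    case (less k)
    show ?case
    proof (cases k)
      case (Suc k')
      have "nu (y * mon \<kappa> i 0 l (Suc s) (- 1)) (Suc k') k' = 0"
      proof (cases k')
        case (Suc k'')
        then show ?thesis using less[of k'' i l "Suc s"] \<open>k = Suc k'\<close>
            rho_y[OF mon_L3[OF \<kappa>, of i 0 l "Suc s" "- 1"], of k''] by (simp add: c_def)
      qed (simp add: Y0)
      then have "of_nat k * c k i l s = 0" using cy[of k' i l s] Suc by simp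
      then show ?thesis using Suc by (simp only: mult_eq_0_iff of_nat_eq_0_iff) simp
    qed (simp add: c0)
  qed
  show ?case
  \<comment> \<open>Each factor \<open>y\<close> costs one unit of \<open>k\<close> through
    \<open>rho_y\<close>; when \<open>k\<close> is used up, \<open>psi_vanish\<close> takes
    over.\<close>
  proof (induction j arbitrary: k)
    case 0
    show ?case
    proof (cases "m = - 1")
      case True
      then show ?thesis using c_all by (simp add: c_def)
    next
      case False
      have "mon \<kappa> i 0 l s m = u powi m * (\<kappa> * b ^ i * D ^ l * (1 / sg) ^ s)"
        by (simp add: mon_def power_one_over mult_ac)
      moreover have "\<kappa> * b ^ i * D ^ l * (1 / sg) ^ s \<in> L4"
        using ring_gen_C_L4[OF \<kappa>] by (intro ring_gen.mult ring_gen_power; simp)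
      ultimately show ?thesis using rho_u_vanish[OF _ False] by simp
    qed
  next
    case (Suc j)
    show ?case
    proof (cases k)
      case 0
      then show ?thesis using psi_vanish[OF mon_L3[OF \<kappa>, of i j l s m]] by (simp add: mon_y)
    next
      case (Suc k')
      then show ?thesis using rho_y[OF mon_L3[OF \<kappa>, of i j l s m], of k'] Suc.IH[of k'] \<open>\<And>k. nu (mon \<kappa> i j l s m) (Suc k) k = 0\<close>
        by (simp add: mon_y)
    qed
  qed
next
  case (add p q)
  then show ?case by (simp add: nu_add)
qed

text \<open>For \<open>j \<le> k\<close> the coefficient \<open>j - k - 1\<close> in
  \<open>nu_p\<close> is nonzero, so the value is determined by one with larger \<open>j\<close>,
  and this climb ends on the diagonal.\<close>

lemma nu_vanish: "w \<in> L3 \<Longrightarrow> nu w j k = 0"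
proof (cases "j \<le> k")
  case False
  then show "w \<in> L3 \<Longrightarrow> ?thesis"
    using rho_vanish[of w k] nu_vanish_above[of w k "j - k - 2"]
    by (cases "j = Suc k") (simp_all add: add.commute[of 2] del: add_2_eq_Suc')
next
  case True
  then show "w \<in> L3 \<Longrightarrow> ?thesis"
  proof (induction "k - j" arbitrary: j w)
    case 0
    let ?w = "b * ((D - y - u) * w)"
    have "?w \<in> L3" using 0 by (auto intro!: ring_gen_closed)
    moreover have "j = k" using 0 by simp
    ultimately have "(of_nat j - of_nat k - 1) * nu w j k = 0"
      using nu_p[of w j k] rho_vanish[of ?w k] 0 by simp
    then show ?case using \<open>j = k\<close> by simp
  next
    case (Suc d)
    let ?w = "b * ((D - y - u) * w)"
    have "?w \<in> L3" using Suc.prems by (auto intro!: ring_gen_closed)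
    then have "(of_nat j - of_nat k - 1) * nu w j k = 0"
      using nu_p[of w j k] Suc.hyps(1)[of "Suc j" ?w] Suc.hyps(2) Suc.prems by simp
    moreover have "of_nat j - of_nat k - 1 \<noteq> (0::'k)"
    proof
      assume "of_nat j - of_nat k - 1 = (0::'k)"
      then have "of_nat j = (of_nat (Suc k) :: 'k)" by (simp add: algebra_simps)
      then show False using Suc.hyps(2) by (simp only: of_nat_eq_iff)
    qed
    ultimately show ?case by simp
  qed
qed

theorem Phi_vanish: "g \<in> L2 \<Longrightarrow> Phi g = 0"
proof -
  assume "g \<in> L2"
  then have "g \<in> L2 \<and> Phi g = 0" unfolding S2_eq
  proof (induction rule: ring_gen_adjoin_induct)
    case (monom w k)
    then show ?case
    proof (induction rule: ring_gen_adjoin_induct)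
      case (monom w j)
      have "w * (1 / k0) ^ j * z ^ k = w * z ^ k / k0 ^ j" by (simp add: power_one_over)
      then show ?case using nu_vanish[OF monom, of j k] nu_arg_L2[OF L3_L2[OF monom], of k j]
        by (simp only: nu_def S2_eq[symmetric])
    qed (simp add: distrib_right Phi_add S2_eq[symmetric] ring_gen.add)
  qed (simp add: Phi_add S2_eq[symmetric] ring_gen.add)
  then show "Phi g = 0" by simp
qed

end

section \<open>From mu to a functional on fractions\<close>

context zz5_functional
begin

text \<open>Expanding a fraction does not change its value; this is what makes \<open>Phi\<close>
  well defined.\<close>

lemma mu_shift: "w \<in> R5 \<Longrightarrow> mu (sg ^ p * ka ^ q * w) (s + p) (n + int q) = mu w s n"
proof -
  assume w: "w \<in> R5"
  have "mu (sg ^ p * w) (s + p) n = mu w s n" if "w \<in> R5" for w n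
  proof (induction p)
    case (Suc p)
    have "sg ^ p * w \<in> R5" using that by (intro ring_gen.mult ring_gen_power) simp_all
    then show ?case using Suc mu_sg[of "sg ^ p * w" "s + p" n] by (simp add: mult.assoc)
  qed simp
  moreover have "mu (ka ^ q * w) s (n + int q) = mu w s n"
  proof (induction q)
    case (Suc q)
    have "ka ^ q * w \<in> R5" using w by (intro ring_gen.mult ring_gen_power) simp_all
    then show ?case using Suc mu_ka[of "ka ^ q * w" s "n + int (Suc q)"]
      by (simp add: mult.assoc algebra_simps)
  qed simp
  moreover have "ka ^ q * w \<in> R5" using w by (intro ring_gen.mult ring_gen_power) simp_all
  ultimately show ?thesis by (simp add: mult.assoc)
qed

abbreviation frac where "frac w s n \<equiv> w / (sg ^ Suc s * ka ^ Suc n)"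

definition Phi :: "'f \<Rightarrow> 'k" where
  "Phi g = (THE x. \<exists>w s n. w \<in> R5 \<and> g = frac w s n \<and> x = mu w s (int n))"

lemma Phi_frac:
  assumes w: "w \<in> R5"
  shows "Phi (frac w s n) = mu w s (int n)"
  unfolding Phi_def
proof (rule the_equality)
  fix x assume "\<exists>w' s' n'. w' \<in> R5 \<and> frac w s n = frac w' s' n' \<and> x = mu w' s' (int n')"
  then obtain w' s' n' where w': "w' \<in> R5" and eq: "frac w s n = frac w' s' n'" and x: "x = mu w' s' (int n')"
    by blast
  have "sg * ka * (sg ^ s' * ka ^ n' * w) = sg * ka * (sg ^ s * ka ^ n * w')"
    using eq sg_nonzero ka_nonzero by (simp add: frac_eq_eq mult_ac)
  then have "sg ^ s' * ka ^ n' * w = sg ^ s * ka ^ n * w'"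
    using sg_nonzero ka_nonzero by simp
  then show "x = mu w s (int n)"
    using mu_shift[OF w, of s' n' s "int n"] mu_shift[OF w', of s n s' "int n'"] x
    by (simp add: add.commute)
qed (use w in blast)

lemma L2_frac:
  assumes "g \<in> ring_gen S2"
  obtains w s n where "w \<in> R5" "g = frac w s n"
proof -
  have "\<exists>s n. g * (sg ^ s * ka ^ n) \<in> R5" using assms
  proof (induction rule: ring_gen.induct)
    case (gen x)
    have u: "u \<noteq> 0" using X_nonzero[of 10] by simp
    from gen consider "x \<in> S5" | "x = 1 / sg" | "x = 1 / u" | "x = 1 / k0" by (auto simp: S2_def)
    then show ?case
    proof cases
      case 1
      then show ?thesis using ring_gen.gen[of x S5] by (intro exI[of _ 0]) simp
    next
      case 2
      then show ?thesis using sg_nonzero by (intro exI[of _ 1] exI[of _ 0]) simp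
    next
      case 3
      then show ?thesis using u by (intro exI[of _ 0] exI[of _ 1]) (simp add: ka_def)
    next
      case 4
      then show ?thesis using k0_nonzero by (intro exI[of _ 0] exI[of _ 1]) (simp add: ka_def)
    qed
  next
    case one
    show ?case by (intro exI[of _ 0]) simp
  next
    case (minus x)
    then obtain s n where "x * (sg ^ s * ka ^ n) \<in> R5" by blast
    then show ?case using ring_gen.minus by (intro exI[of _ s] exI[of _ n]) fastforce
  next
    case (add x x')
    then obtain s n s' n' where h: "x * (sg ^ s * ka ^ n) \<in> R5" "x' * (sg ^ s' * ka ^ n') \<in> R5" by blast
    have "(x + x') * (sg ^ (s + s') * ka ^ (n + n')) =
      x * (sg ^ s * ka ^ n) * (sg ^ s' * ka ^ n') + x' * (sg ^ s' * ka ^ n') * (sg ^ s * ka ^ n)"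
      by (simp add: power_add algebra_simps)
    moreover have "\<dots> \<in> R5"
    proof -
      have "sg ^ s * ka ^ n \<in> R5" "sg ^ s' * ka ^ n' \<in> R5"
        by (intro ring_gen.mult ring_gen_power base_R5)+
      then show ?thesis using h by (simp only: ring_gen.add ring_gen.mult)
    qed
    ultimately show ?case by metis
  next
    case (mult x x')
    then obtain s n s' n' where h: "x * (sg ^ s * ka ^ n) \<in> R5" "x' * (sg ^ s' * ka ^ n') \<in> R5" by blast
    have "x * x' * (sg ^ (s + s') * ka ^ (n + n')) = x * (sg ^ s * ka ^ n) * (x' * (sg ^ s' * ka ^ n'))"
      by (simp add: power_add algebra_simps)
    moreover have "\<dots> \<in> R5" by (rule ring_gen.mult[OF h])
    ultimately show ?case by metis
  qed
  then obtain s n where h: "g * (sg ^ s * ka ^ n) \<in> R5" by blast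
  show ?thesis
  proof
    show "sg * ka * (g * (sg ^ s * ka ^ n)) \<in> R5" using h by (simp only: ring_gen.mult base_R5)
    show "g = frac (sg * ka * (g * (sg ^ s * ka ^ n))) s n"
      using sg_nonzero ka_nonzero by simp
  qed
qed

lemma frac_expand: "frac w s n = frac (sg ^ p * ka ^ q * w) (s + p) (n + q)"
proof -
  have "sg ^ Suc (s + p) * ka ^ Suc (n + q) = (sg ^ p * ka ^ q) * (sg ^ Suc s * ka ^ Suc n)"
    by (simp add: power_add mult_ac)
  then show ?thesis using sg_nonzero ka_nonzero by (simp only:) simp
qed

lemma Phi_base_functional: "zz5_base_functional pd X C Phi"
proof
  fix p q assume "p \<in> ring_gen S2" "q \<in> ring_gen S2"
  then obtain w s n w' s' n' where w: "w \<in> R5" "p = frac w s n" and w': "w' \<in> R5" "q = frac w' s' n'"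
    by (metis L2_frac)
  let ?w = "sg ^ s' * ka ^ n' * w" and ?w' = "sg ^ s * ka ^ n * w'"
  have p: "p = frac ?w (s + s') (n + n')" using w frac_expand by simp
  have q: "q = frac ?w' (s + s') (n + n')" using w' frac_expand[of w' s' n' s n] by (simp add: add.commute)
  have in5: "?w \<in> R5" "?w' \<in> R5" using w w' by (auto intro!: ring_gen.mult ring_gen_power)
  have "p + q = frac (?w + ?w') (s + s') (n + n')" unfolding p q by (simp only: add_divide_distrib)
  then show "Phi (p + q) = Phi p + Phi q"
    by (simp only: p q Phi_frac[OF in5(1)] Phi_frac[OF in5(2)] Phi_frac[OF ring_gen.add[OF in5]] mu_add)
next
  fix i :: nat and g assume i: "i \<in> {7..11}" and "g \<in> ring_gen S2"
  then obtain w s n where w: "w \<in> R5" and g: "g = frac w s n" using L2_frac by metis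
  have i': "i \<in> {2..11}" using i by auto
  \<comment> \<open>The numerator of the quotient rule over the common denominator
    \<open>sg ^ (s + 2) * ka ^ (n + 2)\<close>.\<close>
  let ?W = "sg * (ka * pd i w) - of_nat (Suc s) * (ka * (pd i sg * w)) - of_nat (Suc n) * (sg * (pd i ka * w))"
  have in5: "pd i w \<in> R5" "pd i sg * w \<in> R5" "pd i ka * w \<in> R5"
    using pd_in_R5[OF i'] w by (simp_all add: ring_gen.mult)
  have W: "?W \<in> R5" using in5 by (simp only: ring_gen_diff ring_gen.mult ring_gen_of_nat base_R5)
  have g': "g = (w / sg ^ Suc s) / ka ^ Suc n" by (simp only: g divide_divide_eq_left)
  have "pd i g = (pd i w / sg ^ Suc s - of_nat (Suc s) * (w * pd i sg / sg ^ Suc (Suc s))) / ka ^ Suc n -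
     of_nat (Suc n) * ((w / sg ^ Suc s) * pd i ka / ka ^ Suc (Suc n))"
    by (simp only: g' pd_divide_power[OF i' ka_nonzero] pd_divide_power[OF i' sg_nonzero])
  also have "\<dots> = frac ?W (Suc s) (Suc n)"
  proof -
    have "(p1 / S - m * (w * p2 / (x * S))) / K - k * ((w / S) * p3 / (x' * K)) =
      (x * (x' * p1) - m * (x' * (p2 * w)) - k * (x * (p3 * w))) / (x * S * (x' * K))"
      if "S \<noteq> 0" "K \<noteq> 0" "x \<noteq> 0" "x' \<noteq> 0" for S K x x' p1 p2 p3 m k w :: 'f
      using that by (simp add: divide_simps) (simp add: algebra_simps)
    then show ?thesis
      using sg_nonzero ka_nonzero
      by (simp only: power_Suc[of sg "Suc s"] power_Suc[of ka "Suc n"] power_not_zero not_False_eq_True simp_thms)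
  qed
  finally have "Phi (pd i g) = mu ?W (Suc s) (int (Suc n))"
    using Phi_frac[OF W, of "Suc s" "Suc n"] by (simp only:)
  also have "\<dots> = mu (pd i w) s (int n) - of_nat (Suc s) * mu (pd i sg * w) (Suc s) (int n)
      - of_nat (Suc n) * mu (pd i ka * w) s (int n + 1)"
  proof -
    have mu_of_nat: "mu (of_nat m * x) s' n' = of_nat m * mu x s' n'" for m x s' n'
    proof (induction m)
      case 0
      then show ?case using mu_add[of 0 0 s' n'] by simp
    qed (simp add: distrib_right mu_add)
    show ?thesis
      using mu_sg[OF ka_R5[OF in5(1)], of s "int (Suc n)"] mu_ka[OF in5(1), of s "int (Suc n)"]
        mu_ka[OF in5(2), of "Suc s" "int (Suc n)"] mu_sg[OF in5(3), of s "int (Suc n)"]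
      by (simp add: mu_diff mu_of_nat add.commute del: of_nat_Suc)
        (simp add: add.commute)
  qed
  also have "\<dots> = 0" using mu_ibp[OF w i, of "int n" s] by simp
  finally show "Phi (pd i g) = 0" .
next
  fix k assume k: "k \<in> ring_gen C"
  then have k5: "k \<in> R5" by (rule ring_gen_subset[rotated]) (auto simp: S5_def intro: ring_gen.gen)
  have eq: "k / (sg * u * k0) = frac k 0 0" by (simp add: ka_def mult_ac)
  show "Phi (k / (sg * u * k0)) = 0" unfolding eq Phi_frac[OF k5] using mu_eta[OF k] by simp
qed

theorem lam_zero_on_complement:
  assumes "g \<in> R10"
  shows "lam (g / f ^ K) = 0"
proof (rule lam_vanish[OF _ assms])
  fix w s n assume w: "w \<in> R5"
  interpret base: zz5_base_functional pd X C Phi by (rule Phi_base_functional)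
  show "T w s 0 n = 0"
  proof (cases "n < 0")
    case True
    then show ?thesis using mu_neg by (simp add: mu_def)
  next
    case False
    have "w \<in> ring_gen S2" using w by (rule ring_gen_subset[rotated]) (auto simp: S2_def intro: ring_gen.gen)
    then have "w * ((1 / sg) ^ Suc s * (1 / u * (1 / k0)) ^ Suc (nat n)) \<in> ring_gen S2"
      by (intro ring_gen.mult ring_gen_power) (auto simp: S2_def intro: ring_gen.gen)
    moreover have "w * ((1 / sg) ^ Suc s * (1 / u * (1 / k0)) ^ Suc (nat n)) = frac w s (nat n)"
    proof -
      have "1 / u * (1 / k0) = 1 / ka" by (simp add: ka_def)
      then show ?thesis by (simp only: power_one_over) simp
    qed
    ultimately have "Phi (frac w s (nat n)) = 0" using base.Phi_vanish by simp
    then show ?thesis using Phi_frac[OF w, of s "nat n"] False by (simp add: mu_def)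
  qed
qed

end

section \<open>Rational functions in the edge variables\<close>

lemma derivation_add: "derivation d \<Longrightarrow> derivation d' \<Longrightarrow> derivation (\<lambda>x. d x + d' x)"
  and derivation_diff: "derivation d \<Longrightarrow> derivation d' \<Longrightarrow> derivation (\<lambda>x. d x - d' x)"
  by (simp_all add: derivation_def algebra_simps)

lemma mpderiv_minus: "mpderiv i (- F) = - mpderiv i F"
  using mpderiv_add[of i F "- F"] by (simp add: eq_neg_iff_add_eq_0 add.commute)

lemma mpderiv_Const [simp]: "mpderiv i (Const c) = 0"
  by (simp add: Const_def mpderiv_single)

lemma mpderiv_Var: "mpderiv i (Var j) = (if i = j then 1 else 0)"
  by (simp add: Var_def mpderiv_single lookup_single when_def)

lemma derivation_rderiv: "derivation (rderiv i)"
proof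
  fix x y :: "'a ratfun"
  obtain a b where x: "x = Fract a b" "b \<noteq> 0" by (cases x) auto
  obtain c d where y: "y = Fract c d" "d \<noteq> 0" by (cases y) auto
  show "rderiv i (x + y) = rderiv i x + rderiv i y"
    using x y by (simp add: rderiv_Fract eq_fract mpderiv_add mpderiv_mult algebra_simps)
  show "rderiv i (x * y) = x * rderiv i y + rderiv i x * y"
    using x y by (simp add: rderiv_Fract eq_fract mpderiv_add mpderiv_mult algebra_simps)
qed

definition rat :: "'a::field mpoly \<Rightarrow> 'a ratfun" where "rat F = Fract F 1"

lemma rat_add: "rat (F + G) = rat F + rat G"
  and rat_diff: "rat (F - G) = rat F - rat G"
  and rat_minus: "rat (- F) = - rat F"
  and rat_mult: "rat (F * G) = rat F * rat G"
  and rat_0 [simp]: "rat 0 = 0"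
  and rat_1 [simp]: "rat 1 = 1"
  by (simp_all add: rat_def Zero_fract_def One_fract_def)

lemma rat_power: "rat (F ^ n) = rat F ^ n"
  by (induction n) (simp_all add: rat_mult)

lemma rat_sum: "rat (sum F S) = (\<Sum>x\<in>S. rat (F x))"
  by (induction S rule: infinite_finite_induct) (simp_all add: rat_add)

lemma rat_numeral [simp]: "rat (numeral n) = numeral n"
proof -
  have "rat (of_nat m) = of_nat m" for m by (induction m) (simp_all add: rat_add)
  from this[of "numeral n"] show ?thesis by simp
qed

lemma rat_eq_iff [simp]: "rat F = rat G \<longleftrightarrow> F = G"
  by (simp add: rat_def eq_fract)

lemma Fract_rat: "G \<noteq> 0 \<Longrightarrow> Fract F G = rat F / rat G"
  by (simp add: rat_def divide_fract)

lemma rderiv_rat: "rderiv i (rat F) = rat (mpderiv i F)"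
  using mpderiv_Const[of i "1 :: 'a"] by (simp add: rat_def rderiv_Fract Const_def mpderiv_minus)

abbreviation A :: "nat \<Rightarrow> 'a::field ratfun" where "A i \<equiv> rat (Var i)"

lemma rderiv_A: "rderiv i (A j) = (if i = j then 1 else 0)"
  by (simp add: rderiv_rat mpderiv_Var)

definition constants :: "'a::field ratfun set" where "constants = range (\<lambda>c. rat (Const c))"

text \<open>The entries at positions 0 and 1 are dummies; \<open>zz5_deriv\<close> is the dual basis of derivations.\<close>

definition zz5_coord :: "nat \<Rightarrow> 'a::field ratfun" where
  "zz5_coord i = [0, 0, A 3 + A 4 + A 8, A 1 + A 7 + A 9 + A 10, A 4 + A 5 + A 9, A 4, A 9,
     A 1 + A 2 + A 6, A 1, A 2, A 3, A 2 + A 3 + A 7] ! i"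

definition zz5_deriv :: "nat \<Rightarrow> 'a::field ratfun \<Rightarrow> 'a ratfun" where
  "zz5_deriv i = [rderiv 1, rderiv 1, rderiv 8, rderiv 10, rderiv 5,
     (\<lambda>x. rderiv 4 x - rderiv 8 x - rderiv 5 x),
     (\<lambda>x. rderiv 9 x - rderiv 5 x - rderiv 10 x),
     rderiv 6,
     (\<lambda>x. rderiv 1 x - rderiv 6 x - rderiv 10 x),
     (\<lambda>x. rderiv 2 x - rderiv 6 x - rderiv 7 x + rderiv 10 x),
     (\<lambda>x. rderiv 3 x - rderiv 7 x - rderiv 8 x + rderiv 10 x),
     (\<lambda>x. rderiv 7 x - rderiv 10 x)] ! i"

lemma index_2_11: "i \<in> {2..11} \<Longrightarrow> i \<in> {2, 3, 4, 5, 6, 7, 8, 9, 10, 11 :: nat}"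
  by (simp only: atLeastAtMost_iff insert_iff empty_iff) presburger

lemma derivation_zz5_deriv: "i \<in> {2..11} \<Longrightarrow> derivation (zz5_deriv i)"
  by (drule index_2_11)
     (elim insertE emptyE; simp add: zz5_deriv_def;
      intro derivation_add derivation_diff derivation_rderiv)

lemma rderiv_add: "rderiv i (x + y) = rderiv i x + rderiv i y"
  by (rule derivation.d_add[OF derivation_rderiv])

lemma rderiv_zero [simp]: "rderiv i 0 = 0"
  by (rule derivation.d_zero[OF derivation_rderiv])

lemma zz5_deriv_coord: "i \<in> {2..11} \<Longrightarrow> j \<in> {2..11} \<Longrightarrow>
    zz5_deriv i (zz5_coord j) = (if i = j then 1 else 0)"
  by (drule index_2_11, drule index_2_11)
     (elim insertE emptyE; simp add: zz5_deriv_def zz5_coord_def rderiv_add rderiv_A)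

lemma zz5_deriv_constants: "i \<in> {2..11} \<Longrightarrow> k \<in> constants \<Longrightarrow> zz5_deriv i k = 0"
  by (drule index_2_11) (auto simp: zz5_deriv_def constants_def rderiv_rat)

interpretation zz5: zz5_coordinates zz5_deriv "zz5_coord :: nat \<Rightarrow> 'a::field ratfun" constants
  by (rule zz5_coordinates.intro) (fact derivation_zz5_deriv zz5_deriv_coord zz5_deriv_constants)+

definition polys :: "'a::field ratfun set" where "polys = ring_gen (constants \<union> A ` {1..10})"

lemma A_polys: "i \<in> {1..10} \<Longrightarrow> A i \<in> polys"
  unfolding polys_def by (intro ring_gen.gen) simp

lemma constants_polys: "x \<in> constants \<Longrightarrow> x \<in> polys"
  unfolding polys_def by (intro ring_gen.gen) simp

lemma polys_closed:
  "x \<in> polys \<Longrightarrow> y \<in> polys \<Longrightarrow> x + y \<in> polys" "x \<in> polys \<Longrightarrow> y \<in> polys \<Longrightarrow> x - y \<in> polys"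
  "x \<in> polys \<Longrightarrow> y \<in> polys \<Longrightarrow> x * y \<in> polys" "x \<in> polys \<Longrightarrow> x ^ n \<in> polys"
  "1 \<in> polys" "0 \<in> polys"
  unfolding polys_def by (simp_all add: ring_gen_closed)

lemma zz5_coord_polys: "j \<in> {2..11} \<Longrightarrow> zz5_coord j \<in> polys"
  by (drule index_2_11, elim insertE emptyE) (simp_all add: zz5_coord_def A_polys polys_closed)

text \<open>The change from edge variables to adapted coordinates is invertible with integer
  coefficients, as \<open>eqs\<close> shows, so both sets generate the same polynomial ring.\<close>

lemma zz5_R10: "ring_gen zz5.S10 = (polys :: 'a::field ratfun set)"
proof
  have "zz5.S10 \<subseteq> (polys :: 'a ratfun set)"
    unfolding zz5.S10_def zz5.S7_def zz5.S5_def by (auto intro: zz5_coord_polys constants_polys)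
  then show "ring_gen zz5.S10 \<subseteq> (polys :: 'a ratfun set)"
    unfolding polys_def by (blast intro: ring_gen_subset)
  have X: "(zz5_coord j :: 'a ratfun) \<in> ring_gen zz5.S10" if "j \<in> {2..11}" for j
    using index_2_11[OF that]
    by (auto simp: zz5.S10_def zz5.S7_def zz5.S5_def intro!: ring_gen.gen)
  have eqs: "A 1 = (zz5_coord 8 :: 'a ratfun)" "A 2 = (zz5_coord 9 :: 'a ratfun)"
    "A 3 = (zz5_coord 10 :: 'a ratfun)" "A 4 = (zz5_coord 5 :: 'a ratfun)" "A 9 = (zz5_coord 6 :: 'a ratfun)"
    "A 7 = (zz5_coord 11 :: 'a ratfun) - zz5_coord 9 - zz5_coord 10" "A 8 = (zz5_coord 2 :: 'a ratfun) - zz5_coord 10 - zz5_coord 5"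
    "A 5 = (zz5_coord 4 :: 'a ratfun) - zz5_coord 5 - zz5_coord 6" "A 6 = (zz5_coord 7 :: 'a ratfun) - zz5_coord 8 - zz5_coord 9"
    "A 10 = (zz5_coord 3 :: 'a ratfun) - zz5_coord 8 - (zz5_coord 11 - zz5_coord 9 - zz5_coord 10) - zz5_coord 6"
    by (simp_all add: zz5_coord_def)
  have "(A i :: 'a ratfun) \<in> ring_gen zz5.S10" if "i \<in> {1..10}" for i
  proof -
    have "i \<in> {1, 2, 3, 4, 5, 6, 7, 8, 9, 10}"
      using that by (simp only: atLeastAtMost_iff insert_iff empty_iff) presburger
    then show ?thesis
      by (elim insertE emptyE) (simp_all only: eqs, (intro ring_gen_diff X; simp)+)
  qed
  moreover have "(constants :: 'a ratfun set) \<subseteq> ring_gen zz5.S10"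
    by (auto simp: zz5.S10_def zz5.S7_def zz5.S5_def intro!: ring_gen.gen)
  ultimately have "(constants \<union> A ` {1..10} :: 'a ratfun set) \<subseteq> ring_gen zz5.S10" by auto
  then show "(polys :: 'a ratfun set) \<subseteq> ring_gen zz5.S10"
    unfolding polys_def by (blast intro: ring_gen_subset)
qed

section \<open>Spanning by duality\<close>

lemma (in vector_space) separating_functional:
  assumes h: "h \<notin> span S"
  shows "\<exists>g. Vector_Spaces.linear scale times g \<and> (\<forall>x\<in>S. g x = 0) \<and> g h = 1"
proof -
  interpret vector_space_pair scale "times :: 'a \<Rightarrow> 'a \<Rightarrow> 'a"
    by unfold_locales (simp_all add: algebra_simps)
  obtain B where B: "B \<subseteq> S" "independent B" "S \<subseteq> span B"
    using maximal_independent_subset .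
  have hB: "h \<notin> span B" using h span_mono[OF B(1)] by blast
  then have "h \<notin> B" using span_base by blast
  obtain g where g: "Vector_Spaces.linear scale times g" "\<And>x. x \<in> insert h B \<Longrightarrow> g x = (if x = h then 1 else 0)"
    using linear_independent_extend[OF independent_insertI[OF hB B(2)], of "\<lambda>x. if x = h then 1 else 0"] by blast
  have "g x = 0" if "x \<in> S" for x
  proof (rule linear_eq_0_on_span[OF g(1)])
    show "x \<in> span B" using that B(3) by blast
    show "g y = 0" if "y \<in> B" for y using g(2)[of y] that \<open>h \<notin> B\<close> by auto
  qed
  then show ?thesis using g by auto
qed

lemma Const_add: "Const (c + d) = Const c + Const d"
  by (simp add: Const_def single_add)

lemma Const_mult: "Const (c * d) = Const c * Const d"
  by (simp add: Const_def mult_single)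

lemma Const_1 [simp]: "Const 1 = 1"
  by (simp add: Const_def)

lemma Const_0 [simp]: "Const 0 = 0"
  by (simp add: Const_def)

lemma Const_minus: "Const (- c) = - Const c"
  by (simp add: Const_def single_uminus)

lemma constants_ring_gen: "k \<in> ring_gen constants \<Longrightarrow> \<exists>c. k = rat (Const c)"
proof (induction rule: ring_gen.induct)
  case (gen x)
  then show ?case by (auto simp: constants_def)
next
  case one
  show ?case by (intro exI[of _ 1]) simp
next
  case (minus x)
  then show ?case by (metis Const_minus rat_minus)
next
  case (add x y)
  then show ?case by (metis Const_add rat_add)
next
  case (mult x y)
  then show ?case by (metis Const_mult rat_mult)
qed

lemma polys_rat: "x \<in> polys \<Longrightarrow> \<exists>F. x = rat F"
  unfolding polys_def
proof (induction rule: ring_gen.induct)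
  case (gen x)
  then show ?case by (auto simp: constants_def)
next
  case one
  show ?case by (intro exI[of _ 1]) simp
next
  case (minus x)
  then show ?case by (metis rat_minus)
next
  case (add x y)
  then show ?case by (metis rat_add)
next
  case (mult x y)
  then show ?case by (metis rat_mult)
qed

text \<open>The counterpart of \<open>f\<close> in the polynomial ring itself, over any commutative
  ring, so that it can be compared with the graph polynomial and split by degree.\<close>

definition zz5_psi :: "'a::comm_ring_1 mpoly" where
  "zz5_psi = (let
     a = Var 3 + Var 4 + Var 8; t = Var 1 + Var 7 + Var 9 + Var 10; c = Var 4 + Var 5 + Var 9;
     v = Var 4; r = Var 9; b = Var 1 + Var 2 + Var 6; z = Var 1; y = Var 2; u = Var 3; D = Var 2 + Var 3 + Var 7;
     sg = b * D - y\<^sup>2; al = b * u\<^sup>2; ep = z\<^sup>2 * D + 2 * z * y * (D - y - u) + b * (D - y - u)\<^sup>2;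
     ze = u\<^sup>2 * z\<^sup>2; ka = u * (b * (D - y - u) + y * z)
   in c * (sg * a * t - ep * a - al * t + ze) - v\<^sup>2 * (sg * t - ep) - 2 * v * r * ka - r\<^sup>2 * (sg * a - al))"

lemma rat_zz5_psi: "rat zz5_psi = zz5.f"
  unfolding zz5_psi_def Let_def zz5.f_def zz5.AA_def zz5.De_def zz5.PP_def zz5.base_defs zz5_coord_def
  by (simp add: rat_add rat_diff rat_mult rat_power)

lemma rderiv_diff: "rderiv i (x - y) = rderiv i x - rderiv i y"
  by (rule derivation.d_diff[OF derivation_rderiv])

lemma rderiv_const_mult: "rderiv i (rat (Const c) * x) = rat (Const c) * rderiv i x"
  by (simp add: derivation.d_mult[OF derivation_rderiv] rderiv_rat)

definition ratfun_scale :: "'a::field \<Rightarrow> 'a ratfun \<Rightarrow> 'a ratfun" where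
  "ratfun_scale c x = rat (Const c) * x"

interpretation ratfun: vector_space "ratfun_scale :: 'a::field \<Rightarrow> 'a ratfun \<Rightarrow> 'a ratfun"
  by unfold_locales
     (simp_all add: ratfun_scale_def Const_add Const_mult rat_add rat_mult algebra_simps)

definition boundaries :: "'a::field ratfun set" where
  "boundaries = {rderiv j (g / zz5.f ^ n) | j g n. j \<in> {1..10} \<and> g \<in> polys} \<union> {1 / zz5.f\<^sup>2}"

text \<open>A function outside the span would be detected by a linear functional killing all
  \<open>boundaries\<close>. Such a functional satisfies \<open>zz5_functional\<close>, since the
  adapted derivations are integer combinations of the partial derivatives, and therefore vanishes on
  the given function.\<close>

lemma complement_spanned:
  fixes g :: "'a::field_char_0 ratfun"
  assumes g: "g \<in> polys"
  shows "g / zz5.f ^ K \<in> ratfun.span boundaries"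
proof (rule ccontr)
  assume "g / zz5.f ^ K \<notin> ratfun.span boundaries"
  then obtain lam :: "'a ratfun \<Rightarrow> 'a" where lam: "Vector_Spaces.linear ratfun_scale times lam"
    and z: "\<And>x. x \<in> boundaries \<Longrightarrow> lam x = 0" and one: "lam (g / zz5.f ^ K) = 1"
    using ratfun.separating_functional by blast
  interpret lam: Vector_Spaces.linear "ratfun_scale :: 'a \<Rightarrow> _" times lam by (fact lam)
  have rd: "lam (rderiv j (p / zz5.f ^ n)) = 0" if "j \<in> {1..10}" "p \<in> polys" for j p n
    using that by (intro z) (auto simp: boundaries_def)
  interpret zz5_functional zz5_deriv "zz5_coord :: nat \<Rightarrow> 'a ratfun" constants lam
  proof
    show "lam (p + q) = lam p + lam q" for p q by (rule lam.add)
  next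
    fix i :: nat and p :: "'a ratfun" and n
    assume i: "i \<in> {2..11}" and p: "p \<in> ring_gen zz5.S10"
    then have p: "p \<in> polys" using zz5_R10 by blast
    show "lam (zz5_deriv i (p / zz5.f ^ n)) = 0"
      using index_2_11[OF i] p
      by (elim insertE emptyE) (simp_all add: zz5_deriv_def lam.add lam.diff rd)
  next
    fix k :: "'a ratfun" assume "k \<in> ring_gen constants"
    then obtain c where "k = rat (Const c)" using constants_ring_gen by blast
    then have "k / zz5.f\<^sup>2 = ratfun_scale c (1 / zz5.f\<^sup>2)" by (simp add: ratfun_scale_def)
    moreover have "lam (1 / zz5.f\<^sup>2) = 0" by (rule z) (simp add: boundaries_def)
    ultimately show "lam (k / zz5.f\<^sup>2) = 0" by (simp add: lam.scale)
  qed
  have "g \<in> ring_gen zz5.S10" using g zz5_R10 by blast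
  then have "lam (g / zz5.f ^ K) = 0" by (rule lam_zero_on_complement)
  then show False using one by simp
qed

lemma complement_decomposition:
  fixes G :: "'a::field_char_0 mpoly"
  assumes "rat G \<in> polys"
  shows "\<exists>n H c. rat G / rat zz5_psi ^ K =
    (\<Sum>i\<in>{1..10}. rderiv i (rat (H i) / rat zz5_psi ^ n)) + rat (Const c) / rat zz5_psi ^ 2"
proof -
  let ?f = "zz5.f :: 'a ratfun"
  have f: "?f \<noteq> 0" by (rule zz5.f_nonzero)
  have P: "?f = rat zz5_psi" by (rule rat_zz5_psi[symmetric])
  have "\<exists>n H c. x = (\<Sum>i\<in>{1..10}. rderiv i (rat (H i) / ?f ^ n)) + rat (Const c) / ?f ^ 2"
    if "x \<in> ratfun.span boundaries" for x
    using that
  proof (induction rule: ratfun.span_induct_alt)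
    case base
    show ?case by (intro exI[of _ 0] exI[of _ "\<lambda>_. 0"]) simp
  next
    case (step k x y)
    then obtain n H c where y: "y = (\<Sum>i\<in>{1..10}. rderiv i (rat (H i) / ?f ^ n)) + rat (Const c) / ?f ^ 2"
      by blast
    from step(1) consider j g m where "x = rderiv j (g / ?f ^ m)" "j \<in> {1..10}" "g \<in> polys" | "x = 1 / ?f\<^sup>2"
      unfolding boundaries_def by blast
    then show ?case
    proof cases
      case 1
      obtain G where G: "g = rat G" using 1 polys_rat by blast
      define H' where "H' i = (if i = j then Const k * G * zz5_psi ^ n else 0) + H i * zz5_psi ^ m" for i
      have "rat (H' i) / ?f ^ (n + m) = (if i = j then rat (Const k) * (rat G / ?f ^ m) else 0) + rat (H i) / ?f ^ n" for i
        using f by (simp add: H'_def rat_add rat_mult rat_power P[symmetric] power_add add_divide_distrib)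
      then have "rderiv i (rat (H' i) / ?f ^ (n + m)) = (if i = j then rat (Const k) * x else 0) + rderiv i (rat (H i) / ?f ^ n)" for i
        by (simp add: rderiv_add rderiv_const_mult 1 G del: times_divide_eq_right)
      then have "(\<Sum>i\<in>{1..10}. rderiv i (rat (H' i) / ?f ^ (n + m))) =
          rat (Const k) * x + (\<Sum>i\<in>{1..10}. rderiv i (rat (H i) / ?f ^ n))"
        using 1(2) by (simp add: sum.distrib)
      then have "ratfun_scale k x + y = (\<Sum>i\<in>{1..10}. rderiv i (rat (H' i) / ?f ^ (n + m))) + rat (Const c) / ?f ^ 2"
        by (simp add: y ratfun_scale_def)
      then show ?thesis by blast
    next
      case 2
      have "ratfun_scale k x + y = (\<Sum>i\<in>{1..10}. rderiv i (rat (H i) / ?f ^ n)) + rat (Const (k + c)) / ?f ^ 2"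
        by (simp add: y 2 ratfun_scale_def Const_add rat_add add_divide_distrib)
      then show ?thesis by blast
    qed
  qed
  then show ?thesis using complement_spanned[OF assms, of K] unfolding P by blast
qed

section \<open>Homogeneous components\<close>

definition mdeg :: "nat \<Rightarrow> (nat \<Rightarrow>\<^sub>0 nat) \<Rightarrow> nat" where
  "mdeg N m = (\<Sum>i\<in>{1..N}. Poly_Mapping.lookup m i)"

definition homogeneous_monomial :: "nat \<Rightarrow> nat \<Rightarrow> (nat \<Rightarrow>\<^sub>0 nat) \<Rightarrow> bool" where
  "homogeneous_monomial N d m \<longleftrightarrow> Poly_Mapping.keys m \<subseteq> {1..N} \<and> mdeg N m = d"

lemma homogeneous_iff: "homogeneous N d F \<longleftrightarrow> (\<forall>m\<in>Poly_Mapping.keys F. homogeneous_monomial N d m)"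
  by (simp add: homogeneous_def homogeneous_monomial_def mdeg_def)

lemma mdeg_add: "mdeg N (m + n) = mdeg N m + mdeg N n"
  by (simp add: mdeg_def lookup_add sum.distrib)

lemma keys_add_nat: "Poly_Mapping.keys (m + n) = Poly_Mapping.keys m \<union> Poly_Mapping.keys (n :: nat \<Rightarrow>\<^sub>0 nat)"
  by (auto simp: in_keys_iff lookup_add)

lemma homogeneous_monomial_add:
  "homogeneous_monomial N e n \<Longrightarrow> homogeneous_monomial N (d + e) (m + n) \<longleftrightarrow> homogeneous_monomial N d m"
  by (auto simp: homogeneous_monomial_def mdeg_add keys_add_nat)

lemma homogeneous_monomial_single: "i \<in> {1..N} \<Longrightarrow> homogeneous_monomial N 1 (Poly_Mapping.single i 1)"
  by (simp add: homogeneous_monomial_def mdeg_def lookup_single when_def)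

text \<open>Besides selecting a degree, this discards every monomial with a variable outside
  \<open>1..N\<close>, so arbitrary numerators become polynomials in the edge variables.\<close>

definition hcomp :: "nat \<Rightarrow> nat \<Rightarrow> 'a::comm_ring_1 mpoly \<Rightarrow> 'a mpoly" where
  "hcomp N d F = (\<Sum>m\<in>Poly_Mapping.keys F.
     if homogeneous_monomial N d m then Poly_Mapping.single m (Poly_Mapping.lookup F m) else 0)"

lemma hcomp_superset:
  assumes "finite M" "Poly_Mapping.keys F \<subseteq> M"
  shows "hcomp N d F = (\<Sum>m\<in>M.
     if homogeneous_monomial N d m then Poly_Mapping.single m (Poly_Mapping.lookup F m) else 0)"
  unfolding hcomp_def
  by (rule sum.mono_neutral_left) (use assms in \<open>auto simp: in_keys_iff\<close>)

lemma lookup_hcomp: "Poly_Mapping.lookup (hcomp N d F) m =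
    (if homogeneous_monomial N d m then Poly_Mapping.lookup F m else 0)"
proof -
  have "hcomp N d F = (\<Sum>m'\<in>insert m (Poly_Mapping.keys F).
     if homogeneous_monomial N d m' then Poly_Mapping.single m' (Poly_Mapping.lookup F m') else 0)"
    by (rule hcomp_superset) auto
  then have "Poly_Mapping.lookup (hcomp N d F) m = (\<Sum>m'\<in>insert m (Poly_Mapping.keys F).
      Poly_Mapping.lookup (if homogeneous_monomial N d m' then Poly_Mapping.single m' (Poly_Mapping.lookup F m') else 0) m)"
    by (simp only: lookup_sum)
  also have "\<dots> = (\<Sum>m'\<in>insert m (Poly_Mapping.keys F).
      if m' = m then (if homogeneous_monomial N d m then Poly_Mapping.lookup F m else 0) else 0)"
    by (rule sum.cong) (auto simp: lookup_single when_def)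
  also have "\<dots> = (if homogeneous_monomial N d m then Poly_Mapping.lookup F m else 0)"
    by (subst sum.delta) simp_all
  finally show ?thesis .
qed

lemma hcomp_add: "hcomp N d (F + G) = hcomp N d F + hcomp N d G"
  and hcomp_diff: "hcomp N d (F - G) = hcomp N d F - hcomp N d G"
  and hcomp_zero [simp]: "hcomp N d 0 = 0"
  and hcomp_single: "hcomp N d (Poly_Mapping.single m c) = (if homogeneous_monomial N d m then Poly_Mapping.single m c else 0)"
  by (rule poly_mapping_eqI, simp add: lookup_hcomp lookup_add lookup_minus lookup_single when_def)+

lemma hcomp_sum: "hcomp N d (sum F S) = (\<Sum>x\<in>S. hcomp N d (F x))"
  by (induction S rule: infinite_finite_induct) (simp_all add: hcomp_add)

lemma homogeneous_iff_hcomp: "homogeneous N d F \<longleftrightarrow> hcomp N d F = F"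
proof
  assume "homogeneous N d F"
  then show "hcomp N d F = F"
    by (intro poly_mapping_eqI) (auto simp: lookup_hcomp homogeneous_iff in_keys_iff)
next
  assume "hcomp N d F = F"
  then have "homogeneous_monomial N d m" if "m \<in> Poly_Mapping.keys F" for m
    using lookup_hcomp[of N d F m] that by (auto simp: in_keys_iff split: if_splits)
  then show "homogeneous N d F" by (simp add: homogeneous_iff)
qed

lemma homogeneous_hcomp: "homogeneous N d (hcomp N d F)"
  unfolding homogeneous_iff_hcomp by (rule poly_mapping_eqI) (simp add: lookup_hcomp)

lemma hcomp_mult_hcomp: "hcomp N (d + e) (F * hcomp N e G) = hcomp N d F * hcomp N e G"
proof (induction F rule: mpoly_induct)
  case zero
  show ?case by simp
next
  case (add F m c)
  have "hcomp N (d + e) (Poly_Mapping.single m c * hcomp N e G) = hcomp N d (Poly_Mapping.single m c) * hcomp N e G"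
  proof (induction G rule: mpoly_induct)
    case zero
    show ?case by simp
  next
    case (add G n c')
    have "hcomp N (d + e) (Poly_Mapping.single m c * hcomp N e (Poly_Mapping.single n c')) =
        hcomp N d (Poly_Mapping.single m c) * hcomp N e (Poly_Mapping.single n c')"
      by (simp add: hcomp_single mult_single homogeneous_monomial_add)
    then show ?case using add by (simp add: hcomp_add distrib_left)
  qed
  then show ?case using add by (simp add: hcomp_add distrib_right)
qed

lemma hcomp_mult: "homogeneous N e G \<Longrightarrow> hcomp N (d + e) (F * G) = hcomp N d F * G"
  using hcomp_mult_hcomp[of N d e F G] by (simp add: homogeneous_iff_hcomp)

lemma hcomp_mpderiv:
  assumes i: "i \<in> {1..N}"
  shows "mpderiv i (hcomp N (Suc d) F) = hcomp N d (mpderiv i F)"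
proof (induction F rule: mpoly_induct)
  case zero
  show ?case by simp
next
  case (add F m c)
  have "mpderiv i (hcomp N (Suc d) (Poly_Mapping.single m c)) = hcomp N d (mpderiv i (Poly_Mapping.single m c))"
  proof (cases "Poly_Mapping.lookup m i = 0")
    case True
    then show ?thesis by (simp add: hcomp_single mpderiv_single)
  next
    case False
    have "m = (m - Poly_Mapping.single i 1) + Poly_Mapping.single i 1"
      using False by (intro poly_mapping_eqI) (auto simp: lookup_add lookup_minus lookup_single when_def)
    then have "homogeneous_monomial N (Suc d) m \<longleftrightarrow> homogeneous_monomial N d (m - Poly_Mapping.single i 1)"
      using homogeneous_monomial_add[OF homogeneous_monomial_single[OF i], of d "m - Poly_Mapping.single i 1"] by simp
    then show ?thesis by (simp add: hcomp_single mpderiv_single)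
  qed
  then show ?case using add by (simp add: hcomp_add mpderiv_add)
qed

lemma homogeneous_add: "homogeneous N d F \<Longrightarrow> homogeneous N d G \<Longrightarrow> homogeneous N d (F + G)"
  and homogeneous_diff: "homogeneous N d F \<Longrightarrow> homogeneous N d G \<Longrightarrow> homogeneous N d (F - G)"
  and homogeneous_zero [simp]: "homogeneous N d 0"
  by (simp_all add: homogeneous_iff_hcomp hcomp_add hcomp_diff)

lemma homogeneous_sum: "(\<And>x. x \<in> S \<Longrightarrow> homogeneous N d (F x)) \<Longrightarrow> homogeneous N d (sum F S)"
  by (simp add: homogeneous_iff_hcomp hcomp_sum)

lemma homogeneous_mult: "homogeneous N d F \<Longrightarrow> homogeneous N e G \<Longrightarrow> homogeneous N (d + e) (F * G)"
  using hcomp_mult[of N e G d F] by (simp add: homogeneous_iff_hcomp)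

lemma homogeneous_Const: "homogeneous N 0 (Const c)"
  by (simp add: homogeneous_iff_hcomp Const_def hcomp_single homogeneous_monomial_def mdeg_def)

lemma homogeneous_Var: "i \<in> {1..N} \<Longrightarrow> homogeneous N 1 (Var i)"
  using homogeneous_monomial_single[of i N] by (simp add: homogeneous_iff_hcomp Var_def hcomp_single)

lemma homogeneous_power: "homogeneous N d F \<Longrightarrow> homogeneous N (n * d) (F ^ n)"
proof (induction n)
  case 0
  show ?case using homogeneous_Const[of N 1] by simp
next
  case (Suc n)
  then show ?case using homogeneous_mult[of N d F "n * d" "F ^ n"] by simp
qed

lemma homogeneous_mpderiv: "i \<in> {1..N} \<Longrightarrow> homogeneous N (Suc d) F \<Longrightarrow> homogeneous N d (mpderiv i F)"
  using hcomp_mpderiv[of i N d F] by (simp add: homogeneous_iff_hcomp)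

lemma homogeneous_degree_unique: "homogeneous N d F \<Longrightarrow> homogeneous N e F \<Longrightarrow> F \<noteq> 0 \<Longrightarrow> d = e"
  unfolding homogeneous_iff homogeneous_monomial_def by (metis keys_eq_empty ex_in_conv)

lemma euler_identity:
  assumes "homogeneous N d F"
  shows "(\<Sum>i\<in>{1..N}. Var i * mpderiv i F) = of_nat d * F"
proof -
  have "(\<Sum>i\<in>{1..N}. Var i * mpderiv i (hcomp N d F)) = of_nat d * hcomp N d F"
  proof (induction F rule: mpoly_induct)
    case zero
    show ?case by simp
  next
    case (add F m c)
    have "(\<Sum>i\<in>{1..N}. Var i * mpderiv i (hcomp N d (Poly_Mapping.single m c))) =
        of_nat d * hcomp N d (Poly_Mapping.single m c)"
    proof (cases "homogeneous_monomial N d m")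
      case True
      have "Var i * mpderiv i (Poly_Mapping.single m c) = of_nat (Poly_Mapping.lookup m i) * Poly_Mapping.single m c" for i
      proof (cases "Poly_Mapping.lookup m i = 0")
        case False
        have "m = Poly_Mapping.single i 1 + (m - Poly_Mapping.single i 1)"
          using False by (intro poly_mapping_eqI) (auto simp: lookup_add lookup_minus lookup_single when_def)
        then have "Var i * mpderiv i (Poly_Mapping.single m c) =
            Poly_Mapping.single m (of_nat (Poly_Mapping.lookup m i) * c)"
          by (simp add: Var_def mpderiv_single mult_single)
        also have "\<dots> = of_nat (Poly_Mapping.lookup m i) * Poly_Mapping.single m c"
        proof -
          have "Poly_Mapping.single m (of_nat k * c) = of_nat k * Poly_Mapping.single m c" for k
            by (induction k) (simp_all add: single_add distrib_right)
          then show ?thesis .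
        qed
        finally show ?thesis .
      qed (simp add: mpderiv_single)
      then have "(\<Sum>i\<in>{1..N}. Var i * mpderiv i (Poly_Mapping.single m c)) = of_nat (mdeg N m) * Poly_Mapping.single m c"
        by (simp add: mdeg_def sum_distrib_right)
      then show ?thesis using True by (simp add: hcomp_single homogeneous_monomial_def)
    qed (simp add: hcomp_single)
    then show ?case using add by (simp add: hcomp_add mpderiv_add distrib_left sum.distrib)
  qed
  then show ?thesis using assms by (simp add: homogeneous_iff_hcomp)
qed

lemma sum_in_polys: "(\<And>x. x \<in> S \<Longrightarrow> F x \<in> polys) \<Longrightarrow> sum F S \<in> polys"
  by (induction S rule: infinite_finite_induct) (simp_all add: polys_closed)

lemma homogeneous_polys:
  assumes "homogeneous 10 d F"
  shows "rat F \<in> polys"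
proof -
  have single: "rat (Poly_Mapping.single m c) \<in> polys" if "homogeneous_monomial 10 e m" for m c e
    using that
  proof (induction e arbitrary: m)
    case 0
    then have "m = 0" 
      by (intro poly_mapping_eqI) (auto simp: homogeneous_monomial_def mdeg_def in_keys_iff)
    then show ?case by (auto simp: Const_def[symmetric] constants_def intro: constants_polys)
  next
    case (Suc e)
    then have "mdeg 10 m \<noteq> 0" by (simp add: homogeneous_monomial_def)
    then obtain i where i: "i \<in> {1..10}" "Poly_Mapping.lookup m i \<noteq> 0"
      unfolding mdeg_def by (metis sum.neutral)
    have m: "m = (m - Poly_Mapping.single i 1) + Poly_Mapping.single i 1"
      using i by (intro poly_mapping_eqI) (auto simp: lookup_add lookup_minus lookup_single when_def)
    have "homogeneous_monomial 10 e (m - Poly_Mapping.single i 1)"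
      using homogeneous_monomial_add[OF homogeneous_monomial_single[OF i(1)], of e "m - Poly_Mapping.single i 1"]
        Suc.prems m by simp
    then have "rat (Poly_Mapping.single (m - Poly_Mapping.single i 1) c) * A i \<in> polys"
      by (intro polys_closed Suc.IH A_polys i)
    moreover have "Poly_Mapping.single m c = Poly_Mapping.single (m - Poly_Mapping.single i 1) c * Var i"
      using m by (simp add: Var_def mult_single)
    ultimately show ?case by (simp only: rat_mult)
  qed
  have "rat (hcomp 10 d F) \<in> polys"
    unfolding hcomp_def rat_sum
    by (rule sum_in_polys) (auto intro: single polys_closed)
  then show ?thesis using assms by (simp add: homogeneous_iff_hcomp)
qed

lemma homogeneous_zz5_psi: "homogeneous 10 5 zz5_psi"
proof -
  let ?h = "homogeneous 10"
  have V: "?h 1 (Var i)" if "i \<in> {1..10}" for i by (rule homogeneous_Var[OF that])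
  define a t c v r b z y u D where "a = Var 3 + Var 4 + (Var 8 :: 'a mpoly)"
    and "t = Var 1 + Var 7 + Var 9 + (Var 10 :: 'a mpoly)" and "c = Var 4 + Var 5 + (Var 9 :: 'a mpoly)"
    and "v = (Var 4 :: 'a mpoly)" and "r = (Var 9 :: 'a mpoly)" and "b = Var 1 + Var 2 + (Var 6 :: 'a mpoly)"
    and "z = (Var 1 :: 'a mpoly)" and "y = (Var 2 :: 'a mpoly)" and "u = (Var 3 :: 'a mpoly)"
    and "D = Var 2 + Var 3 + (Var 7 :: 'a mpoly)"
  note defs = a_def t_def c_def v_def r_def b_def z_def y_def u_def D_def
  have 1: "?h 1 a" "?h 1 t" "?h 1 c" "?h 1 v" "?h 1 r" "?h 1 b" "?h 1 z" "?h 1 y" "?h 1 u" "?h 1 D"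
    unfolding defs by (intro homogeneous_add V; simp)+
  have mult: "?h k (F * G)" if "?h d F" "?h e G" "k = d + e" for k d e and F G :: "'a mpoly"
    using homogeneous_mult that by blast
  have sq: "?h 2 (F\<^sup>2)" if "?h 1 F" for F :: "'a mpoly"
    using homogeneous_power[OF that, of 2] by simp
  have two: "?h 0 (2 :: 'a mpoly)"
    using homogeneous_Const[of 10 "1 :: 'a"] homogeneous_add[of 10 0 "1 :: 'a mpoly" 1] by simp
  define p where "p = D - y - u"
  have p: "?h 1 p" unfolding p_def by (intro homogeneous_diff 1)
  define sg where "sg = b * D - y\<^sup>2"
  have sg: "?h 2 sg" unfolding sg_def by (intro homogeneous_diff mult[OF 1(6) 1(10)] sq 1) simp
  define al where "al = b * u\<^sup>2"
  have al: "?h 3 al" unfolding al_def by (rule mult[OF 1(6) sq[OF 1(9)]]) simp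
  define ep where "ep = z\<^sup>2 * D + 2 * z * y * p + b * p\<^sup>2"
  have ep: "?h 3 ep" unfolding ep_def
    by (intro homogeneous_add mult[OF sq[OF 1(7)] 1(10)] mult[OF mult[OF mult[OF two 1(7) refl] 1(8) refl] p]
        mult[OF 1(6) sq[OF p]]) simp_all
  define ze where "ze = u\<^sup>2 * z\<^sup>2"
  have ze: "?h 4 ze" unfolding ze_def by (rule mult[OF sq[OF 1(9)] sq[OF 1(7)]]) simp
  define ka where "ka = u * (b * p + y * z)"
  have "?h 2 (b * p + y * z)" by (intro homogeneous_add mult[OF 1(6) p] mult[OF 1(8) 1(7)]) simp_all
  then have ka: "?h 3 ka" unfolding ka_def by (rule mult[OF 1(9)]) simp
  have AA: "?h 4 (sg * a * t - ep * a - al * t + ze)"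
    by (intro homogeneous_add homogeneous_diff mult[OF mult[OF sg 1(1) refl] 1(2)] mult[OF ep 1(1)]
        mult[OF al 1(2)] ze) simp_all
  have De: "?h 3 (sg * t - ep)" by (intro homogeneous_diff mult[OF sg 1(2)] ep) simp_all
  have PP: "?h 3 (sg * a - al)" by (intro homogeneous_diff mult[OF sg 1(1)] al) simp_all
  have "?h 5 (c * (sg * a * t - ep * a - al * t + ze) - v\<^sup>2 * (sg * t - ep) - 2 * v * r * ka - r\<^sup>2 * (sg * a - al))"
    by (intro homogeneous_diff mult[OF 1(3) AA] mult[OF sq[OF 1(4)] De]
        mult[OF mult[OF mult[OF two 1(4) refl] 1(5) refl] ka] mult[OF sq[OF 1(5)] PP]) simp_all
  also have "(c * (sg * a * t - ep * a - al * t + ze) - v\<^sup>2 * (sg * t - ep) - 2 * v * r * ka - r\<^sup>2 * (sg * a - al)) = zz5_psi"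
    unfolding zz5_psi_def Let_def sg_def al_def ep_def ze_def ka_def p_def defs ..
  finally show ?thesis .
qed

lemma zz5_psi_nonzero: "(zz5_psi :: 'a::field mpoly) \<noteq> 0"
  using rat_zz5_psi[where 'a='a] zz5.f_nonzero[where 'a='a] by auto

lemma rderiv_divide_power:
  assumes "P \<noteq> 0"
  shows "rderiv i (rat F / rat P ^ n) =
    rat (P * mpderiv i F - of_nat n * (F * mpderiv i P)) / rat P ^ Suc n"
proof -
  have P: "rat P \<noteq> 0" using assms rat_eq_iff[of P 0] by simp
  have nat: "rat (of_nat n) = of_nat n" by (induction n) (simp_all add: rat_add)
  show ?thesis
    using P by (simp add: derivation.d_divide_power[OF derivation_rderiv P] rderiv_rat rat_diff rat_mult nat
        diff_divide_distrib)
qed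

text \<open>Clearing denominators, so that homogeneous components can be taken in the polynomial ring.\<close>

lemma decomposition_iff:
  assumes P: "P \<noteq> (0 :: 'a::field mpoly)"
  shows "rat G / rat P ^ K = (\<Sum>i\<in>S. rderiv i (rat (H i) / rat P ^ n)) + rat c / rat P ^ 2 \<longleftrightarrow>
    G * P ^ (n + 3) = (\<Sum>i\<in>S. P * mpderiv i (H i) - of_nat n * (H i * mpderiv i P)) * P ^ (K + 2) + c * P ^ (n + 1 + K)"
    (is "?l = ?r \<longleftrightarrow> ?L = ?R")
proof -
  have P0: "rat P \<noteq> 0" using P rat_eq_iff[of P 0] by simp
  define x where "x = (\<Sum>i\<in>S. P * mpderiv i (H i) - of_nat n * (H i * mpderiv i P))"
  have r: "?r = rat x / rat P ^ Suc n + rat c / rat P ^ 2"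
    by (simp add: rderiv_divide_power[OF P] x_def rat_sum sum_divide_distrib)
  have L: "rat ?L = ?l * rat P ^ (n + K + 3)"
    using P0 by (simp add: rat_mult rat_power power_add)
  have R: "rat ?R = ?r * rat P ^ (n + K + 3)"
  proof -
    have "n + K + 3 = Suc n + (K + 2)" "n + K + 3 = 2 + (n + 1 + K)" by simp_all
    then have e: "rat P ^ (n + K + 3) = rat P ^ Suc n * rat P ^ (K + 2)"
      "rat P ^ (n + K + 3) = rat P ^ 2 * rat P ^ (n + 1 + K)"
      by (metis power_add)+
    have "rat x / rat P ^ Suc n * rat P ^ (n + K + 3) = rat x * rat P ^ (K + 2)"
      unfolding e(1) using power_not_zero[OF P0, of "Suc n"] by (simp del: power_Suc)
    moreover have "rat c / rat P ^ 2 * rat P ^ (n + K + 3) = rat c * rat P ^ (n + 1 + K)"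
      unfolding e(2) using power_not_zero[OF P0, of 2] by (simp del: power_Suc)
    ultimately have "?r * rat P ^ (n + K + 3) = rat x * rat P ^ (K + 2) + rat c * rat P ^ (n + 1 + K)"
      unfolding r distrib_right by (simp only:)
    then show ?thesis by (simp add: x_def[symmetric] rat_add rat_mult rat_power)
  qed
  have "?L = ?R \<longleftrightarrow> rat ?L = rat ?R" by simp
  also have "\<dots> \<longleftrightarrow> ?l = ?r" unfolding L R using power_not_zero[OF P0] by (simp only: mult_cancel_right simp_thms)
  finally show ?thesis ..
qed

text \<open>After clearing denominators, the terms with \<open>G\<close> and \<open>c\<close> are
  homogeneous of the same degree \<open>e\<close>. Taking that component leaves them intact and cuts
  each \<open>H i\<close> down to one degree, because differentiation and multiplication by powers
  of the polynomial respect the grading.\<close>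

lemma homogeneous_decomposition:
  fixes G :: "'a::field_char_0 mpoly"
  assumes G: "homogeneous 10 d G" and d: "d + 10 = 5 * K"
  shows "\<exists>m H c. (\<forall>i. homogeneous 10 (5 * m + 1) (H i)) \<and>
    rat G / rat zz5_psi ^ K =
    (\<Sum>i\<in>{1..10}. rderiv i (rat (H i) / rat zz5_psi ^ (m + 2))) + rat (Const c) / rat zz5_psi ^ 2"
proof -
  let ?P = "zz5_psi :: 'a mpoly"
  have P: "?P \<noteq> 0" by (rule zz5_psi_nonzero)
  have P0: "rat ?P \<noteq> 0" using P rat_eq_iff[of ?P 0] by simp
  have hP: "homogeneous 10 5 ?P" by (rule homogeneous_zz5_psi)
  obtain m H0 c where dec: "rat G / rat ?P ^ K =
    (\<Sum>i\<in>{1..10}. rderiv i (rat (H0 i) / rat ?P ^ m)) + rat (Const c) / rat ?P ^ 2"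
    using complement_decomposition[OF homogeneous_polys[OF G], of K] by blast
  define n where "n = m + 2"
  \<comment> \<open>Coefficients of degree -9 over \<open>P ^ n\<close> need numerators of degree
    \<open>5 n - 9\<close>. Two extra powers of \<open>P\<close> make this the natural number
    \<open>5 m + 1\<close>.\<close>
  define H1 where "H1 i = H0 i * ?P\<^sup>2" for i
  have "rat (H0 i) / rat ?P ^ m = rat (H1 i) / rat ?P ^ n" for i
    using P0 by (simp add: n_def H1_def rat_mult rat_power power_add power2_eq_square)
  then have dec1: "G * ?P ^ (n + 3) = (\<Sum>i\<in>{1..10}. ?P * mpderiv i (H1 i) - of_nat n * (H1 i * mpderiv i ?P)) * ?P ^ (K + 2)
     + Const c * ?P ^ (n + 1 + K)"
    using dec by (simp only: decomposition_iff[OF P])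
  define H where "H i = hcomp 10 (5 * m + 1) (H1 i)" for i
  define e where "e = 5 * m + 15 + 5 * K"
  have powers: "homogeneous 10 (5 * k) (?P ^ k)" for k
    using homogeneous_power[OF hP, of k] by (simp add: mult.commute)
  have "homogeneous 10 e (G * ?P ^ (n + 3))"
  proof -
    have "d + 5 * (n + 3) = e" using d by (simp add: e_def n_def)
    then show ?thesis using homogeneous_mult[OF G powers[of "n + 3"]] by simp
  qed
  then have 1: "hcomp 10 e (G * ?P ^ (n + 3)) = G * ?P ^ (n + 3)" by (simp add: homogeneous_iff_hcomp)
  have "homogeneous 10 e (Const c * ?P ^ (n + 1 + K))"
  proof -
    have "0 + 5 * (n + 1 + K) = e" by (simp add: e_def n_def)
    then show ?thesis using homogeneous_mult[OF homogeneous_Const powers[of "n + 1 + K"], of c] by simp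
  qed
  then have 2: "hcomp 10 e (Const c * ?P ^ (n + 1 + K)) = Const c * ?P ^ (n + 1 + K)"
    by (simp add: homogeneous_iff_hcomp)
  have comp: "hcomp 10 (5 * m + 5) (?P * mpderiv i (H1 i) - of_nat n * (H1 i * mpderiv i ?P)) =
     ?P * mpderiv i (H i) - of_nat n * (H i * mpderiv i ?P)" if i: "i \<in> {1..10}" for i
  proof -
    have "hcomp 10 (5 * m + 5) (mpderiv i (H1 i) * ?P) = mpderiv i (H i) * ?P"
      using hcomp_mult[OF hP, of "5 * m" "mpderiv i (H1 i)"] hcomp_mpderiv[OF i, of "5 * m" "H1 i"]
      by (simp add: H_def)
    moreover have "homogeneous 10 4 (mpderiv i ?P)"
      using homogeneous_mpderiv[OF i, of 4] hP by simp
    from hcomp_mult[OF this, of "5 * m + 1" "H1 i"]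
    have "hcomp 10 (5 * m + 5) (H1 i * mpderiv i ?P) = H i * mpderiv i ?P"
      by (simp add: H_def add.commute)
    moreover have "hcomp 10 (5 * m + 5) (of_nat k * F) = of_nat k * hcomp 10 (5 * m + 5) F" for k and F :: "'a mpoly"
      by (induction k) (simp_all add: hcomp_add distrib_right)
    ultimately show ?thesis by (simp add: hcomp_diff mult.commute[of ?P])
  qed
  have "hcomp 10 e ((\<Sum>i\<in>{1..10}. ?P * mpderiv i (H1 i) - of_nat n * (H1 i * mpderiv i ?P)) * ?P ^ (K + 2)) =
     (\<Sum>i\<in>{1..10}. ?P * mpderiv i (H i) - of_nat n * (H i * mpderiv i ?P)) * ?P ^ (K + 2)"
  proof -
    have e: "e = (5 * m + 5) + 5 * (K + 2)" by (simp add: e_def)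
    show ?thesis unfolding e hcomp_mult[OF powers] hcomp_sum
      by (intro arg_cong2[of _ _ _ _ times] sum.cong refl comp)
  qed
  then have "G * ?P ^ (n + 3) = (\<Sum>i\<in>{1..10}. ?P * mpderiv i (H i) - of_nat n * (H i * mpderiv i ?P)) * ?P ^ (K + 2)
     + Const c * ?P ^ (n + 1 + K)"
    using arg_cong[OF dec1, of "hcomp 10 e"] by (simp only: hcomp_add 1 2)
  then have "rat G / rat ?P ^ K = (\<Sum>i\<in>{1..10}. rderiv i (rat (H i) / rat ?P ^ n)) + rat (Const c) / rat ?P ^ 2"
    by (simp only: decomposition_iff[OF P])
  moreover have "homogeneous 10 (5 * m + 1) (H i)" for i unfolding H_def by (rule homogeneous_hcomp)
  ultimately show ?thesis unfolding n_def by blast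
qed

section \<open>Top-degree forms\<close>

lemma pos_sign_swap:
  assumes "finite I" "i \<noteq> j" "i \<notin> I" "j \<notin> I"
  shows "pos_sign j I * pos_sign i (insert j I) = - (pos_sign i I * pos_sign j (insert i I))"
proof -
  have *: "pos_sign j I * pos_sign i (insert j I) = - (pos_sign i I * pos_sign j (insert i I) :: 'a::field ratfun)"
    if "i < j" "finite I" "i \<notin> I" for i j
  proof -
    have "{x \<in> insert j I. x < i} = {x \<in> I. x < i}" "{x \<in> insert i I. x < j} = insert i {x \<in> I. x < j}"
      using that by auto
    then show ?thesis using that by (simp add: pos_sign_def)
  qed
  consider "i < j" | "j < i" using assms(2) by linarith
  then show ?thesis
  proof cases
    case 2
    then show ?thesis using *[OF 2] assms by simp
  qed (use * assms in blast)
qed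

text \<open>Contracting twice with one vector field gives 0 because the double sum is antisymmetric
  in the two contracted indices.\<close>

lemma euler_contraction_square:
  fixes \<beta> :: "'a::field_char_0 form"
  shows "euler_contraction N (euler_contraction N \<beta>) = (\<lambda>_. 0)"
proof
  fix I
  show "euler_contraction N (euler_contraction N \<beta>) I = 0"
  proof (cases "I \<subseteq> {1..N}")
    case True
    then have fin: "finite I" by (rule finite_subset) simp
    let ?J = "{1..N} - I"
    define X where "X j i = (if i = j then 0 else
      pos_sign j I * A j * (pos_sign i (insert j I) * A i * \<beta> (insert i (insert j I))))" for i j
    have swap: "X j i = - X i j" if "i \<in> ?J" "j \<in> ?J" for i j
    proof (cases "i = j")
      case False
      have "X j i = (pos_sign j I * pos_sign i (insert j I)) * (A j * A i * \<beta> (insert i (insert j I)))"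
        using False by (simp add: X_def mult_ac)
      also have "\<dots> = - (pos_sign i I * pos_sign j (insert i I)) * (A j * A i * \<beta> (insert i (insert j I)))"
        using pos_sign_swap[OF fin False, where 'a='a] that by (simp only: Diff_iff simp_thms)
      also have "insert i (insert j I) = insert j (insert i I)" by auto
      finally show ?thesis using False by (simp add: X_def mult_ac)
    qed (simp add: X_def)
    have expand: "euler_contraction N (euler_contraction N \<beta>) I = (\<Sum>j\<in>?J. \<Sum>i\<in>?J. X j i)"
    proof -
      have "pos_sign j I * Fract (Var j) 1 * euler_contraction N \<beta> (insert j I) = (\<Sum>i\<in>?J. X j i)"
        if j: "j \<in> ?J" for j
      proof -
        have "insert j I \<subseteq> {1..N}" "{1..N} - insert j I = ?J - {j}" using j True by auto
        then have "euler_contraction N \<beta> (insert j I) =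
          (\<Sum>i\<in>?J - {j}. pos_sign i (insert j I) * A i * \<beta> (insert i (insert j I)))"
          by (simp only: euler_contraction_def rat_def if_True)
        moreover have "(\<Sum>i\<in>?J. X j i) = (\<Sum>i\<in>?J - {j}. X j i)"
            using j sum.remove[of ?J j "X j"] by (simp add: X_def[of j j])
        moreover have "(\<Sum>i\<in>?J - {j}. X j i) = (\<Sum>i\<in>?J - {j}. pos_sign j I * A j * (pos_sign i (insert j I) * A i * \<beta> (insert i (insert j I))))"
          by (rule sum.cong) (auto simp: X_def)
        ultimately show ?thesis by (simp only: sum_distrib_left rat_def)
      qed
      then show ?thesis using True
        by (simp only: euler_contraction_def[of N "euler_contraction N \<beta>"] if_True cong: sum.cong)
    qed
    have anti: "(\<Sum>j\<in>?J. \<Sum>i\<in>?J. X j i) = - (\<Sum>j\<in>?J. \<Sum>i\<in>?J. X j i)"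
    proof -
      have "(\<Sum>j\<in>?J. \<Sum>i\<in>?J. X j i) = (\<Sum>j\<in>?J. \<Sum>i\<in>?J. - X i j)"
        by (intro sum.cong refl swap)
      also have "\<dots> = - (\<Sum>j\<in>?J. \<Sum>i\<in>?J. X i j)" by (simp add: sum_negf)
      also have "(\<Sum>j\<in>?J. \<Sum>i\<in>?J. X i j) = (\<Sum>j\<in>?J. \<Sum>i\<in>?J. X j i)" by (rule sum.swap)
      finally show ?thesis .
    qed
    \<comment> \<open>Characteristic 0 is used through the constants: 2 is an invertible constant of
      the rational function field.\<close>
    have half: "x = 0" if "x = - x" for x :: "'a ratfun"
    proof -
      have "rat (Const 2) * x = x + x" using Const_add[of "1::'a" 1] by (simp add: rat_add distrib_right)
      also have "\<dots> = x + - x" by (rule arg_cong[OF that])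
      finally have "rat (Const 2) * x = 0" by simp
      moreover have "rat (Const (inverse 2)) * rat (Const 2) = (1 :: 'a ratfun)"
        by (simp flip: rat_mult Const_mult)
      ultimately show ?thesis by (metis mult_eq_0_iff zero_neq_one)
    qed
    show ?thesis unfolding expand by (rule half[OF anti])
  qed (simp add: euler_contraction_def)
qed

section \<open>Multiples of Omega as the forms of top degree\<close>

abbreviation omit :: "nat \<Rightarrow> nat \<Rightarrow> nat set" where "omit N i \<equiv> {1..N} - {i}"

lemma omit_eq_iff: "i \<in> {1..N} \<Longrightarrow> j \<in> {1..N} \<Longrightarrow> omit N i = omit N j \<longleftrightarrow> i = j"
  by blast

lemma Omega_omit: "i \<in> {1..N} \<Longrightarrow> Omega N (omit N i) = (-1) ^ i * A i"
proof -
  assume i: "i \<in> {1..N}"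
  have "Omega N (omit N i) = (\<Sum>j\<in>{1..N}. if j = i then (-1) ^ i * A i else 0)"
    unfolding Omega_def rat_def by (rule sum.cong) (use i omit_eq_iff in auto)
  then show ?thesis using i by simp
qed

lemma Omega_other: "(\<And>i. i \<in> {1..N} \<Longrightarrow> I \<noteq> omit N i) \<Longrightarrow> Omega N I = 0"
  unfolding Omega_def by (rule sum.neutral) auto

lemma card_omit: "i \<in> {1..N} \<Longrightarrow> card (omit N i) = N - 1"
  by simp

lemma card_eq_omit:
  assumes "I \<subseteq> {1..N}" "card I = N - 1" "0 < N"
  shows "\<exists>i\<in>{1..N}. I = omit N i"
proof -
  have "card ({1..N} - I) = 1" using assms by (simp add: card_Diff_subset finite_subset)
  then obtain i where "{1..N} - I = {i}" by (metis card_1_singletonE)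
  then have "i \<in> {1..N}" "I = omit N i" using assms(1) by auto
  then show ?thesis by blast
qed

lemma pos_sign_omit: "i \<in> {1..N} \<Longrightarrow> pos_sign i (omit N i) = (- 1) ^ (i - 1)"
proof -
  assume "i \<in> {1..N}"
  then have "{x \<in> omit N i. x < i} = {1..<i}" by auto
  then show ?thesis by (simp add: pos_sign_def)
qed

lemma pos_sign_omit2:
  assumes "i \<in> {1..N}" "j \<in> {1..N}" "i \<noteq> j"
  shows "pos_sign j (omit N i) * pos_sign i ({1..N} - {i, j}) = (- ((- 1) ^ (i + j)) :: 'a::field ratfun)"
proof -
  have s: "{x \<in> omit N i. x < j} = {1..<j} - {i}" "{x \<in> {1..N} - {i, j}. x < i} = {1..<i} - {j}"
    using assms by auto
  have "card ({1..<j} - {i}) + card ({1..<i} - {j}) + 3 = i + j"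
    using assms by (cases "i < j") (auto simp: card_Diff_singleton_if)
  then have "i + j = Suc (card ({1..<j} - {i}) + card ({1..<i} - {j})) + 2" by simp
  then have "(- 1) ^ (i + j) = - ((- 1 :: 'a ratfun) ^ (card ({1..<j} - {i}) + card ({1..<i} - {j})))"
    by (simp only: power_add power_Suc) simp
  then show ?thesis unfolding pos_sign_def s by (simp add: power_add)
qed

definition vol :: "nat \<Rightarrow> 'a::field ratfun \<Rightarrow> 'a form" where "vol N h = (\<lambda>I. h * Omega N I)"

text \<open>The sign comes from \<open>(-1)^i\<close> in \<open>Omega\<close> against
  \<open>(-1)^(i-1)\<close> in the contraction of the volume form. As a contraction,
  \<open>vol N h\<close> is itself killed by the Euler field.\<close>

lemma vol_contraction:
  "vol N h = euler_contraction N (\<lambda>I. if I = {1..N} then - h else 0)"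
proof
  fix I
  show "vol N h I = euler_contraction N (\<lambda>I. if I = {1..N} then - h else 0) I"
  proof (cases "\<exists>i\<in>{1..N}. I = omit N i")
    case True
    then obtain i where i: "i \<in> {1..N}" "I = omit N i" by blast
    have "{1..N} - omit N i = {i}" "insert i (omit N i) = {1..N}" using i(1) by auto
    then have "euler_contraction N (\<lambda>I. if I = {1..N} then - h else 0) I = (- 1) ^ (i - 1) * A i * (- h)"
      unfolding i(2) euler_contraction_def using pos_sign_omit[OF i(1), where 'a='a] by (simp add: rat_def)
    also have "\<dots> = (- 1) ^ i * A i * h" using i(1) by (cases i) simp_all
    finally show ?thesis using Omega_omit[OF i(1), where 'a='a] by (simp add: vol_def i(2) mult_ac)
  next
    case False
    have "insert j I \<noteq> {1..N}" if "I \<subseteq> {1..N}" "j \<in> {1..N} - I" for j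
    proof
      assume "insert j I = {1..N}"
      then have "I = omit N j" using that by auto
      then show False using False that by blast
    qed
    then have "euler_contraction N (\<lambda>I. if I = {1..N} then - h else 0) I = 0"
      unfolding euler_contraction_def by (auto intro!: sum.neutral)
    moreover have "Omega N I = (0 :: 'a ratfun)" using False by (intro Omega_other) blast
    ultimately show ?thesis by (simp add: vol_def)
  qed
qed

lemma vol_regular:
  fixes G :: "'a::field_char_0 mpoly"
  assumes G: "homogeneous 10 d G" and P: "homogeneous 10 (d + 10) (P ^ k)" "P \<noteq> 0"
  shows "vol 10 (rat G / rat P ^ k) \<in> regular_forms 10 P 9"
proof -
  let ?h = "rat G / rat P ^ k"
  have "vol 10 ?h I = 0" if I: "\<not> (I \<subseteq> {1..10} \<and> card I = 9)" for I
  proof -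
    have "I \<noteq> omit 10 i" if i: "i \<in> {1..10}" for i
      using I card_omit[OF i] by auto
    then show ?thesis using Omega_other[of 10 I, where 'a='a] by (simp add: vol_def)
  qed
  moreover have "\<exists>F k d. homogeneous 10 d F \<and> homogeneous 10 (d + 9) (P ^ k) \<and> vol 10 ?h I = Fract F (P ^ k)"
    if "I \<subseteq> {1..10}" "card I = 9" for I
  proof -
    have "\<exists>i\<in>{1..10}. I = omit 10 i" by (rule card_eq_omit) (use that in simp_all)
    then obtain i where i: "i \<in> {1..10}" "I = omit 10 i" by blast
    let ?F = "Const ((- 1) ^ i) * (Var i * G)"
    have c: "rat (Const ((- 1) ^ i)) = ((- 1) ^ i :: 'a ratfun)"
      by (induction i) (simp_all add: Const_mult rat_mult Const_minus rat_minus)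
    have "homogeneous 10 (0 + (1 + d)) ?F"
      by (intro homogeneous_mult homogeneous_Const homogeneous_Var i G)
    moreover have "homogeneous 10 (0 + (1 + d) + 9) (P ^ k)" using P(1) by (simp add: add.commute)
    moreover have "vol 10 ?h I = Fract ?F (P ^ k)"
      using P(2) Omega_omit[OF i(1), where 'a='a] by (simp add: vol_def i(2) Fract_rat rat_mult rat_power c mult_ac)
    ultimately show ?thesis by blast
  qed
  moreover have "euler_contraction 10 (vol 10 ?h) = (\<lambda>_. 0)"
    unfolding vol_contraction by (rule euler_contraction_square)
  ultimately show ?thesis unfolding regular_forms_def by blast
qed

text \<open>The hypothesis is Euler's identity for a function of degree \<open>- N\<close>, the
  degree that balances the form \<open>Omega\<close> of degree \<open>N\<close>.\<close>

lemma vol_closed: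
  assumes "(\<Sum>j\<in>{1..N}. A j * rderiv j h) = - (of_nat N * h)"
  shows "ext_deriv N (vol N h) = (\<lambda>_. 0)"
proof
  fix J
  show "ext_deriv N (vol N h) J = 0"
  proof (cases "J = {1..N}")
    case True
    have "pos_sign j J * rderiv j (vol N h (J - {j})) = - (h + A j * rderiv j h)" if j: "j \<in> {1..N}" for j
    proof -
      have "{x \<in> {1..N}. x < j} = {1..<j}" using j by auto
      then have "pos_sign j J = (- 1 :: 'a ratfun) ^ (j - 1)" by (simp add: pos_sign_def True)
      moreover have "vol N h (J - {j}) = (- 1) ^ j * (A j * h)"
        unfolding True vol_def Omega_omit[OF j] by (simp add: mult_ac)
      moreover have "rderiv j ((- 1) ^ j * (A j * h)) = (- 1) ^ j * (h + A j * rderiv j h)"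
      proof -
        have neg: "rderiv j ((- 1) ^ j * x) = (- 1) ^ j * rderiv j x" for x :: "'a ratfun"
          by (cases "even j") (simp_all add: derivation.d_minus[OF derivation_rderiv])
        show ?thesis unfolding neg by (simp add: derivation.d_mult[OF derivation_rderiv] rderiv_A add.commute)
      qed
      moreover have "(- 1 :: 'a ratfun) ^ (j - 1) * (- 1) ^ j = - 1"
        using j by (cases j) (simp_all flip: power_add add: mult_2[symmetric])
      ultimately show ?thesis by (simp flip: mult.assoc)
    qed
    then have "ext_deriv N (vol N h) J = (\<Sum>j\<in>{1..N}. - (h + A j * rderiv j h))"
      unfolding ext_deriv_def True by simp
    also have "\<dots> = - (of_nat N * h + (\<Sum>j\<in>{1..N}. A j * rderiv j h))"
      by (simp only: sum_negf sum.distrib sum_constant) simp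
    also have "\<dots> = 0" unfolding assms by simp
    finally show ?thesis .
  next
    case False
    have "vol N h (J - {j}) = 0" if "J \<subseteq> {1..N}" "j \<in> J" for j
    proof -
      have "J - {j} \<noteq> omit N i" if i: "i \<in> {1..N}" for i
      proof
        assume e: "J - {j} = omit N i"
        then have "i = j" using \<open>j \<in> J\<close> \<open>J \<subseteq> {1..N}\<close> by blast
        then show False using e False \<open>j \<in> J\<close> \<open>J \<subseteq> {1..N}\<close> i by auto
      qed
      then show ?thesis using Omega_other[of N "J - {j}", where 'a='a] by (simp add: vol_def)
    qed
    then show ?thesis by (simp add: ext_deriv_def)
  qed
qed

lemma rat_sign: "rat (Const ((- 1) ^ n)) = (- 1) ^ n"
  by (induction n) (simp_all add: Const_mult rat_mult Const_minus rat_minus)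

lemma euler_identity_fraction:
  assumes "homogeneous N d F" "homogeneous N e P" "P \<noteq> (0 :: 'a::field mpoly)"
  shows "(\<Sum>j\<in>{1..N}. A j * rderiv j (rat F / rat P ^ n)) =
    (of_nat d - of_nat (n * e)) * (rat F / rat P ^ n)"
proof -
  have P0: "rat P \<noteq> 0" using assms(3) rat_eq_iff[of P 0] by simp
  have nat: "rat (of_nat m) = of_nat m" for m by (induction m) (simp_all add: rat_add)
  have "(\<Sum>j\<in>{1..N}. A j * rderiv j (rat F / rat P ^ n)) =
    rat (\<Sum>j\<in>{1..N}. Var j * (P * mpderiv j F - of_nat n * (F * mpderiv j P))) / rat P ^ Suc n"
    unfolding rderiv_divide_power[OF assms(3)] rat_sum sum_divide_distrib rat_mult[of "Var _"]
    by (simp only: times_divide_eq_right)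
  also have "(\<Sum>j\<in>{1..N}. Var j * (P * mpderiv j F - of_nat n * (F * mpderiv j P))) =
    P * (\<Sum>j\<in>{1..N}. Var j * mpderiv j F) - of_nat n * F * (\<Sum>j\<in>{1..N}. Var j * mpderiv j P)"
    by (simp add: sum_distrib_left right_diff_distrib sum_subtractf mult_ac)
  also have "\<dots> = (of_nat d - of_nat (n * e)) * (F * P)"
    unfolding euler_identity[OF assms(1)] euler_identity[OF assms(2)] by (simp add: algebra_simps)
  finally show ?thesis using P0 by (simp add: rat_mult rat_diff nat)
qed

lemma lookup_mult_Var: "Poly_Mapping.lookup (F * Var i) m =
    (if Poly_Mapping.lookup m i = 0 then 0 else Poly_Mapping.lookup F (m - Poly_Mapping.single i 1))"
proof (induction F rule: mpoly_induct)
  case zero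
  show ?case by simp
next
  case (add F n c)
  have "n + Poly_Mapping.single i 1 = m \<longleftrightarrow> Poly_Mapping.lookup m i \<noteq> 0 \<and> n = m - Poly_Mapping.single i 1"
  proof
    assume "n + Poly_Mapping.single i 1 = m"
    then show "Poly_Mapping.lookup m i \<noteq> 0 \<and> n = m - Poly_Mapping.single i 1"
      by (auto simp: lookup_add)
  next
    assume *: "Poly_Mapping.lookup m i \<noteq> 0 \<and> n = m - Poly_Mapping.single i 1"
    then show "n + Poly_Mapping.single i 1 = m"
      by (intro poly_mapping_eqI) (auto simp: lookup_add lookup_minus lookup_single when_def)
  qed
  then have "Poly_Mapping.lookup (Poly_Mapping.single n c * Var i) m =
    (if Poly_Mapping.lookup m i = 0 then 0 else Poly_Mapping.lookup (Poly_Mapping.single n c) (m - Poly_Mapping.single i 1))"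
    by (auto simp: Var_def mult_single lookup_single when_def)
  then show ?case using add by (simp add: distrib_right lookup_add)
qed

text \<open>Coprimality of two distinct variables, read off from exponents: every monomial of
  \<open>F\<close> must contain \<open>Var j\<close>.\<close>

lemma Var_dvd:
  assumes eq: "F * Var i = G * Var j" and "i \<noteq> j"
  shows "\<exists>H. F = H * Var j"
proof
  define H where "H = (\<Sum>m\<in>Poly_Mapping.keys F. Poly_Mapping.single (m - Poly_Mapping.single j 1) (Poly_Mapping.lookup F m))"
  have pos: "Poly_Mapping.lookup m j \<noteq> 0" if "m \<in> Poly_Mapping.keys F" for m
  proof
    assume "Poly_Mapping.lookup m j = 0"
    then have "Poly_Mapping.lookup (G * Var j) (m + Poly_Mapping.single i 1) = 0"
      using \<open>i \<noteq> j\<close> by (simp add: lookup_mult_Var lookup_add lookup_single)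
    moreover have "Poly_Mapping.lookup (F * Var i) (m + Poly_Mapping.single i 1) = Poly_Mapping.lookup F m"
      by (simp add: lookup_mult_Var lookup_add)
    ultimately show False using that eq by (simp add: in_keys_iff)
  qed
  have "H * Var j = (\<Sum>m\<in>Poly_Mapping.keys F. Poly_Mapping.single m (Poly_Mapping.lookup F m))"
    unfolding H_def sum_distrib_right
  proof (rule sum.cong)
    fix m assume "m \<in> Poly_Mapping.keys F"
    then have "m - Poly_Mapping.single j 1 + Poly_Mapping.single j 1 = m"
      using pos[of m] by (intro poly_mapping_eqI) (auto simp: lookup_add lookup_minus lookup_single when_def)
    then show "Poly_Mapping.single (m - Poly_Mapping.single j 1) (Poly_Mapping.lookup F m) * Var j =
        Poly_Mapping.single m (Poly_Mapping.lookup F m)"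
      by (simp add: Var_def mult_single)
  qed simp
  also have "\<dots> = F"
  proof (rule poly_mapping_eqI)
    fix m
    have "Poly_Mapping.lookup (\<Sum>m\<in>Poly_Mapping.keys F. Poly_Mapping.single m (Poly_Mapping.lookup F m)) m =
        (\<Sum>m'\<in>Poly_Mapping.keys F. if m' = m then Poly_Mapping.lookup F m else 0)"
      unfolding lookup_sum by (rule sum.cong) (auto simp: lookup_single when_def)
    then show "Poly_Mapping.lookup (\<Sum>m\<in>Poly_Mapping.keys F. Poly_Mapping.single m (Poly_Mapping.lookup F m)) m =
        Poly_Mapping.lookup F m"
      by (simp add: in_keys_iff)
  qed
  finally show "F = H * Var j" ..
qed

lemma A_nonzero [simp]: "A i \<noteq> (0 :: 'a::field ratfun)"
  using rderiv_A[of i i, where 'a='a] by auto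

lemma pos_sign_insert_self: "pos_sign j (insert j I) = pos_sign j I"
proof -
  have "{x \<in> insert j I. x < j} = {x \<in> I. x < j}" by auto
  then show ?thesis by (simp add: pos_sign_def)
qed

lemma pos_sign_square: "pos_sign j I * pos_sign j I = 1"
  by (simp add: pos_sign_def flip: power_add mult_2)

text \<open>If the contraction vanishes, the coefficients \<open>\<omega> (omit N i)\<close> are, up
  to sign, proportional to the \<open>A i\<close>, as for a multiple of
  \<open>Omega\<close>.\<close>

lemma contraction_omit2:
  fixes \<omega> :: "'a::field form"
  assumes "i \<in> {1..N}" "j \<in> {1..N}" "i \<noteq> j"
  shows "pos_sign j (omit N i) * euler_contraction N \<omega> ({1..N} - {i, j}) =
    A j * \<omega> (omit N i) - (- 1) ^ (i + j) * A i * \<omega> (omit N j)"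
proof -
  let ?J = "{1..N} - {i, j}"
  have s: "{1..N} - ?J = {i, j}" "insert i ?J = omit N j" "insert j ?J = omit N i" using assms by auto
  have "euler_contraction N \<omega> ?J = pos_sign i ?J * A i * \<omega> (omit N j) + pos_sign j ?J * A j * \<omega> (omit N i)"
    unfolding euler_contraction_def s using assms(3) s(2,3) by (simp add: rat_def)
  moreover have "pos_sign j ?J = (pos_sign j (omit N i) :: 'a ratfun)"
    using pos_sign_insert_self[of j ?J, where 'a='a] unfolding s by simp
  ultimately have "pos_sign j (omit N i) * euler_contraction N \<omega> ?J =
     (pos_sign j (omit N i) * pos_sign i ?J) * (A i * \<omega> (omit N j))
     + (pos_sign j (omit N i) * pos_sign j (omit N i)) * (A j * \<omega> (omit N i))"
    by (simp only:) (simp only: distrib_left mult_ac)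
  then show ?thesis unfolding pos_sign_omit2[OF assms] pos_sign_square by simp
qed

text \<open>The common ratio of the coefficients to the \<open>A i\<close> is the function sought.
  Comparing the coefficients for 1 and 2 shows that \<open>A 1\<close> divides the first numerator
  once denominators are cleared, so the ratio has no pole outside the hypersurface.\<close>

lemma regular_top_form:
  fixes \<omega> :: "'a::field_char_0 form"
  assumes \<omega>: "\<omega> \<in> regular_forms 10 P 9" and P: "homogeneous 10 5 P" "P \<noteq> 0"
  shows "\<exists>G d k. homogeneous 10 d G \<and> d + 10 = 5 * k \<and> \<omega> = vol 10 (rat G / rat P ^ k)"
proof -
  have P0: "rat P \<noteq> 0" using P(2) rat_eq_iff[of P 0] by simp
  have rel: "A j * \<omega> (omit 10 i) = (- 1) ^ (i + j) * A i * \<omega> (omit 10 j)"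
    if "i \<in> {1..10}" "j \<in> {1..10}" "i \<noteq> j" for i j
    using contraction_omit2[OF that, of \<omega>] \<omega> by (simp add: regular_forms_def)
  have frac: "\<exists>F k d. homogeneous 10 d F \<and> d + 9 = 5 * k \<and> \<omega> (omit 10 i) = rat F / rat P ^ k"
    if "i \<in> {1..10}" for i
  proof -
    have "omit 10 i \<subseteq> {1..10}" "card (omit 10 i) = 9" using card_omit[OF that] by auto
    then obtain F k d where F: "homogeneous 10 d F" "homogeneous 10 (d + 9) (P ^ k)" "\<omega> (omit 10 i) = Fract F (P ^ k)"
      using \<omega> unfolding regular_forms_def by blast
    moreover have "homogeneous 10 (k * 5) (P ^ k)" using homogeneous_power[OF P(1)] by simp
    moreover have "P ^ k \<noteq> 0" using P(2) by simp
    ultimately have "d + 9 = 5 * k" using homogeneous_degree_unique by fastforce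
    moreover have "\<omega> (omit 10 i) = rat F / rat P ^ k"
      using F(3) Fract_rat[OF \<open>P ^ k \<noteq> 0\<close>] by (simp add: rat_power)
    ultimately show ?thesis using F(1) by blast
  qed
  obtain F1 k1 d1 where F1: "homogeneous 10 d1 F1" "d1 + 9 = 5 * k1" "\<omega> (omit 10 1) = rat F1 / rat P ^ k1"
    using frac[of 1] by auto
  obtain F2 k2 d2 where F2: "\<omega> (omit 10 2) = rat F2 / rat P ^ k2"
    using frac[of 2] by auto
  have "A 2 * \<omega> (omit 10 1) = - (A 1 * \<omega> (omit 10 2))" using rel[of 1 2] by simp
  then have "rat (F1 * P ^ k2 * Var 2) = rat (- (F2 * P ^ k1) * Var 1)"
    using P0 unfolding F1(3) F2 by (simp add: rat_mult rat_power rat_minus field_simps)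
  then have "F1 * P ^ k2 * Var 2 = - (F2 * P ^ k1) * Var 1" by simp
  then obtain H where H: "F1 * P ^ k2 = H * Var 1" using Var_dvd[of "F1 * P ^ k2" 2] by fastforce
  define d where "d = d1 + 5 * k2 - 1"
  have d: "d + 1 = d1 + 5 * k2" "d + 10 = 5 * (k1 + k2)"
  proof -
    have "d1 \<noteq> 0 \<or> k2 \<noteq> 0" using F1(2) by presburger
    then show "d + 1 = d1 + 5 * k2" by (auto simp: d_def)
    then show "d + 10 = 5 * (k1 + k2)" using F1(2) by simp
  qed
  \<comment> \<open>The quotient \<open>H\<close> may be replaced by its component of degree
    \<open>d\<close>, since its product with \<open>Var 1\<close> is already homogeneous of degree
    \<open>d + 1\<close>.\<close>
  have "homogeneous 10 (d + 1) (H * Var 1)"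
    using homogeneous_mult[OF F1(1) homogeneous_power[OF P(1), of k2]] d(1) H by (simp add: mult.commute)
  then have "hcomp 10 (d + 1) (H * Var 1) = H * Var 1" by (simp only: homogeneous_iff_hcomp)
  moreover have "hcomp 10 (d + 1) (H * Var 1) = hcomp 10 d H * Var 1"
    by (rule hcomp_mult) (rule homogeneous_Var, simp)
  ultimately have "hcomp 10 d H * Var 1 = H * Var 1" by (rule trans[OF sym, rotated])
  moreover define G where "G = - hcomp 10 d H"
  ultimately have G: "F1 * P ^ k2 = - G * Var 1" using H by (simp only: minus_minus)
  have hG: "homogeneous 10 d G"
    using homogeneous_diff[of 10 d 0 "hcomp 10 d H"] homogeneous_hcomp[of 10 d H] by (simp add: G_def)
  have w1: "\<omega> (omit 10 1) = - (A 1 * (rat G / rat P ^ (k1 + k2)))"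
  proof -
    have "\<omega> (omit 10 1) = rat (F1 * P ^ k2) / rat P ^ (k1 + k2)"
      unfolding F1(3) using P0 by (simp add: rat_mult rat_power power_add)
    then show ?thesis unfolding G by (simp add: rat_mult rat_minus)
  qed
  have "\<omega> = vol 10 (rat G / rat P ^ (k1 + k2))"
  proof
    fix I
    let ?h = "rat G / rat P ^ (k1 + k2)"
    show "\<omega> I = vol 10 ?h I"
    proof (cases "\<exists>i\<in>{1..10}. I = omit 10 i")
      case True
      then obtain i where i: "i \<in> {1..10}" "I = omit 10 i" by blast
      have "A 1 * \<omega> (omit 10 i) = A 1 * ((- 1) ^ i * A i * ?h)"
      proof (cases "i = 1")
        case True
        then show ?thesis using w1 by simp
      next
        case False
        then have "A 1 * \<omega> (omit 10 i) = (- 1) ^ (i + 1) * A i * \<omega> (omit 10 1)"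
          using rel[OF i(1), of 1] by simp
        then show ?thesis unfolding w1 by (simp add: mult_ac)
      qed
      then have "\<omega> (omit 10 i) = (- 1) ^ i * A i * ?h" by (metis A_nonzero mult_left_cancel)
      then show ?thesis using Omega_omit[OF i(1), where 'a='a] by (simp only: i(2) vol_def mult_ac)
    next
      case False
      then have "\<not> (I \<subseteq> {1..10} \<and> card I = 9)" using card_eq_omit[of I 10] by auto
      then have "\<omega> I = 0" using \<omega> by (simp add: regular_forms_def)
      moreover have "Omega 10 I = (0 :: 'a ratfun)" using False by (intro Omega_other) blast
      ultimately show ?thesis by (simp add: vol_def)
    qed
  qed
  then show ?thesis using hG d(2) by blast
qed

lemma rderiv_sign: "rderiv j ((- 1) ^ n * x) = (- 1) ^ n * rderiv j x"
  by (cases "even n") (simp_all add: derivation.d_minus[OF derivation_rderiv])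

lemma exact_forms_Suc: "exact_forms N f (Suc q) = ext_deriv N ` regular_forms N f q"
  by (simp add: exact_forms_def)

text \<open>Cartan's formula. The form \<open>\<beta>\<close> has total degree 0, its coefficients
  having degree -9, so its Lie derivative along the Euler field is 0 and the differential of its
  contraction is minus the contraction of its differential. The signs in \<open>B\<close> make the
  latter the divergence times the volume form.\<close>

lemma divergence_exact:
  fixes P :: "'a::field_char_0 mpoly"
  assumes P: "homogeneous 10 5 P" "P \<noteq> 0" and H: "\<And>i. homogeneous 10 (5 * m + 1) (H i)"
  shows "vol 10 (\<Sum>j\<in>{1..10}. rderiv j (rat (H j) / rat P ^ (m + 2))) \<in> exact_forms 10 P 9"
proof -
  define n where "n = m + 2"
  define g where "g j = rat (H j) / rat P ^ n" for j
  define B where "B I = - (\<Sum>i\<in>{1..10}. if I = omit 10 i then Const ((- 1) ^ i) * H i else 0)" for I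
  define \<beta> where "\<beta> I = rat (B I) / rat P ^ n" for I
  define \<theta> where "\<theta> = euler_contraction 10 \<beta>"
  have P0: "rat P \<noteq> 0" using P(2) rat_eq_iff[of P 0] by simp
  have hB: "homogeneous 10 (5 * m + 1) (B I)" for I
  proof -
    have "homogeneous 10 (5 * m + 1) (\<Sum>i\<in>{1..10}. if I = omit 10 i then Const ((- 1) ^ i) * H i else 0)"
    proof (rule homogeneous_sum)
      fix i
      show "homogeneous 10 (5 * m + 1) (if I = omit 10 i then Const ((- 1) ^ i) * H i else 0)"
        using homogeneous_mult[OF homogeneous_Const H, of "(- 1) ^ i" i] by simp
    qed
    from homogeneous_diff[OF homogeneous_zero this] show ?thesis by (simp only: B_def diff_0)
  qed
  have B_omit: "B (omit 10 i) = - (Const ((- 1) ^ i) * H i)" if i: "i \<in> {1..10}" for i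
  proof -
    have "(\<Sum>j\<in>{1..10}. if omit 10 i = omit 10 j then Const ((- 1) ^ j) * H j else 0) =
        (\<Sum>j\<in>{1..10}. if j = i then Const ((- 1) ^ i) * H i else 0)"
      by (rule sum.cong) (use i omit_eq_iff[of i 10] in auto)
    then show ?thesis using i by (simp add: B_def)
  qed
  have \<beta>_omit: "\<beta> (omit 10 i) = - ((- 1) ^ i * g i)" if "i \<in> {1..10}" for i
    by (simp only: \<beta>_def B_omit[OF that] rat_minus rat_mult rat_sign g_def) simp
  have \<beta>_other: "\<beta> I = 0" if "card I \<noteq> 9" for I
  proof -
    have "I \<noteq> omit 10 i" if "i \<in> {1..10}" for i using \<open>card I \<noteq> 9\<close> card_omit[OF that] by auto
    then have "B I = 0" unfolding B_def by (simp add: sum.neutral)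
    then show ?thesis by (simp add: \<beta>_def)
  qed
  have \<theta>_other: "\<theta> I = 0" if "\<not> (I \<subseteq> {1..10} \<and> card I = 8)" for I
  proof (cases "I \<subseteq> {1..10}")
    case True
    then have "card I \<noteq> 8" using that by simp
    moreover have "finite I" using True by (rule finite_subset) simp
    ultimately have "\<beta> (insert j I) = 0" if "j \<in> {1..10} - I" for j
      using that by (intro \<beta>_other) simp
    then show ?thesis by (simp add: \<theta>_def euler_contraction_def)
  qed (simp add: \<theta>_def euler_contraction_def)
  have "\<theta> \<in> regular_forms 10 P 8"
  proof -
    have "\<exists>F k d. homogeneous 10 d F \<and> homogeneous 10 (d + 8) (P ^ k) \<and> \<theta> I = Fract F (P ^ k)"
      if "I \<subseteq> {1..10}" "card I = 8" for I
    proof (intro exI conjI)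
      let ?F = "\<Sum>j\<in>{1..10} - I. Const ((- 1) ^ card {i \<in> I. i < j}) * (Var j * B (insert j I))"
      have "homogeneous 10 (0 + (1 + (5 * m + 1))) ?F"
        by (intro homogeneous_sum homogeneous_mult homogeneous_Const homogeneous_Var hB) auto
      then show "homogeneous 10 (5 * m + 2) ?F" by simp
      show "homogeneous 10 (5 * m + 2 + 8) (P ^ n)"
        using homogeneous_power[OF P(1), of n] by (simp add: n_def algebra_simps)
      have "P ^ n \<noteq> 0" using P(2) by simp
      then have "Fract ?F (P ^ n) = rat ?F / rat (P ^ n)" by (rule Fract_rat)
      also have "\<dots> = rat ?F / rat P ^ n" by (simp only: rat_power)
      also have "\<dots> = \<theta> I"
        using that(1) by (simp add: \<theta>_def euler_contraction_def \<beta>_def pos_sign_def rat_def[symmetric]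
            rat_sum rat_mult rat_sign sum_divide_distrib mult.assoc)
      finally show "\<theta> I = Fract ?F (P ^ n)" ..
    qed
    moreover have "euler_contraction 10 \<theta> = (\<lambda>_. 0)"
      unfolding \<theta>_def by (rule euler_contraction_square)
    ultimately show ?thesis using \<theta>_other unfolding regular_forms_def by blast
  qed
  moreover have "ext_deriv 10 \<theta> = vol 10 (\<Sum>j\<in>{1..10}. rderiv j (g j))"
  proof
    fix I
    show "ext_deriv 10 \<theta> I = vol 10 (\<Sum>j\<in>{1..10}. rderiv j (g j)) I"
    proof (cases "\<exists>i\<in>{1..10}. I = omit 10 i")
      case True
      then obtain i where i: "i \<in> {1..10}" "I = omit 10 i" by blast
      let ?b = "\<beta> (omit 10 i)"
      \<comment> \<open>The bracket is the share of \<open>j\<close> in the Lie derivative of the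
        coefficient \<open>?b\<close>. Summed over the nine \<open>j\<close> it gives
        \<open>9 * ?b\<close> plus the Euler sum without its term for \<open>i\<close>; by degree -9
        only minus that missing term remains, and it supplies the derivative of
        \<open>g i\<close>.\<close>
      have summand: "pos_sign j I * rderiv j (\<theta> (I - {j})) =
          (- 1) ^ i * A i * rderiv j (g j) + (?b + A j * rderiv j ?b)" if j: "j \<in> I" for j
      proof -
        have j': "j \<in> {1..10}" "i \<noteq> j" using j i by auto
        have "I - {j} = {1..10} - {i, j}" using i by auto
        then have "pos_sign j I * \<theta> (I - {j}) = A j * ?b - (- 1) ^ (i + j) * A i * \<beta> (omit 10 j)"
          using contraction_omit2[OF i(1) j', of \<beta>] by (simp only: i(2) \<theta>_def)
        also have "\<dots> = A j * ?b + (- 1) ^ i * (A i * g j)"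
        proof -
          have "(- 1) ^ (i + j) * A i * \<beta> (omit 10 j) = - (((- 1) ^ i * ((- 1) ^ j * (- 1) ^ j)) * (A i * g j))"
            unfolding \<beta>_omit[OF j'(1)] by (simp add: power_add mult_ac)
          also have "(- 1 :: 'a ratfun) ^ j * (- 1) ^ j = 1" by (simp flip: power_add mult_2)
          finally show ?thesis by simp
        qed
        finally have "rderiv j (pos_sign j I * \<theta> (I - {j})) = rderiv j (A j * ?b + (- 1) ^ i * (A i * g j))" by simp
        moreover have "rderiv j (pos_sign j I * \<theta> (I - {j})) = pos_sign j I * rderiv j (\<theta> (I - {j}))"
          unfolding pos_sign_def by (rule rderiv_sign)
        moreover have "rderiv j (A j * ?b + (- 1) ^ i * (A i * g j)) =
            A j * rderiv j ?b + ?b + (- 1) ^ i * (A i * rderiv j (g j))"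
          unfolding rderiv_add rderiv_sign
          using j'(2) by (simp add: derivation.d_mult[OF derivation_rderiv] rderiv_A)
        ultimately show ?thesis by (simp add: mult_ac add_ac)
      qed
      have I: "I \<subseteq> {1..10}" "finite I" "card I = 9" using i card_omit[OF i(1)] by auto
      have split: "(\<Sum>j\<in>{1..10}. F j) = F i + (\<Sum>j\<in>I. F j)" for F :: "nat \<Rightarrow> 'a ratfun"
        unfolding i(2) using i(1) by (intro sum.remove) simp_all
      have "(\<Sum>j\<in>{1..10}. A j * rderiv j ?b) = - 9 * ?b"
      proof -
        have "(of_nat (5 * m + 1) - of_nat (n * 5)) = (- 9 :: 'a ratfun)" by (simp add: n_def)
        then show ?thesis
          using euler_identity_fraction[OF hB[of "omit 10 i"] P, of n] unfolding \<beta>_def by (simp only:)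
      qed
      then have euler: "(\<Sum>j\<in>I. A j * rderiv j ?b) = - 9 * ?b - A i * rderiv i ?b"
        unfolding split by (simp add: algebra_simps)
      have bi: "rderiv i ?b = - ((- 1) ^ i * rderiv i (g i))"
        unfolding \<beta>_omit[OF i(1)] derivation.d_minus[OF derivation_rderiv] rderiv_sign ..
      have "ext_deriv 10 \<theta> I = (\<Sum>j\<in>I. (- 1) ^ i * A i * rderiv j (g j) + (?b + A j * rderiv j ?b))"
        unfolding ext_deriv_def using I(1) by (simp only: if_True summand cong: sum.cong)
      also have "\<dots> = (- 1) ^ i * A i * (\<Sum>j\<in>I. rderiv j (g j)) + (9 * ?b + (\<Sum>j\<in>I. A j * rderiv j ?b))"
        using I(2,3) by (simp add: sum.distrib sum_distrib_left)
      also have "\<dots> = (- 1) ^ i * A i * (rderiv i (g i) + (\<Sum>j\<in>I. rderiv j (g j)))"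
        unfolding euler bi by (simp add: algebra_simps)
      also have "\<dots> = (- 1) ^ i * A i * (\<Sum>j\<in>{1..10}. rderiv j (g j))"
        by (simp only: split)
      finally show ?thesis
        unfolding vol_def i(2) Omega_omit[OF i(1)] by (simp only: mult_ac)
    next
      case False
      then have "Omega 10 I = (0 :: 'a ratfun)" by (intro Omega_other) blast
      moreover have "ext_deriv 10 \<theta> I = 0"
      proof (cases "I \<subseteq> {1..10}")
        case True
        have "card I \<noteq> 9" using False card_eq_omit[OF True] by auto
        moreover have "finite I" using True by (rule finite_subset) simp
        ultimately have "\<theta> (I - {j}) = 0" if "j \<in> I" for j
          using that by (intro \<theta>_other) (auto simp: card_Diff_singleton dest: card_gt_0_iff[THEN iffD2, rotated])
        then show ?thesis by (simp add: ext_deriv_def)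
      qed (simp add: ext_deriv_def)
      ultimately show ?thesis by (simp add: vol_def)
    qed
  qed
  moreover have "exact_forms 10 P 9 = ext_deriv 10 ` regular_forms 10 P 8"
    using exact_forms_Suc[of 10 P 8] by simp
  ultimately show ?thesis unfolding g_def n_def by (simp only: image_eqI[OF sym])
qed

section \<open>Cohomology classes and the span of eta\<close>

lemma regular_forms_diff:
  fixes f :: "'a::field mpoly"
  assumes f: "f \<noteq> 0" and w: "\<omega> \<in> regular_forms N f p" "\<omega>' \<in> regular_forms N f p"
  shows "(\<lambda>I. \<omega> I - \<omega>' I) \<in> regular_forms N f p"
proof -
  have "\<exists>F k d. homogeneous N d F \<and> homogeneous N (d + p) (f ^ k) \<and> \<omega> I - \<omega>' I = Fract F (f ^ k)"
    if I: "I \<subseteq> {1..N} \<and> card I = p" for I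
  proof -
    obtain F k d where F: "homogeneous N d F" "homogeneous N (d + p) (f ^ k)" "\<omega> I = Fract F (f ^ k)"
      using w(1) I unfolding regular_forms_def by blast
    obtain F' k' d' where F': "homogeneous N d' F'" "homogeneous N (d' + p) (f ^ k')" "\<omega>' I = Fract F' (f ^ k')"
      using w(2) I unfolding regular_forms_def by blast
    have "homogeneous N (d + d' + p) (F * f ^ k' - F' * f ^ k)"
      using homogeneous_mult[OF F(1) F'(2)] homogeneous_mult[OF F'(1) F(2)]
      by (intro homogeneous_diff) (simp_all add: add_ac)
    moreover have "homogeneous N (d + d' + p + p) (f ^ (k + k'))"
      using homogeneous_mult[OF F(2) F'(2)] by (simp add: add_ac flip: power_add)
    moreover have "\<omega> I - \<omega>' I = Fract (F * f ^ k' - F' * f ^ k) (f ^ (k + k'))"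
      using f by (simp add: F(3) F'(3) power_add mult.commute)
    ultimately show ?thesis by blast
  qed
  moreover have "euler_contraction N (\<lambda>I. \<omega> I - \<omega>' I) = (\<lambda>_. 0)"
  proof
    fix I
    have "euler_contraction N (\<lambda>I. \<omega> I - \<omega>' I) I = euler_contraction N \<omega> I - euler_contraction N \<omega>' I"
      by (simp add: euler_contraction_def right_diff_distrib sum_subtractf)
    then show "euler_contraction N (\<lambda>I. \<omega> I - \<omega>' I) I = 0" using w by (simp add: regular_forms_def)
  qed
  ultimately show ?thesis using w unfolding regular_forms_def by auto
qed

lemma exact_forms_diff:
  assumes "f \<noteq> 0" "\<alpha> \<in> exact_forms N f p" "\<alpha>' \<in> exact_forms N f p"
  shows "(\<lambda>I. \<alpha> I - \<alpha>' I) \<in> exact_forms N f p"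
proof (cases p)
  case 0
  then show ?thesis using assms by (simp add: exact_forms_def)
next
  case (Suc q)
  then obtain \<theta> \<theta>' where t: "\<theta> \<in> regular_forms N f q" "\<theta>' \<in> regular_forms N f q"
    and a: "\<alpha> = ext_deriv N \<theta>" "\<alpha>' = ext_deriv N \<theta>'"
    using assms by (auto simp: exact_forms_def)
  have "(\<lambda>I. \<alpha> I - \<alpha>' I) = ext_deriv N (\<lambda>I. \<theta> I - \<theta>' I)"
    by (rule ext) (simp add: a ext_deriv_def rderiv_diff right_diff_distrib sum_subtractf)
  then show ?thesis using regular_forms_diff[OF assms(1) t] Suc by (simp add: exact_forms_def)
qed

lemma cohomologous_class_eq:
  assumes f: "f \<noteq> 0" and c: "(\<omega>, \<omega>') \<in> cohomologous N f p"
  shows "cohomologous N f p `` {\<omega>} = cohomologous N f p `` {\<omega>'}"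
proof -
  have swap: "(\<lambda>I. \<alpha> I - \<gamma> I) \<in> exact_forms N f p"
    if "(\<lambda>I. \<delta> I - \<gamma> I) \<in> exact_forms N f p" "(\<lambda>I. \<delta> I - \<alpha> I) \<in> exact_forms N f p" for \<alpha> \<gamma> \<delta>
    using exact_forms_diff[OF f that] by (simp add: algebra_simps)
  have neg: "(\<lambda>I. \<omega>' I - \<omega> I) \<in> exact_forms N f p"
  proof (rule swap)
    show e: "(\<lambda>I. \<omega> I - \<omega>' I) \<in> exact_forms N f p" using c by (simp add: cohomologous_def)
    show "(\<lambda>I. \<omega> I - \<omega> I) \<in> exact_forms N f p" using exact_forms_diff[OF f e e] by simp
  qed
  show ?thesis
  proof (intro equalityI subsetI)
    fix \<gamma> assume "\<gamma> \<in> cohomologous N f p `` {\<omega>}"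
    then show "\<gamma> \<in> cohomologous N f p `` {\<omega>'}" using c swap by (auto simp: cohomologous_def)
  next
    fix \<gamma> assume "\<gamma> \<in> cohomologous N f p `` {\<omega>'}"
    then show "\<gamma> \<in> cohomologous N f p `` {\<omega>}" using c swap[OF _ neg] by (auto simp: cohomologous_def)
  qed
qed

text \<open>One inclusion is closedness of the multiples of eta. For the other, a regular 9-form is
  \<open>G / P ^ k\<close> times \<open>Omega\<close>, and its homogeneous decomposition splits off
  an exact form and leaves a multiple of eta.\<close>

lemma class_span_zz5:
  fixes P :: "'a::field_char_0 mpoly"
  assumes psi: "P = zz5_psi"
  shows "class_span 10 P 9 (\<lambda>I. Omega 10 I / Fract (P ^ 2) 1) = de_rham_cohomology 10 P 9"
proof -
  have P: "homogeneous 10 5 P" "P \<noteq> 0" unfolding psi by (rule homogeneous_zz5_psi, rule zz5_psi_nonzero)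
  have P0: "rat P \<noteq> 0" using P(2) rat_eq_iff[of P 0] by simp
  let ?\<eta> = "\<lambda>I. Omega 10 I / Fract (P ^ 2) 1"
  have eta: "smult_form c ?\<eta> = vol 10 (rat (Const c) / rat P ^ 2)" for c
    by (rule ext) (simp add: smult_form_def vol_def rat_power flip: rat_def)
  have hP2: "homogeneous 10 (0 + 10) (P ^ 2)" using homogeneous_power[OF P(1), of 2] by simp
  have closed: "smult_form c ?\<eta> \<in> closed_forms 10 P 9" for c
  proof -
    have "ext_deriv 10 (vol 10 (rat (Const c) / rat P ^ 2)) = (\<lambda>_. 0)"
      using euler_identity_fraction[OF homogeneous_Const P, of c 2] by (intro vol_closed) simp
    then show ?thesis
      unfolding eta closed_forms_def using vol_regular[OF homogeneous_Const hP2 P(2)] by simp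
  qed
  show ?thesis
  proof (intro equalityI subsetI)
    fix x assume "x \<in> class_span 10 P 9 ?\<eta>"
    then obtain c where "x = cohomologous 10 P 9 `` {smult_form c ?\<eta>}"
      by (auto simp: class_span_def de_rham_class_def)
    then show "x \<in> de_rham_cohomology 10 P 9"
      unfolding de_rham_cohomology_def using closed by (simp add: quotientI)
  next
    fix x assume "x \<in> de_rham_cohomology 10 P 9"
    then obtain \<omega> where x: "x = cohomologous 10 P 9 `` {\<omega>}" and \<omega>: "\<omega> \<in> closed_forms 10 P 9"
      unfolding de_rham_cohomology_def by (rule quotientE)
    then have "\<omega> \<in> regular_forms 10 P 9" by (simp add: closed_forms_def)
    then obtain G d k where G: "homogeneous 10 d G" "d + 10 = 5 * k" and w: "\<omega> = vol 10 (rat G / rat P ^ k)"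
      using regular_top_form[OF _ P] by blast
    obtain m H c where H: "\<And>i. homogeneous 10 (5 * m + 1) (H i)" and
      dec: "rat G / rat P ^ k = (\<Sum>i\<in>{1..10}. rderiv i (rat (H i) / rat P ^ (m + 2))) + rat (Const c) / rat P ^ 2"
      using homogeneous_decomposition[OF G] unfolding psi by blast
    have "(\<lambda>I. \<omega> I - smult_form c ?\<eta> I) = vol 10 (\<Sum>i\<in>{1..10}. rderiv i (rat (H i) / rat P ^ (m + 2)))"
      unfolding eta w dec by (rule ext) (simp add: vol_def distrib_right)
    then have "(\<lambda>I. \<omega> I - smult_form c ?\<eta> I) \<in> exact_forms 10 P 9"
      using divergence_exact[OF P H] by simp
    then have "(\<omega>, smult_form c ?\<eta>) \<in> cohomologous 10 P 9"
      using \<omega> closed by (simp add: cohomologous_def)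
    then have "x = de_rham_class 10 P 9 (smult_form c ?\<eta>)"
      unfolding x de_rham_class_def by (rule cohomologous_class_eq[OF P(2)])
    then show "x \<in> class_span 10 P 9 ?\<eta>" by (auto simp: class_span_def)
  qed
qed

section \<open>Spanning trees and the graph polynomial\<close>

definition edge_rel :: "'v set set \<Rightarrow> ('v \<times> 'v) set" where
  "edge_rel T = {(x, y). {x, y} \<in> T}"

definition acyclic_graph :: "'v set set \<Rightarrow> bool" where
  "acyclic_graph T \<longleftrightarrow> (\<nexists>c. is_cycle T c)"

lemma sym_edge_rel: "(x, y) \<in> edge_rel T \<Longrightarrow> (y, x) \<in> edge_rel T"
  by (simp add: edge_rel_def insert_commute)

lemma sym_connected: "(x, y) \<in> (edge_rel T)\<^sup>* \<Longrightarrow> (y, x) \<in> (edge_rel T)\<^sup>*"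
  by (induction rule: rtrancl_induct) (auto intro: sym_edge_rel converse_rtrancl_into_rtrancl)

lemma edge_rel_insert: "edge_rel (insert {x, y} T) = insert (x, y) (insert (y, x) (edge_rel T))"
  by (auto simp: edge_rel_def doubleton_eq_iff)

lemma connected_insert:
  "(a, b) \<in> (edge_rel (insert {x, y} T))\<^sup>* \<longleftrightarrow> (a, b) \<in> (edge_rel T)\<^sup>* \<or>
    (a, x) \<in> (edge_rel T)\<^sup>* \<and> (y, b) \<in> (edge_rel T)\<^sup>* \<or> (a, y) \<in> (edge_rel T)\<^sup>* \<and> (x, b) \<in> (edge_rel T)\<^sup>*"
  unfolding edge_rel_insert rtrancl_insert
  by (auto dest: sym_connected intro: rtrancl_trans)

lemma is_cycle_mono: "is_cycle T c \<Longrightarrow> T \<subseteq> T' \<Longrightarrow> is_cycle T' c"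
  unfolding is_cycle_def by blast

lemma connected_distinct_path:
  assumes "(x, y) \<in> (edge_rel T)\<^sup>*"
  shows "\<exists>p. p \<noteq> [] \<and> distinct p \<and> hd p = x \<and> last p = y \<and> successively (\<lambda>a b. {a, b} \<in> T) p"
  using assms
proof (induction rule: rtrancl_induct)
  case base
  show ?case by (intro exI[of _ "[x]"]) simp
next
  case (step y z)
  then obtain p where p: "p \<noteq> []" "distinct p" "hd p = x" "last p = y" "successively (\<lambda>a b. {a, b} \<in> T) p" by blast
  show ?case
  proof (cases "z \<in> set p")
    case True
    then obtain us vs where "p = us @ z # vs" by (meson split_list)
    then have "p = (us @ [z]) @ vs" by simp
    then have "distinct (us @ [z])" "hd (us @ [z]) = x" "successively (\<lambda>a b. {a, b} \<in> T) (us @ [z])"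
      using p by (auto simp: successively_append_iff hd_append split: if_splits)
    then show ?thesis by (intro exI[of _ "us @ [z]"]) simp
  next
    case False
    then show ?thesis using p step(2)
      by (intro exI[of _ "p @ [z]"]) (auto simp: successively_append_iff edge_rel_def)
  qed
qed

lemma cycle_of_connected:
  assumes "(x, y) \<in> (edge_rel T)\<^sup>*" "x \<noteq> y" "{x, y} \<notin> T"
  shows "\<exists>c. is_cycle (insert {x, y} T) c"
proof -
  obtain p where p: "p \<noteq> []" "distinct p" "hd p = x" "last p = y" "successively (\<lambda>a b. {a, b} \<in> T) p"
    using connected_distinct_path[OF assms(1)] by blast
  \<comment> \<open>One vertex would contradict \<open>x \<noteq> y\<close>, and two would put
    \<open>{x, y}\<close> into \<open>T\<close>; the path is thus long enough to close up to a
    cycle.\<close>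
  have len: "3 \<le> length p"
  proof (rule ccontr)
    assume "\<not> 3 \<le> length p"
    then have "length p = 1 \<or> length p = 2" using p(1) by (cases "length p") auto
    then show False
    proof
      assume "length p = 1"
      then show False using p assms(2) by (cases p) auto
    next
      assume "length p = 2"
      then obtain a b where "p = [a, b]" by (auto simp: length_Suc_conv numeral_2_eq_2)
      then show False using p assms(3) by auto
    qed
  qed
  have "is_cycle (insert {x, y} T) p"
    unfolding is_cycle_def
  proof (intro conjI allI impI)
    fix i assume i: "i < length p"
    show "{p ! i, p ! (Suc i mod length p)} \<in> insert {x, y} T"
    proof (cases "Suc i < length p")
      case True
      then show ?thesis using p(5) by (auto simp: successively_conv_nth)
    next
      case False
      then have len: "Suc i = length p" "i = length p - 1" using i by simp_all
      then have "p ! i = y" using p(1,4) by (simp add: last_conv_nth)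
      moreover have "p ! (Suc i mod length p) = x" using p(1,3) by (simp add: len(1) hd_conv_nth)
      ultimately show ?thesis by (simp add: insert_commute)
    qed
  qed (use len p in auto)
  then show ?thesis by blast
qed

text \<open>A cycle in the larger graph must use the new edge, and going round the rest of it
  connects \<open>x\<close> and \<open>y\<close> inside \<open>T\<close>.\<close>

lemma acyclic_insert:
  assumes T: "acyclic_graph T" and xy: "(x, y) \<notin> (edge_rel T)\<^sup>*"
  shows "acyclic_graph (insert {x, y} T)"
  unfolding acyclic_graph_def
proof
  assume "\<exists>c. is_cycle (insert {x, y} T) c"
  then obtain c where c: "is_cycle (insert {x, y} T) c" by blast
  define n where "n = length c"
  have n: "3 \<le> n" "distinct c" and edges: "\<And>k. k < n \<Longrightarrow> {c ! k, c ! (Suc k mod n)} \<in> insert {x, y} T"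
    using c by (auto simp: is_cycle_def n_def)
  have "\<not> is_cycle T c" using T by (auto simp: acyclic_graph_def)
  then obtain i where i: "i < n" "{c ! i, c ! (Suc i mod n)} = {x, y}"
    using c edges unfolding is_cycle_def n_def by blast
  \<comment> \<open>A cycle of length at least 3 passes through each edge only once, so all its
    other edges lie in \<open>T\<close>.\<close>
  have other: "{c ! k, c ! (Suc k mod n)} \<in> T" if k: "k < n" "k \<noteq> i" for k
  proof -
    have "{c ! k, c ! (Suc k mod n)} \<noteq> {c ! i, c ! (Suc i mod n)}"
    proof
      assume "{c ! k, c ! (Suc k mod n)} = {c ! i, c ! (Suc i mod n)}"
      then have "c ! k = c ! (Suc i mod n)" "c ! (Suc k mod n) = c ! i"
        using k i n(2) by (auto simp: doubleton_eq_iff nth_eq_iff_index_eq n_def)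
      moreover have "Suc i mod n < n" "Suc k mod n < n" using n by simp_all
      ultimately have "k = Suc i mod n" "Suc k mod n = i"
        using k i n(2) by (auto simp: nth_eq_iff_index_eq n_def)
      then show False using n(1) i(1) k by (auto simp: mod_Suc split: if_splits)
    qed
    then show ?thesis using edges[OF k(1)] i(2) by auto
  qed
  have path: "(c ! (Suc i mod n), c ! ((Suc i + m) mod n)) \<in> (edge_rel T)\<^sup>*" if "m < n" for m
    using that
  proof (induction m)
    case (Suc m)
    have ne: "(Suc i + m) mod n \<noteq> i"
    proof
      assume "(Suc i + m) mod n = i"
      then show False using Suc.prems i(1)
        by (cases "Suc i + m < n") (simp_all add: le_mod_geq)
    qed
    have "{c ! ((Suc i + m) mod n), c ! (Suc ((Suc i + m) mod n) mod n)} \<in> T"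
      by (rule other) (use ne n in simp_all)
    moreover have "Suc ((Suc i + m) mod n) mod n = (Suc i + Suc m) mod n" by (simp add: mod_Suc_eq)
    ultimately have "(c ! ((Suc i + m) mod n), c ! ((Suc i + Suc m) mod n)) \<in> edge_rel T"
      by (simp add: edge_rel_def)
    then show ?case using Suc by (meson Suc_lessD rtrancl.rtrancl_into_rtrancl)
  qed simp
  have "(Suc i + (n - 1)) mod n = i" using i(1) n(1) by simp
  then have "(c ! (Suc i mod n), c ! i) \<in> (edge_rel T)\<^sup>*" using path[of "n - 1"] n(1) by simp
  then have "(x, y) \<in> (edge_rel T)\<^sup>*" using i(2) sym_connected by (auto simp: doubleton_eq_iff)
  then show False using xy by blast
qed

section \<open>Spanning trees by deletion and contraction\<close>

text \<open>\<open>T\<close> holds the edges already chosen and \<open>es\<close> the undecided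
  ones, with their indices; the summands are the spanning trees that arise from \<open>T\<close> by
  adding undecided edges.\<close>

definition weight_sum :: "'v set \<Rightarrow> (nat \<Rightarrow> 'a::comm_ring_1) \<Rightarrow> (nat \<times> 'v set) list \<Rightarrow> 'v set set \<Rightarrow> 'a" where
  "weight_sum V x es T = (\<Sum>S\<in>Pow (snd ` set es).
     if connected_graph V (T \<union> S) \<and> acyclic_graph (T \<union> S)
     then \<Prod>(i, e) | (i, e) \<in> set es \<and> e \<notin> S. x i else 0)"

lemma weight_sum_Nil: "weight_sum V x [] T = (if connected_graph V T \<and> acyclic_graph T then 1 else 0)"
  unfolding weight_sum_def list.set image_empty Pow_empty by simp

lemma weight_sum_Cons:
  assumes e: "e \<notin> snd ` set es"
  shows "weight_sum V x ((i, e) # es) T = x i * weight_sum V x es T + weight_sum V x es (insert e T)"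
proof -
  let ?ok = "\<lambda>T. connected_graph V T \<and> acyclic_graph T"
  let ?p = "\<lambda>es S. \<Prod>(i, e) | (i, e) \<in> set es \<and> e \<notin> S. x i"
  let ?A = "snd ` set es"
  define g where "g S = (if ?ok (T \<union> S) then ?p ((i, e) # es) S else 0)" for S
  have "weight_sum V x ((i, e) # es) T = sum g (Pow ?A \<union> insert e ` Pow ?A)"
    unfolding weight_sum_def g_def by (simp add: Pow_insert)
  also have "\<dots> = sum g (Pow ?A) + sum g (insert e ` Pow ?A)"
    by (rule sum.union_disjoint) (use e in auto)
  also have "sum g (insert e ` Pow ?A) = (\<Sum>S\<in>Pow ?A. g (insert e S))"
  proof (rule sum.reindex[unfolded comp_def], rule inj_onI)
    fix S S' assume "S \<in> Pow ?A" "S' \<in> Pow ?A" "insert e S = insert e S'"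
    moreover have "e \<notin> S" "e \<notin> S'" using e calculation by auto
    ultimately show "S = S'" using insert_ident by metis
  qed
  also have "\<dots> = weight_sum V x es (insert e T)"
    unfolding weight_sum_def
  proof (rule sum.cong)
    fix S assume "S \<in> Pow ?A"
    have "{(j, e'). (j, e') \<in> set ((i, e) # es) \<and> e' \<notin> insert e S} = {(j, e'). (j, e') \<in> set es \<and> e' \<notin> S}"
      using e by (auto simp: image_iff)
    then show "g (insert e S) = (if ?ok (insert e T \<union> S) then ?p es S else 0)" by (simp add: g_def)
  qed simp
  also have "sum g (Pow ?A) = x i * weight_sum V x es T"
    unfolding weight_sum_def sum_distrib_left
  proof (rule sum.cong)
    fix S assume "S \<in> Pow ?A"
    then have "e \<notin> S" using e by auto
    then have "{(j, e'). (j, e') \<in> set ((i, e) # es) \<and> e' \<notin> S} = insert (i, e) {(j, e'). (j, e') \<in> set es \<and> e' \<notin> S}"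
      by auto
    moreover have "finite {(j, e'). (j, e') \<in> set es \<and> e' \<notin> S}"
      by (rule finite_subset[of _ "set es"]) auto
    moreover have "(i, e) \<notin> {(j, e'). (j, e') \<in> set es \<and> e' \<notin> S}" using e by (auto simp: image_iff)
    ultimately have "?p ((i, e) # es) S = x i * ?p es S" by simp
    then show "g S = x i * (if ?ok (T \<union> S) then ?p es S else 0)" by (simp add: g_def)
  qed simp
  finally show ?thesis .
qed

lemma weight_sum_cyclic: "\<not> acyclic_graph T \<Longrightarrow> weight_sum V x es T = 0"
proof -
  assume "\<not> acyclic_graph T"
  then have "\<not> acyclic_graph (T \<union> S)" for S
    unfolding acyclic_graph_def using is_cycle_mono[of T _ "T \<union> S"] by blast
  then show ?thesis by (simp add: weight_sum_def)
qed

text \<open>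
  \<open>L ! v\<close> labels the connected component of the vertex \<open>v\<close> in the forest chosen so far (\<open>L ! 0\<close> is a
  dummy); each list in the result consists of the indices of the edges that are left out.
\<close>

fun cotrees :: "(nat \<times> nat \<times> nat) list \<Rightarrow> nat list \<Rightarrow> nat list list" where
  "cotrees [] L = (if \<forall>v\<in>set (tl L). v = L ! 1 then [[]] else [])"
| "cotrees ((i, p, q) # es) L = map (Cons i) (cotrees es L) @
     (if L ! p = L ! q then [] else cotrees es (map (\<lambda>l. if l = L ! p then L ! q else l) L))"

definition tree_sum :: "(nat \<Rightarrow> 'a::comm_ring_1) \<Rightarrow> (nat \<times> nat \<times> nat) list \<Rightarrow> nat list \<Rightarrow> 'a" where
  "tree_sum x es L = (\<Sum>d\<leftarrow>cotrees es L. \<Prod>i\<leftarrow>d. x i)"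

lemma tree_sum_Nil: "tree_sum x [] L = (if \<forall>v\<in>set (tl L). v = L ! 1 then 1 else 0)"
  by (simp add: tree_sum_def)

lemma tree_sum_Cons: "tree_sum x ((i, p, q) # es) L = x i * tree_sum x es L +
    (if L ! p = L ! q then 0 else tree_sum x es (map (\<lambda>l. if l = L ! p then L ! q else l) L))"
  by (simp add: tree_sum_def comp_def sum_list_const_mult)

abbreviation edge_of :: "nat \<times> nat \<times> nat \<Rightarrow> nat \<times> nat set" where
  "edge_of \<equiv> \<lambda>(i, p, q). (i, {p, q})"

text \<open>The invariant is that two vertices have the same label exactly if \<open>T\<close>
  connects them. An edge inside a component would close a cycle and contributes nothing when chosen;
  any other edge merges two labels.\<close>

lemma tree_sum_eq:
  assumes "acyclic_graph T" "length L = Suc n"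
    and "\<And>p q. p \<in> {1..n} \<Longrightarrow> q \<in> {1..n} \<Longrightarrow> (p, q) \<in> (edge_rel T)\<^sup>* \<longleftrightarrow> L ! p = L ! q"
    and "\<And>i p q. (i, p, q) \<in> set es \<Longrightarrow> p \<in> {1..n} \<and> q \<in> {1..n} \<and> p \<noteq> q \<and> {p, q} \<notin> T"
    and "distinct (map (\<lambda>(i, p, q). {p, q}) es)" and "0 < n"
  shows "weight_sum {1..n} x (map edge_of es) T = tree_sum x es L"
  using assms
proof (induction es arbitrary: T L)
  case Nil
  have "connected_graph {1..n} T \<longleftrightarrow> (\<forall>p\<in>{1..n}. \<forall>q\<in>{1..n}. L ! p = L ! q)"
    unfolding connected_graph_def edge_rel_def[symmetric] by (intro ball_cong refl Nil.prems(3))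
  also have "\<dots> \<longleftrightarrow> (\<forall>p\<in>{1..n}. L ! p = L ! 1)"
  proof
    assume *: "\<forall>p\<in>{1..n}. L ! p = L ! 1"
    have "L ! p = L ! q" if "p \<in> {1..n}" "q \<in> {1..n}" for p q
      using bspec[OF * that(1)] bspec[OF * that(2)] by (rule trans[OF _ sym])
    then show "\<forall>p\<in>{1..n}. \<forall>q\<in>{1..n}. L ! p = L ! q" by blast
  next
    assume *: "\<forall>p\<in>{1..n}. \<forall>q\<in>{1..n}. L ! p = L ! q"
    have "1 \<in> {1..n}" using \<open>0 < n\<close> by simp
    then show "\<forall>p\<in>{1..n}. L ! p = L ! 1" using * by blast
  qed
  also have "\<dots> \<longleftrightarrow> (\<forall>v\<in>set (tl L). v = L ! 1)"
  proof -
    have "set (tl L) = {tl L ! k | k. k < n}" using Nil.prems(2) by (auto simp: set_conv_nth)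
    also have "\<dots> = (!) L ` {1..n}"
    proof (intro equalityI subsetI)
      fix v assume "v \<in> {tl L ! k | k. k < n}"
      then obtain k where "v = tl L ! k" "k < n" by blast
      then show "v \<in> (!) L ` {1..n}" using Nil.prems(2) by (intro image_eqI[of _ _ "Suc k"]) (simp_all add: nth_tl)
    next
      fix v assume "v \<in> (!) L ` {1..n}"
      then obtain p where "v = L ! p" "p \<in> {1..n}" by blast
      then show "v \<in> {tl L ! k | k. k < n}" using Nil.prems(2)
        by (intro CollectI exI[of _ "p - 1"]) (auto simp: nth_tl)
    qed
    finally show ?thesis by auto
  qed
  finally show ?case using Nil.prems(1) by (simp add: weight_sum_Nil tree_sum_Nil)
next
  case (Cons e es)
  obtain i p q where e: "e = (i, p, q)" by (cases e)
  have pq: "p \<in> {1..n}" "q \<in> {1..n}" "p \<noteq> q" "{p, q} \<notin> T" using Cons.prems(4)[of i p q] by (simp_all add: e)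
  have snd_edges: "snd ` set (map edge_of es) = set (map (\<lambda>(i, p, q). {p, q}) es)"
    by (simp add: image_image case_prod_unfold)
  have fresh: "{p, q} \<notin> snd ` set (map edge_of es)"
    unfolding snd_edges using Cons.prems(5) by (simp add: e)
  have split: "weight_sum {1..n} x (map edge_of (e # es)) T =
      x i * weight_sum {1..n} x (map edge_of es) T + weight_sum {1..n} x (map edge_of es) (insert {p, q} T)"
    using weight_sum_Cons[OF fresh, of "{1..n}" x i T] by (simp add: e)
  have 1: "weight_sum {1..n} x (map edge_of es) T = tree_sum x es L"
  proof (rule Cons.IH)
    show "(p, q) \<in> (edge_rel T)\<^sup>* \<longleftrightarrow> L ! p = L ! q" if "p \<in> {1..n}" "q \<in> {1..n}" for p q
      using that by (rule Cons.prems(3))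
    show "a \<in> {1..n} \<and> b \<in> {1..n} \<and> a \<noteq> b \<and> {a, b} \<notin> T" if "(j, a, b) \<in> set es" for j a b
      by (rule Cons.prems(4)[of j]) (simp add: that)
    show "distinct (map (\<lambda>(i, p, q). {p, q}) es)" using Cons.prems(5) by simp
  qed (fact Cons.prems)+
  show ?case
  proof (cases "L ! p = L ! q")
    case True
    then have "(p, q) \<in> (edge_rel T)\<^sup>*" using Cons.prems(3)[OF pq(1,2)] by simp
    then have "\<not> acyclic_graph (insert {p, q} T)"
      using cycle_of_connected[OF _ pq(3,4)] by (simp add: acyclic_graph_def)
    then show ?thesis using split 1 True by (simp add: e weight_sum_cyclic tree_sum_Cons)
  next
    case False
    let ?L = "map (\<lambda>l. if l = L ! p then L ! q else l) L"
    have "weight_sum {1..n} x (map edge_of es) (insert {p, q} T) = tree_sum x es ?L"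
    proof (rule Cons.IH)
      show "acyclic_graph (insert {p, q} T)"
        using acyclic_insert[OF Cons.prems(1)] Cons.prems(3)[OF pq(1,2)] False by simp
      show "length ?L = Suc n" using Cons.prems(2) by simp
      show "(a, b) \<in> (edge_rel (insert {p, q} T))\<^sup>* \<longleftrightarrow> ?L ! a = ?L ! b" if "a \<in> {1..n}" "b \<in> {1..n}" for a b
      proof -
        have nth: "?L ! v = (if L ! v = L ! p then L ! q else L ! v)" if "v \<in> {1..n}" for v
          using that Cons.prems(2) by simp
        show ?thesis
          unfolding connected_insert Cons.prems(3)[OF that] Cons.prems(3)[OF that(1) pq(1)]
            Cons.prems(3)[OF pq(2) that(2)] Cons.prems(3)[OF that(1) pq(2)] Cons.prems(3)[OF pq(1) that(2)]
            nth[OF that(1)] nth[OF that(2)]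
          using False by auto
      qed
      show "a \<in> {1..n} \<and> b \<in> {1..n} \<and> a \<noteq> b \<and> {a, b} \<notin> insert {p, q} T" if "(j, a, b) \<in> set es" for j a b
      proof -
        have ab: "{a, b} \<in> set (map (\<lambda>(i, p, q). {p, q}) es)"
          unfolding set_map using that by (rule rev_image_eqI) simp
        have "{a, b} \<noteq> {p, q}"
        proof
          assume "{a, b} = {p, q}"
          with ab have "{p, q} \<in> set (map (\<lambda>(i, p, q). {p, q}) es)" by (simp only:)
          with fresh show False unfolding snd_edges by (rule notE)
        qed
        then show ?thesis using Cons.prems(4)[of j a b] that by simp
      qed
      show "distinct (map (\<lambda>(i, p, q). {p, q}) es)" using Cons.prems(5) by simp
    qed fact
    then show ?thesis using split 1 False by (simp add: e tree_sum_Cons)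
  qed
qed

lemma graph_polynomial_weight_sum:
  assumes "distinct es"
  shows "graph_polynomial V es = weight_sum V Var (zip [1..<Suc (length es)] es) {}"
proof -
  let ?z = "zip [1..<Suc (length es)] es"
  have snd: "snd ` set ?z = set es"
    by (simp del: upt_Suc flip: set_map)
  have z: "set ?z = (\<lambda>i. (i, es ! (i - 1))) ` {1..length es}"
  proof (intro equalityI subsetI)
    fix w assume "w \<in> set ?z"
    then obtain k where "k < length es" "w = ([1..<Suc (length es)] ! k, es ! k)"
      by (auto simp: set_zip)
    then show "w \<in> (\<lambda>i. (i, es ! (i - 1))) ` {1..length es}"
      by (intro image_eqI[of _ _ "Suc k"]) (simp_all del: upt_Suc)
  next
    fix w assume "w \<in> (\<lambda>i. (i, es ! (i - 1))) ` {1..length es}"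
    then obtain i where "i \<in> {1..length es}" "w = (i, es ! (i - 1))" by blast
    then show "w \<in> set ?z"
      by (auto simp: set_zip simp del: upt_Suc intro!: exI[of _ "i - 1"])
  qed
  have prod: "(\<Prod>(i, e) | (i, e) \<in> set ?z \<and> e \<notin> T. Var i) =
      (\<Prod>i | i \<in> {1..length es} \<and> es ! (i - 1) \<notin> T. Var i :: 'b mpoly)" for T
  proof -
    have "{(i, e). (i, e) \<in> set ?z \<and> e \<notin> T} =
        (\<lambda>i. (i, es ! (i - 1))) ` {i. i \<in> {1..length es} \<and> es ! (i - 1) \<notin> T}"
      unfolding z by auto
    then show ?thesis by (simp only:) (subst prod.reindex, auto intro!: inj_onI)
  qed
  have "{T. spanning_tree V es T} = {T \<in> Pow (set es). connected_graph V T \<and> acyclic_graph T}"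
    by (auto simp: spanning_tree_def acyclic_graph_def)
  then have "graph_polynomial V es = (\<Sum>T\<in>{T \<in> Pow (set es). connected_graph V T \<and> acyclic_graph T}.
      \<Prod>i | i \<in> {1..length es} \<and> es ! (i - 1) \<notin> T. Var i)"
    by (simp only: graph_polynomial_def)
  also have "\<dots> = (\<Sum>T\<in>Pow (set es). if connected_graph V T \<and> acyclic_graph T
      then \<Prod>i | i \<in> {1..length es} \<and> es ! (i - 1) \<notin> T. Var i else 0)"
    by (rule sum.inter_filter) simp
  finally show ?thesis unfolding weight_sum_def snd prod by simp
qed

section \<open>The graph polynomial of the graph with ten edges\<close>

definition ZZ5_list :: "(nat \<times> nat \<times> nat) list" where
  "ZZ5_list = [(1, 1, 2), (2, 2, 3), (3, 3, 4), (4, 4, 5), (5, 5, 6), (6, 1, 3), (7, 2, 4), (8, 3, 5), (9, 4, 6), (10, 1, 6)]"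

lemma ZZ5_edges_eq: "ZZ5_edges = map (\<lambda>(i, p, q). {p, q}) ZZ5_list"
  by (simp add: ZZ5_edges_def ZZ5_list_def upt_rec eval_nat_numeral)

lemma Psi_ZZ5_tree_sum: "Psi_ZZ5 = tree_sum Var ZZ5_list [0, 1, 2, 3, 4, 5, 6]"
proof -
  have dist: "distinct (map (\<lambda>(i, p, q). {p, q}) ZZ5_list)"
    by (simp add: ZZ5_list_def doubleton_eq_iff)
  have "zip [1..<Suc (length ZZ5_edges)] ZZ5_edges = map edge_of ZZ5_list"
    unfolding ZZ5_edges_eq by (simp add: ZZ5_list_def upt_rec eval_nat_numeral)
  then have "Psi_ZZ5 = weight_sum {1..6} Var (map edge_of ZZ5_list) {}"
    unfolding Psi_ZZ5_def ZZ5_vertices_def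
    by (subst graph_polynomial_weight_sum) (simp_all only: ZZ5_edges_eq dist)
  also have "\<dots> = tree_sum Var ZZ5_list [0, 1, 2, 3, 4, 5, 6]"
  proof (rule tree_sum_eq)
    show "(p, q) \<in> (edge_rel {})\<^sup>* \<longleftrightarrow> [0, 1, 2, 3, 4, 5, 6] ! p = ([0, 1, 2, 3, 4, 5, 6] ! q :: nat)"
      if "p \<in> {1..6}" "q \<in> {1..6}" for p q
    proof -
      have nth: "[0, 1, 2, 3, 4, 5, 6] ! k = k" if "k \<in> {1..6}" for k :: nat
      proof -
        have "k \<in> {1, 2, 3, 4, 5, 6}"
          using that by (simp only: atLeastAtMost_iff insert_iff empty_iff) presburger
        then show ?thesis by (elim insertE emptyE) simp_all
      qed
      have "edge_rel {} = ({} :: (nat \<times> nat) set)" by (simp add: edge_rel_def)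
      then show ?thesis by (simp only: nth[OF that(1)] nth[OF that(2)] rtrancl_empty pair_in_Id_conv)
    qed
    show "acyclic_graph {}" by (auto simp: acyclic_graph_def is_cycle_def intro!: exI[of _ 0])
    show "distinct (map (\<lambda>(i, p, q). {p, q}) ZZ5_list)" by (rule dist)
    show "p \<in> {1..6} \<and> q \<in> {1..6} \<and> p \<noteq> q \<and> {p, q} \<notin> {}" if "(i, p, q) \<in> set ZZ5_list" for i p q
      using that by (auto simp: ZZ5_list_def)
  qed simp_all
  finally show ?thesis .
qed

text \<open>Each list has five entries, the number of independent cycles: ten edges minus the five
  edges of a spanning tree.\<close>

lemma cotrees_ZZ5: "cotrees ZZ5_list [0, 1, 2, 3, 4, 5, 6] =
    [[1, 2, 3, 4, 5], [1, 2, 3, 4, 6], [1, 2, 3, 4, 8], [1, 2, 3, 4, 10], [1, 2, 3, 5, 6], [1, 2, 3, 5, 8],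
     [1, 2, 3, 5, 9], [1, 2, 3, 5, 10], [1, 2, 3, 6, 9], [1, 2, 3, 8, 9], [1, 2, 3, 9, 10], [1, 2, 4, 5, 6],
     [1, 2, 4, 5, 9], [1, 2, 4, 5, 10], [1, 2, 4, 6, 8], [1, 2, 4, 6, 9], [1, 2, 4, 8, 9], [1, 2, 4, 8, 10],
     [1, 2, 4, 9, 10], [1, 2, 5, 6, 8], [1, 2, 5, 8, 9], [1, 2, 5, 8, 10], [1, 2, 6, 8, 9], [1, 2, 8, 9, 10],
     [1, 3, 4, 5, 6], [1, 3, 4, 5, 7], [1, 3, 4, 5, 9], [1, 3, 4, 5, 10], [1, 3, 4, 6, 7], [1, 3, 4, 6, 8],
     [1, 3, 4, 6, 9], [1, 3, 4, 7, 8], [1, 3, 4, 7, 10], [1, 3, 4, 8, 9], [1, 3, 4, 8, 10], [1, 3, 4, 9, 10],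
     [1, 3, 5, 6, 7], [1, 3, 5, 6, 8], [1, 3, 5, 7, 8], [1, 3, 5, 7, 9], [1, 3, 5, 7, 10], [1, 3, 5, 8, 9],
     [1, 3, 5, 8, 10], [1, 3, 6, 7, 9], [1, 3, 6, 8, 9], [1, 3, 7, 8, 9], [1, 3, 7, 9, 10], [1, 3, 8, 9, 10],
     [1, 4, 5, 6, 7], [1, 4, 5, 7, 9], [1, 4, 5, 7, 10], [1, 4, 6, 7, 8], [1, 4, 6, 7, 9], [1, 4, 7, 8, 9],
     [1, 4, 7, 8, 10], [1, 4, 7, 9, 10], [1, 5, 6, 7, 8], [1, 5, 7, 8, 9], [1, 5, 7, 8, 10], [1, 6, 7, 8, 9],
     [1, 7, 8, 9, 10], [2, 3, 4, 5, 7], [2, 3, 4, 5, 9], [2, 3, 4, 5, 10], [2, 3, 4, 6, 7], [2, 3, 4, 6, 9],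
     [2, 3, 4, 6, 10], [2, 3, 4, 7, 8], [2, 3, 4, 7, 10], [2, 3, 4, 8, 9], [2, 3, 4, 8, 10], [2, 3, 4, 9, 10],
     [2, 3, 5, 6, 7], [2, 3, 5, 6, 9], [2, 3, 5, 6, 10], [2, 3, 5, 7, 8], [2, 3, 5, 7, 9], [2, 3, 5, 7, 10],
     [2, 3, 5, 8, 9], [2, 3, 5, 8, 10], [2, 3, 6, 7, 9], [2, 3, 6, 9, 10], [2, 3, 7, 8, 9], [2, 3, 7, 9, 10],
     [2, 3, 8, 9, 10], [2, 4, 5, 6, 7], [2, 4, 5, 6, 9], [2, 4, 5, 6, 10], [2, 4, 5, 7, 9], [2, 4, 5, 7, 10],
     [2, 4, 6, 7, 8], [2, 4, 6, 7, 9], [2, 4, 6, 8, 9], [2, 4, 6, 8, 10], [2, 4, 6, 9, 10], [2, 4, 7, 8, 9],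
     [2, 4, 7, 8, 10], [2, 4, 7, 9, 10], [2, 5, 6, 7, 8], [2, 5, 6, 8, 9], [2, 5, 6, 8, 10], [2, 5, 7, 8, 9],
     [2, 5, 7, 8, 10], [2, 6, 7, 8, 9], [2, 6, 8, 9, 10], [2, 7, 8, 9, 10], [3, 4, 5, 6, 7], [3, 4, 5, 6, 9],
     [3, 4, 5, 6, 10], [3, 4, 6, 7, 8], [3, 4, 6, 7, 10], [3, 4, 6, 8, 9], [3, 4, 6, 8, 10], [3, 4, 6, 9, 10],
     [3, 5, 6, 7, 8], [3, 5, 6, 7, 9], [3, 5, 6, 7, 10], [3, 5, 6, 8, 9], [3, 5, 6, 8, 10], [3, 6, 7, 8, 9],
     [3, 6, 7, 9, 10], [3, 6, 8, 9, 10], [4, 5, 6, 7, 9], [4, 5, 6, 7, 10], [4, 6, 7, 8, 9], [4, 6, 7, 8, 10],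
     [4, 6, 7, 9, 10], [5, 6, 7, 8, 9], [5, 6, 7, 8, 10], [6, 7, 8, 9, 10]]"
  by code_simp

text \<open>The comparison of the list of spanning trees with the determinant of the cycle matrix;
  \<open>x7\<close> replaces \<open>D - y - u\<close>. The abbreviations enter as equations so that
  the expansion can be carried out in stages.\<close>

lemma ZZ5_cotree_identity:
  fixes x1 x2 x3 x4 x5 x6 x7 x8 x9 x10 :: "'a::comm_ring_1"
  assumes a: "a = x3 + x4 + x8" and t: "t = x1 + x7 + x9 + x10" and c: "c = x4 + x5 + x9"
    and b: "b = x1 + x2 + x6" and D: "D = x2 + x3 + x7" and sg: "sg = b * D - x2 * x2"
    and al: "al = b * (x3 * x3)" and ep: "ep = x1 * x1 * D + 2 * x1 * x2 * x7 + b * (x7 * x7)"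
    and ze: "ze = x3 * x3 * (x1 * x1)" and ka: "ka = x3 * (b * x7 + x2 * x1)"
  shows "x1 * x2 * x3 * x4 * x5 + x1 * x2 * x3 * x4 * x6 + x1 * x2 * x3 * x4 * x8 + x1 * x2 * x3 * x4 * x10 + x1 * x2 * x3 * x5 * x6 +
    x1 * x2 * x3 * x5 * x8 + x1 * x2 * x3 * x5 * x9 + x1 * x2 * x3 * x5 * x10 + x1 * x2 * x3 * x6 * x9 + x1 * x2 * x3 * x8 * x9 +
    x1 * x2 * x3 * x9 * x10 + x1 * x2 * x4 * x5 * x6 + x1 * x2 * x4 * x5 * x9 + x1 * x2 * x4 * x5 * x10 + x1 * x2 * x4 * x6 * x8 +
    x1 * x2 * x4 * x6 * x9 + x1 * x2 * x4 * x8 * x9 + x1 * x2 * x4 * x8 * x10 + x1 * x2 * x4 * x9 * x10 + x1 * x2 * x5 * x6 * x8 +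
    x1 * x2 * x5 * x8 * x9 + x1 * x2 * x5 * x8 * x10 + x1 * x2 * x6 * x8 * x9 + x1 * x2 * x8 * x9 * x10 + x1 * x3 * x4 * x5 * x6 +
    x1 * x3 * x4 * x5 * x7 + x1 * x3 * x4 * x5 * x9 + x1 * x3 * x4 * x5 * x10 + x1 * x3 * x4 * x6 * x7 + x1 * x3 * x4 * x6 * x8 +
    x1 * x3 * x4 * x6 * x9 + x1 * x3 * x4 * x7 * x8 + x1 * x3 * x4 * x7 * x10 + x1 * x3 * x4 * x8 * x9 + x1 * x3 * x4 * x8 * x10 +
    x1 * x3 * x4 * x9 * x10 + x1 * x3 * x5 * x6 * x7 + x1 * x3 * x5 * x6 * x8 + x1 * x3 * x5 * x7 * x8 + x1 * x3 * x5 * x7 * x9 +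
    x1 * x3 * x5 * x7 * x10 + x1 * x3 * x5 * x8 * x9 + x1 * x3 * x5 * x8 * x10 + x1 * x3 * x6 * x7 * x9 + x1 * x3 * x6 * x8 * x9 +
    x1 * x3 * x7 * x8 * x9 + x1 * x3 * x7 * x9 * x10 + x1 * x3 * x8 * x9 * x10 + x1 * x4 * x5 * x6 * x7 + x1 * x4 * x5 * x7 * x9 +
    x1 * x4 * x5 * x7 * x10 + x1 * x4 * x6 * x7 * x8 + x1 * x4 * x6 * x7 * x9 + x1 * x4 * x7 * x8 * x9 + x1 * x4 * x7 * x8 * x10 +
    x1 * x4 * x7 * x9 * x10 + x1 * x5 * x6 * x7 * x8 + x1 * x5 * x7 * x8 * x9 + x1 * x5 * x7 * x8 * x10 + x1 * x6 * x7 * x8 * x9 +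
    x1 * x7 * x8 * x9 * x10 + x2 * x3 * x4 * x5 * x7 + x2 * x3 * x4 * x5 * x9 + x2 * x3 * x4 * x5 * x10 + x2 * x3 * x4 * x6 * x7 +
    x2 * x3 * x4 * x6 * x9 + x2 * x3 * x4 * x6 * x10 + x2 * x3 * x4 * x7 * x8 + x2 * x3 * x4 * x7 * x10 + x2 * x3 * x4 * x8 * x9 +
    x2 * x3 * x4 * x8 * x10 + x2 * x3 * x4 * x9 * x10 + x2 * x3 * x5 * x6 * x7 + x2 * x3 * x5 * x6 * x9 + x2 * x3 * x5 * x6 * x10 +
    x2 * x3 * x5 * x7 * x8 + x2 * x3 * x5 * x7 * x9 + x2 * x3 * x5 * x7 * x10 + x2 * x3 * x5 * x8 * x9 + x2 * x3 * x5 * x8 * x10 +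
    x2 * x3 * x6 * x7 * x9 + x2 * x3 * x6 * x9 * x10 + x2 * x3 * x7 * x8 * x9 + x2 * x3 * x7 * x9 * x10 + x2 * x3 * x8 * x9 * x10 +
    x2 * x4 * x5 * x6 * x7 + x2 * x4 * x5 * x6 * x9 + x2 * x4 * x5 * x6 * x10 + x2 * x4 * x5 * x7 * x9 + x2 * x4 * x5 * x7 * x10 +
    x2 * x4 * x6 * x7 * x8 + x2 * x4 * x6 * x7 * x9 + x2 * x4 * x6 * x8 * x9 + x2 * x4 * x6 * x8 * x10 + x2 * x4 * x6 * x9 * x10 +
    x2 * x4 * x7 * x8 * x9 + x2 * x4 * x7 * x8 * x10 + x2 * x4 * x7 * x9 * x10 + x2 * x5 * x6 * x7 * x8 + x2 * x5 * x6 * x8 * x9 +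
    x2 * x5 * x6 * x8 * x10 + x2 * x5 * x7 * x8 * x9 + x2 * x5 * x7 * x8 * x10 + x2 * x6 * x7 * x8 * x9 + x2 * x6 * x8 * x9 * x10 +
    x2 * x7 * x8 * x9 * x10 + x3 * x4 * x5 * x6 * x7 + x3 * x4 * x5 * x6 * x9 + x3 * x4 * x5 * x6 * x10 + x3 * x4 * x6 * x7 * x8 +
    x3 * x4 * x6 * x7 * x10 + x3 * x4 * x6 * x8 * x9 + x3 * x4 * x6 * x8 * x10 + x3 * x4 * x6 * x9 * x10 + x3 * x5 * x6 * x7 * x8 +
    x3 * x5 * x6 * x7 * x9 + x3 * x5 * x6 * x7 * x10 + x3 * x5 * x6 * x8 * x9 + x3 * x5 * x6 * x8 * x10 + x3 * x6 * x7 * x8 * x9 +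
    x3 * x6 * x7 * x9 * x10 + x3 * x6 * x8 * x9 * x10 + x4 * x5 * x6 * x7 * x9 + x4 * x5 * x6 * x7 * x10 + x4 * x6 * x7 * x8 * x9 +
    x4 * x6 * x7 * x8 * x10 + x4 * x6 * x7 * x9 * x10 + x5 * x6 * x7 * x8 * x9 + x5 * x6 * x7 * x8 * x10 + x6 * x7 * x8 * x9 * x10 =
    c * (sg * a * t - ep * a - al * t + ze) - x4 * x4 * (sg * t - ep) - 2 * x4 * x9 * ka - x9 * x9 * (sg * a - al)"
proof -
  \<comment> \<open>Expanding \<open>sg\<close> first cancels \<open>x2 * x2\<close> and leaves
    eight monomials without signs, before the large products are formed.\<close>
  have sg': "sg = x1 * x2 + x1 * x3 + x1 * x7 + x2 * x3 + x2 * x7 + x6 * x2 + x6 * x3 + x6 * x7"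
    unfolding sg b D by (simp add: algebra_simps)
  show ?thesis
    unfolding a t c sg' al ep ze ka unfolding b D by (simp add: algebra_simps)
qed

lemma Psi_ZZ5_eq: "Psi_ZZ5 = (zz5_psi :: 'a::comm_ring_1 mpoly)"
proof -
  have "Psi_ZZ5 = (\<Sum>d\<leftarrow>cotrees ZZ5_list [0, 1, 2, 3, 4, 5, 6]. \<Prod>i\<leftarrow>d. Var i :: 'a mpoly)"
    by (simp only: Psi_ZZ5_tree_sum tree_sum_def)
  also have "\<dots> = zz5_psi"
  proof -
    have p: "Var 2 + Var 3 + Var 7 - Var 2 - Var 3 = (Var 7 :: 'a mpoly)" by simp
    show ?thesis
      unfolding zz5_psi_def Let_def p power2_eq_square cotrees_ZZ5
      using ZZ5_cotree_identity[OF refl refl refl refl refl refl refl refl refl refl,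
        where ?x1.0 = "Var 1 :: 'a mpoly" and ?x2.0 = "Var 2" and ?x3.0 = "Var 3" and ?x4.0 = "Var 4"
          and ?x5.0 = "Var 5" and ?x6.0 = "Var 6" and ?x7.0 = "Var 7" and ?x8.0 = "Var 8"
          and ?x9.0 = "Var 9" and ?x10.0 = "Var 10"]
      by (simp only: list.map sum_list.Cons sum_list.Nil prod_list.Cons prod_list.Nil
          mult_1_right add_0_right mult.assoc add.assoc)
  qed
  finally show ?thesis .
qed

theorem corollary2p3p5:
  shows "class_span 10 Psi_ZZ5 9 (eta_ZZ5 :: 'k::{alg_closed_field, field_char_0} form) =
    de_rham_cohomology 10 Psi_ZZ5 9"
  unfolding eta_ZZ5_def by (rule class_span_zz5[OF Psi_ZZ5_eq])

end
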